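(* Let $K:\mathbb{R}\to\mathbb{R}$ be admissible and let $(u_0,u_1)\in X$. Let $u$ be the corresponding global solution to $$-\partial_t^2u+\partial_x^2u=K(x)u^3,\qquad (u,\partial_tu)|_{t=0}=(u_0,u_1).$$ Then there exist unique $(U_+,V_+)\in Y$ such that $$\lim_{t\to\infty}\bigl\|S(-t)(u(t),\partial_tu(t))-(U_+,V_+)\bigr\|_Y=0.$$
   Context: All functions are real-valued; $t$ is time and $x\in\mathbb{R}$ is the one-dimensional space variable. $\langle x\rangle=\sqrt{1+x^2}$. Admissible: $K:\mathbb{R}\to\mathbb{R}$ is called admissible if $K$ is smooth, nonnegative, compactly supported in $[-1,1]$, and satisfies (i) $K(0)>0$ and (ii) $xK'(x)\le 0$ for all $x\in\mathbb{R}$. Global solution: for $(u_0,u_1)\in H^1(\mathbb{R})\times L^2(\mathbb{R})$, the solution of the nonlinear equation is the unique function $u\in C(\mathbb{R};H^1)\cap C^1(\mathbb{R};L^2)$ satisfying $$u(t,x)=u_L(t,x)-\tfrac12\int_0^t\int_{x-(t-s)}^{x+(t-s)}K(y)u(s,y)^3\,dy\,ds,$$ where $u_L(t,x)=\tfrac12(u_0(x+t)+u_0(x-t))+\tfrac12\int_{x-t}^{x+t}u_1(s)\,ds$ is the solution of the linear wave equation with the same data. Spaces: $X=\{(u_0,u_1)\in H^1(\mathbb{R})\times L^2(\mathbb{R}): (u_0,u_1)\text{ compactly supported}\}$, and $Y=\dot H^1(\mathbb{R},\langle x\rangle^{-1}dx)\times L^2(\mathbb{R},\langle x\rangle^{-1}dx)$,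 with norm given by $\|(f,g)\|_Y^2=\int_{\mathbb{R}}\langle x\rangle^{-1}|\partial_xf(x)|^2dx+\int_{\mathbb{R}}\langle x\rangle^{-1}|g(x)|^2dx$; as usual for homogeneous spaces, the first component is understood modulo additive constants. Linear group: $S(t)$, $t\in\mathbb{R}$, is the linear solution operator $$S(t)=\begin{pmatrix}\cos(t|\nabla|)&|\nabla|^{-1}\sin(t|\nabla|)\\-|\nabla|\sin(t|\nabla|)&\cos(t|\nabla|)\end{pmatrix},$$ which is unitary on $\dot H^1\times L^2$; equivalently $S(t)(f,g)=(w(t),\partial_tw(t))$ with $w(t,x)=\tfrac12(f(x+t)+f(x-t))+\tfrac12\int_{x-t}^{x+t}g(s)\,ds$. *)

theory Defs
  imports "HOL-Analysis.Analysis"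
begin

text \<open>Elements of Lebesgue and Sobolev spaces are represented by Borel measurable functions, and two
  functions that agree almost everywhere represent the same element.\<close>

definition jap :: "real \<Rightarrow> real" where
  "jap x = sqrt (1 + x\<^sup>2)"

definition smooth :: "(real \<Rightarrow> real) \<Rightarrow> bool" where
  "smooth f \<longleftrightarrow> (\<forall>n. (deriv ^^ n) f differentiable_on UNIV)"

definition admissible :: "(real \<Rightarrow> real) \<Rightarrow> bool" where
  "admissible K \<longleftrightarrow>
     smooth K \<and> (\<forall>x. 0 \<le> K x) \<and> closure {x. K x \<noteq> 0} \<subseteq> {-1..1} \<and>
     0 < K 0 \<and> (\<forall>x. x * deriv K x \<le> 0)"


definition test_function :: "(real \<Rightarrow> real) \<Rightarrow> bool" where
  "test_function \<phi> \<longleftrightarrow> smooth \<phi> \<and> compact (closure {x. \<phi> x \<noteq> 0})"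

definition locally_integrable :: "(real \<Rightarrow> real) \<Rightarrow> bool" where
  "locally_integrable f \<longleftrightarrow> (\<forall>C. compact C \<longrightarrow> set_integrable lborel C f)"

definition has_weak_deriv :: "(real \<Rightarrow> real) \<Rightarrow> (real \<Rightarrow> real) \<Rightarrow> bool" where
  "has_weak_deriv f g \<longleftrightarrow>
     locally_integrable f \<and> locally_integrable g \<and>
     (\<forall>\<phi>. test_function \<phi> \<longrightarrow>
        (LINT x|lborel. f x * deriv \<phi> x) = - (LINT x|lborel. g x * \<phi> x))"

text \<open>A weak derivative is unique up to null sets, so the choice is immaterial.\<close>

definition weak_deriv :: "(real \<Rightarrow> real) \<Rightarrow> real \<Rightarrow> real" where
  "weak_deriv f = (SOME g. has_weak_deriv f g)"


definition L2 :: "(real \<Rightarrow> real) set" where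
  "L2 = {f. f \<in> borel_measurable lborel \<and> integrable lborel (\<lambda>x. (f x)\<^sup>2)}"

definition L2_norm :: "(real \<Rightarrow> real) \<Rightarrow> real" where
  "L2_norm f = sqrt (LINT x|lborel. (f x)\<^sup>2)"

definition H1 :: "(real \<Rightarrow> real) set" where
  "H1 = {f \<in> L2. \<exists>g \<in> L2. has_weak_deriv f g}"

definition H1_norm :: "(real \<Rightarrow> real) \<Rightarrow> real" where
  "H1_norm f = sqrt ((L2_norm f)\<^sup>2 + (L2_norm (weak_deriv f))\<^sup>2)"

text \<open>Compact support of an almost-everywhere class.\<close>

definition ess_compact_support :: "(real \<Rightarrow> real) \<Rightarrow> bool" where
  "ess_compact_support f \<longleftrightarrow> (\<exists>C. compact C \<and> (AE x in lborel. x \<notin> C \<longrightarrow> f x = 0))"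

definition X_space :: "((real \<Rightarrow> real) \<times> (real \<Rightarrow> real)) set" where
  "X_space = {(f, g). f \<in> H1 \<and> g \<in> L2 \<and> ess_compact_support f \<and> ess_compact_support g}"


definition weighted_L2 :: "(real \<Rightarrow> real) set" where
  "weighted_L2 = {g. g \<in> borel_measurable lborel \<and> integrable lborel (\<lambda>x. (g x)\<^sup>2 / jap x)}"

definition Y_space :: "((real \<Rightarrow> real) \<times> (real \<Rightarrow> real)) set" where
  "Y_space = {(f, g). (\<exists>f' \<in> weighted_L2. has_weak_deriv f f') \<and> g \<in> weighted_L2}"

definition Y_norm :: "(real \<Rightarrow> real) \<times> (real \<Rightarrow> real) \<Rightarrow> real" where
  "Y_norm = (\<lambda>(f, g). sqrt ((LINT x|lborel. (weak_deriv f x)\<^sup>2 / jap x) +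
                            (LINT x|lborel. (g x)\<^sup>2 / jap x)))"

text \<open>Equality in \<open>Y\<close>: the first component is taken modulo additive constants.\<close>

definition Y_eq :: "(real \<Rightarrow> real) \<times> (real \<Rightarrow> real) \<Rightarrow> (real \<Rightarrow> real) \<times> (real \<Rightarrow> real) \<Rightarrow> bool" where
  "Y_eq = (\<lambda>(f, g) (f', g').
     (\<exists>c. AE x in lborel. f x = f' x + c) \<and> (AE x in lborel. g x = g' x))"


text \<open>Time derivative of a curve of functions, the difference quotients converging in
  the \<open>L\<^sup>2\<close> norm.  Only the increments, not the curve itself, have to lie in
  \<open>L\<^sup>2\<close>, so that a linear wave whose data have first component merely in the homogeneous
  space is covered too.\<close>

definition has_L2_time_deriv ::
    "(real \<Rightarrow> real \<Rightarrow> real) \<Rightarrow> (real \<Rightarrow> real) \<Rightarrow> real \<Rightarrow> bool" where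
  "has_L2_time_deriv w v t \<longleftrightarrow>
     v \<in> L2 \<and> (\<forall>h. (\<lambda>x. w (t + h) x - w t x) \<in> L2) \<and>
     ((\<lambda>h. L2_norm (\<lambda>x. (w (t + h) x - w t x) / h - v x)) \<longlongrightarrow> 0) (at 0)"

definition L2_time_deriv :: "(real \<Rightarrow> real \<Rightarrow> real) \<Rightarrow> real \<Rightarrow> real \<Rightarrow> real" where
  "L2_time_deriv w t = (SOME v. has_L2_time_deriv w v t)"

definition C_H1 :: "(real \<Rightarrow> real \<Rightarrow> real) \<Rightarrow> bool" where
  "C_H1 u \<longleftrightarrow>
     (\<forall>t. u t \<in> H1) \<and>
     (\<forall>t. ((\<lambda>s. H1_norm (\<lambda>x. u s x - u t x)) \<longlongrightarrow> 0) (at t))"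

definition C1_L2 :: "(real \<Rightarrow> real \<Rightarrow> real) \<Rightarrow> bool" where
  "C1_L2 u \<longleftrightarrow>
     (\<forall>t. u t \<in> L2) \<and>
     (\<forall>t. \<exists>v. has_L2_time_deriv u v t) \<and>
     (\<forall>t. ((\<lambda>s. L2_norm (\<lambda>x. L2_time_deriv u s x - L2_time_deriv u t x)) \<longlongrightarrow> 0) (at t))"


text \<open>The interval integrals \<open>LBINT s=a..b\<close> are oriented, so the formulas hold for both signs
  of the time variable.\<close>

definition linear_wave :: "(real \<Rightarrow> real) \<Rightarrow> (real \<Rightarrow> real) \<Rightarrow> real \<Rightarrow> real \<Rightarrow> real" where
  "linear_wave f g t x =
     (f (x + t) + f (x - t)) / 2 + (LBINT s=ereal (x - t)..ereal (x + t). g s) / 2"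

definition wave_group ::
    "real \<Rightarrow> (real \<Rightarrow> real) \<times> (real \<Rightarrow> real) \<Rightarrow> (real \<Rightarrow> real) \<times> (real \<Rightarrow> real)" where
  "wave_group t = (\<lambda>(f, g). (linear_wave f g t, L2_time_deriv (linear_wave f g) t))"

definition global_solution ::
    "(real \<Rightarrow> real) \<Rightarrow> (real \<Rightarrow> real) \<Rightarrow> (real \<Rightarrow> real) \<Rightarrow> (real \<Rightarrow> real \<Rightarrow> real) \<Rightarrow> bool" where
  "global_solution K u0 u1 u \<longleftrightarrow>
     C_H1 u \<and> C1_L2 u \<and>
     (\<forall>t. AE x in lborel.
        u t x = linear_wave u0 u1 t x -
          (LBINT s=ereal 0..ereal t.
             (LBINT y=ereal (x - (t - s))..ereal (x + (t - s)). K y * (u s y) ^ 3)) / 2)"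

definition scatters_to ::
    "(real \<Rightarrow> real \<Rightarrow> real) \<Rightarrow> (real \<Rightarrow> real) \<times> (real \<Rightarrow> real) \<Rightarrow> bool" where
  "scatters_to u = (\<lambda>(U, V).
     ((\<lambda>t. Y_norm (wave_group (- t) (u t, L2_time_deriv u t) - (U, V))) \<longlongrightarrow> 0) at_top)"

end

theory Submission
  imports Defs
begin

text \<open>
  Put \<open>F = K u\<^sup>3\<close>.  By Duhamel's formula, \<open>S(-t)(u(t), \<partial>\<^sub>t u(t))\<close> differs from the data by integrals of
  \<open>F\<close> along characteristics: the derivative of its first component and its second component are
  \<open>\<partial>\<^sub>x u0 - (P t - N t) / 2\<close> and \<open>u1 - (P t + N t) / 2\<close>, where \<open>P t z = \<integral>\<^sub>0\<^sup>t F(s, z - s) ds\<close> and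
  \<open>N t z = \<integral>\<^sub>0\<^sup>t F(s, z + s) ds\<close> (\<open>left_char\<close> and \<open>right_char\<close> below; lemma
  \<open>wave_group_of_solution\<close>).  As \<open>F\<close> is supported in \<open>\<bar>x\<bar> \<le> 1\<close>, the value \<open>P t z\<close> no longer changes
  once \<open>t \<ge> \<bar>z\<bar> + 1\<close>, so the pointwise limit exists trivially, and \<open>P t\<close> differs from it only
  where the weight is at most \<open>1 / (t - 1)\<close>.  Hence convergence in \<open>Y\<close> follows as soon as \<open>P t\<close> and
  \<open>N t\<close> are bounded in the unweighted \<open>L\<^sup>2\<close> space
  (\<open>weighted_convergence_if_stationary\<close>).

  The bound is an energy identity (\<open>energy_bound\<close>).  The data have compact support, so after some
  time the free part of \<open>u\<close> is constant on \<open>\<bar>x\<bar> \<le> 1\<close>.  There \<open>u\<close> is then continuously differentiable,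
  whatever the regularity of the data, with null derivatives \<open>- P t (x + t)\<close> and \<open>- N t (x - t)\<close>.  From
  \<open>\<partial>\<^sub>t P t z = F(t, z - t)\<close> and \<open>\<partial>\<^sub>t N t z = F(t, z + t)\<close> it follows that
  \<open>\<integral> (P t z)\<^sup>2 + (N t z)\<^sup>2 dz + \<integral> K u\<^sup>4 dx\<close> is constant in time, and all its terms are nonnegative.  No
  decay of the solution is needed.

  Most of the work is the interplay with weak derivatives and derivatives in the mean square sense.
  Functions with a weak derivative are primitives up to null sets (\<open>AE_prim_if_has_weak_deriv\<close>);
  the test functions needed for this are built from \<open>K\<close> itself, which is a smooth bump.  The
  Sobolev embedding yields a jointly continuous representative of \<open>u\<close>
  (\<open>C_H1_continuous_representative\<close>).  The time derivative hidden in the linear group is obtained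
  from the differentiability of \<open>u\<close> at time \<open>0\<close>, and mean square derivatives are identified by
  integrating over bounded intervals (\<open>L2_time_deriv_of_null_form\<close>).  Uniqueness of the limit is
  uniqueness of limits in the weighted space together with the representation by primitives.
\<close>

section \<open>Locally integrable functions and their primitives\<close>

lemma AE_affine:
  fixes P :: "real \<Rightarrow> bool"
  assumes "AE x in lborel. P x" and "c \<noteq> 0"
  shows "AE x in lborel. P (t + c * x)"
proof -
  obtain N where N: "{x \<in> space lborel. \<not> P x} \<subseteq> N" "emeasure lborel N = 0" "N \<in> sets lborel"
    using AE_E[OF assms(1)] by blast
  have [measurable]: "N \<in> sets borel" using N(3) by simp
  have "AE x in lborel. x \<notin> N" using N by (intro AE_not_in) auto
  then have "AE x in lborel. t + c * x \<notin> N"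
    using assms(2) by (intro AE_borel_affine[where P = "\<lambda>x. x \<notin> N"]) auto
  then show ?thesis by eventually_elim (use N(1) in auto)
qed

lemma AE_shift:
  fixes P :: "real \<Rightarrow> bool"
  assumes "AE x in lborel. P x"
  shows "AE x in lborel. P (x + t)" "AE x in lborel. P (x - t)"
  using AE_affine[OF assms, of 1 t] AE_affine[OF assms, of 1 "-t"] by (simp_all add: add.commute)

lemma continuous_AE_eq:
  fixes f g :: "real \<Rightarrow> real"
  assumes "continuous_on UNIV f" "continuous_on UNIV g" and ae: "AE x in lborel. f x = g x"
  shows "f x = g x"
proof (rule ccontr)
  assume ne: "f x \<noteq> g x"
  have "open {x. f x \<noteq> g x}" using assms(1,2) by (rule open_Collect_neq)
  then obtain e where e: "e > 0" "ball x e \<subseteq> {x. f x \<noteq> g x}"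
    using ne unfolding open_contains_ball by auto
  have [measurable]: "f \<in> borel_measurable borel" "g \<in> borel_measurable borel"
    using assms(1,2) by (auto intro: borel_measurable_continuous_onI)
  have "emeasure lborel {x. f x \<noteq> g x} = 0"
    using AE_iff_measurable[of "{x. f x \<noteq> g x}" lborel "\<lambda>x. f x = g x"] ae by simp
  moreover have "{x. f x \<noteq> g x} \<in> sets lborel"
    using borel_open[OF \<open>open {x. f x \<noteq> g x}\<close>] by simp
  ultimately have "emeasure lborel (ball x e) = 0"
    using emeasure_mono[OF e(2), of lborel] by (metis le_zero_eq)
  then have "emeasure lborel {x - e<..<x + e} = 0" by (simp only: ball_eq_greaterThanLessThan)
  then show False using e(1) by simp
qed

lemma locally_integrable_measurable [dest]:
  assumes "locally_integrable f" shows "f \<in> borel_measurable borel"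
proof -
  have "(\<lambda>x. indicator {- real n..real n} x *\<^sub>R f x) \<in> borel_measurable borel" for n
  proof -
    have "integrable lborel (\<lambda>x. indicator {- real n..real n} x *\<^sub>R f x)"
      using assms by (simp add: locally_integrable_def set_integrable_def)
    then show ?thesis by simp
  qed
  moreover have "(\<lambda>n. indicator {- real n..real n} x *\<^sub>R f x) \<longlonglongrightarrow> f x" for x
  proof -
    obtain m where m: "real m \<ge> \<bar>x\<bar>" using real_arch_simple by blast
    have "eventually (\<lambda>n. indicator {- real n..real n} x *\<^sub>R f x = f x) sequentially"
      using eventually_ge_at_top[of m]
      by eventually_elim (use m in \<open>auto simp: indicator_def abs_le_iff\<close>)
    then show ?thesis by (rule tendsto_eventually)
  qed
  ultimately show ?thesis
    using borel_measurable_LIMSEQ_real[of borel "\<lambda>n x. indicator {- real n..real n} x *\<^sub>R f x" f] by blast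
qed

lemma locally_integrable_interval:
  "locally_integrable f \<Longrightarrow> set_integrable lborel {a..b} f"
  by (auto simp: locally_integrable_def)

lemma locally_integrableI:
  assumes [measurable]: "f \<in> borel_measurable borel"
    and "\<And>a b. set_integrable lborel {a..b} f"
  shows "locally_integrable f"
  unfolding locally_integrable_def
proof (intro allI impI)
  fix C :: "real set" assume C: "compact C"
  then obtain r where "C \<subseteq> {-r..r}"
    using bounded_subset_cbox_symmetric[OF compact_imp_bounded] by (metis cbox_interval)
  moreover have "C \<in> sets borel" using C by (simp add: borel_compact)
  ultimately show "set_integrable lborel C f"
    using set_integrable_subset[OF assms(2), of C] by auto
qed

lemma locally_integrable_interval_integrable:
  fixes a b :: real
  assumes "locally_integrable f"
  shows "interval_lebesgue_integrable lborel (ereal a) (ereal b) f"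
  using assms set_integrable_subset[OF locally_integrable_interval[OF assms, of "min a b" "max a b"]]
  by (auto simp: interval_lebesgue_integrable_def intro: set_integrable_subset[OF locally_integrable_interval[OF assms, of "min a b" "max a b"]])

lemma locally_integrable_lincomb:
  assumes "locally_integrable f" "locally_integrable g"
  shows "locally_integrable (\<lambda>x. p * f x + q * g x)"
  using assms unfolding locally_integrable_def by auto

lemma locally_integrable_add:
  assumes "locally_integrable f" "locally_integrable g"
  shows "locally_integrable (\<lambda>x. f x + g x)"
  using locally_integrable_lincomb[OF assms, of 1 1] by simp

lemma locally_integrable_diff:
  assumes "locally_integrable f" "locally_integrable g"
  shows "locally_integrable (\<lambda>x. f x - g x)"
  using locally_integrable_lincomb[OF assms, of 1 "-1"] by simp

lemma locally_integrable_affine: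
  assumes "locally_integrable f" and c: "c \<noteq> 0"
  shows "locally_integrable (\<lambda>x. f (t + c * x))"
proof (rule locally_integrableI)
  have [measurable]: "f \<in> borel_measurable borel" using assms(1) by auto
  show "(\<lambda>x. f (t + c * x)) \<in> borel_measurable borel" by measurable
  fix a b :: real
  let ?l = "min (t + c * a) (t + c * b)" and ?u = "max (t + c * a) (t + c * b)"
  have "integrable lborel (\<lambda>x. indicator {?l..?u} x *\<^sub>R f x)"
    using locally_integrable_interval[OF assms(1)] by (simp add: set_integrable_def)
  then have "integrable lborel (\<lambda>x. indicator {?l..?u} (t + c * x) *\<^sub>R f (t + c * x))"
    using lborel_integrable_real_affine[OF _ c] by blast
  then have "set_integrable lborel {x. t + c * x \<in> {?l..?u}} (\<lambda>x. f (t + c * x))"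
    by (simp add: set_integrable_def indicator_def)
  moreover have "{a..b} \<subseteq> {x. t + c * x \<in> {?l..?u}}"
  proof
    fix x assume x: "x \<in> {a..b}"
    show "x \<in> {x. t + c * x \<in> {?l..?u}}"
    proof (cases "c > 0")
      case True
      then have "c * a \<le> c * x" "c * x \<le> c * b" using x by auto
      then show ?thesis by auto
    next
      case False
      then have "c * x \<le> c * a" "c * b \<le> c * x" using x c by (auto simp: mult_left_mono_neg)
      then show ?thesis by auto
    qed
  qed
  ultimately show "set_integrable lborel {a..b} (\<lambda>x. f (t + c * x))"
    using set_integrable_subset[of lborel _ "\<lambda>x. f (t + c * x)" "{a..b}"] by auto
qed

lemma locally_integrable_shift:
  assumes "locally_integrable f"
  shows "locally_integrable (\<lambda>x. f (x + t))" "locally_integrable (\<lambda>x. f (x - t))"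
  using locally_integrable_affine[OF assms, of 1 t] locally_integrable_affine[OF assms, of 1 "-t"]
  by (simp_all add: add.commute)

lemma locally_integrable_continuous:
  assumes "continuous_on UNIV (f :: real \<Rightarrow> real)"
  shows "locally_integrable f"
  using assms by (intro locally_integrableI borel_measurable_continuous_onI borel_integrable_atLeastAtMost')
    (auto intro: continuous_on_subset)

lemma locally_integrable_cong_AE:
  assumes "locally_integrable f" "g \<in> borel_measurable borel" "AE x in lborel. f x = g x"
  shows "locally_integrable g"
proof (rule locally_integrableI[OF assms(2)])
  fix a b :: real
  have "f \<in> borel_measurable lborel" "g \<in> borel_measurable lborel" using assms(1,2) by auto
  moreover have "AE x\<in>{a..b} in lborel. f x = g x" using assms(3) by auto
  ultimately show "set_integrable lborel {a..b} g"
    using set_integrable_cong_AE[of f lborel g "{a..b}"] locally_integrable_interval[OF assms(1), of a b]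
    by simp
qed

text \<open>The primitive, normalized to vanish at the origin, of a locally integrable function.\<close>

definition prim :: "(real \<Rightarrow> real) \<Rightarrow> real \<Rightarrow> real" where
  "prim g x = (LBINT y=ereal 0..ereal x. g y)"

lemma prim_0 [simp]: "prim g 0 = 0"
  by (simp add: prim_def)

lemma LBINT_eq_prim:
  assumes "locally_integrable g"
  shows "(LBINT y=ereal a..ereal b. g y) = prim g b - prim g a"
proof -
  have "(LBINT y=ereal 0..ereal a. g y) + (LBINT y=ereal a..ereal b. g y) = (LBINT y=ereal 0..ereal b. g y)"
    using locally_integrable_interval_integrable[OF assms, of "min 0 (min a b)" "max 0 (max a b)"]
    by (intro interval_integral_sum) (simp add: max_def min_def split: if_splits)
  then show ?thesis by (simp add: prim_def)
qed

lemma integral_eq_prim: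
  assumes "locally_integrable g" "a \<le> b"
  shows "(LINT y:{a..b}|lborel. g y) = prim g b - prim g a"
  using LBINT_eq_prim[OF assms(1), of a b] interval_integral_Icc[OF assms(2)] by metis

lemma hk_integral_eq_prim:
  assumes "locally_integrable g" "a \<le> b"
  shows "integral {a..b} g = prim g b - prim g a"
  using integral_eq_prim[OF assms] set_borel_integral_eq_integral(2)[OF locally_integrable_interval[OF assms(1)]] by metis

lemma prim_lincomb:
  assumes "locally_integrable f" "locally_integrable g"
  shows "prim (\<lambda>x. p * f x + q * g x) x = p * prim f x + q * prim g x"
  unfolding prim_def
  using assms[THEN locally_integrable_interval_integrable] by (subst interval_lebesgue_integral_add) auto

lemma prim_add:
  assumes "locally_integrable f" "locally_integrable g"
  shows "prim (\<lambda>x. f x + g x) x = prim f x + prim g x"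
  using prim_lincomb[OF assms, of 1 1] by simp

lemma prim_diff:
  assumes "locally_integrable f" "locally_integrable g"
  shows "prim (\<lambda>x. f x - g x) x = prim f x - prim g x"
  using prim_lincomb[OF assms, of 1 "-1"] by simp

lemma prim_cong_AE:
  assumes "f \<in> borel_measurable borel" "g \<in> borel_measurable borel" "AE x in lborel. f x = g x"
  shows "prim f x = prim g x"
  unfolding prim_def using assms by (intro interval_integral_cong_AE) auto

lemma interval_integral_shift:
  "(LBINT y=ereal a..ereal b. g (y + t)) = (LBINT y=ereal (a + t)..ereal (b + t). g y)"
proof -
  have *: "(LBINT y:{a<..<b}. g (y + t)) = (LBINT y:{a + t<..<b + t}. g y)" for a b :: real
  proof -
    have "(LBINT y:{a + t<..<b + t}. g y)
        = (LINT y|lborel. indicator {a + t<..<b + t} (t + 1 * y) *\<^sub>R g (t + 1 * y))"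
      unfolding set_lebesgue_integral_def
      using lborel_integral_real_affine[of 1 "\<lambda>y. indicator {a + t<..<b + t} y *\<^sub>R g y" t] by simp
    also have "\<dots> = (LBINT y:{a<..<b}. g (y + t))"
      unfolding set_lebesgue_integral_def
      by (intro Bochner_Integration.integral_cong) (auto simp: indicator_def add.commute)
    finally show ?thesis by (rule sym)
  qed
  show ?thesis
    unfolding interval_lebesgue_integral_def einterval_eq * by simp
qed

lemma prim_shift:
  assumes "locally_integrable g"
  shows "prim (\<lambda>y. g (y + t)) x = prim g (x + t) - prim g t"
  unfolding prim_def[of "\<lambda>y. g (y + t)"] interval_integral_shift
  using LBINT_eq_prim[OF assms, of t "x + t"] by simp

lemma prim_continuous:
  assumes "locally_integrable g"
  shows "continuous_on UNIV (prim g)"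
proof -
  have "isCont (prim g) x" for x
  proof -
    define n where "n = \<bar>x\<bar> + 1"
    have "g integrable_on {-n..n}"
      using set_borel_integral_eq_integral(1)[OF locally_integrable_interval[OF assms]] .
    then have "continuous_on {-n..n} (\<lambda>y. integral {-n..y} g)"
      by (rule indefinite_integral_continuous_1)
    then have "continuous_on {-n..n} (\<lambda>y. integral {-n..y} g + prim g (-n))"
      by (intro continuous_intros)
    then have "continuous_on {-n..n} (prim g)"
      by (rule continuous_on_eq) (simp add: hk_integral_eq_prim[OF assms])
    then have "continuous_on {-n<..<n} (prim g)" by (rule continuous_on_subset) auto
    moreover have "x \<in> {-n<..<n}" by (auto simp: n_def)
    ultimately show ?thesis by (simp add: continuous_on_eq_continuous_at)
  qed
  then show ?thesis by (simp add: continuous_at_imp_continuous_on)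
qed

lemma prim_has_real_derivative:
  assumes g: "continuous_on UNIV g"
  shows "(prim g has_real_derivative g x) (at x)"
proof -
  define n where "n = \<bar>x\<bar> + 1"
  have loc: "locally_integrable g" using g by (rule locally_integrable_continuous)
  have x: "x \<in> {-n<..<n}" by (auto simp: n_def)
  have "((\<lambda>y. integral {-n..y} g) has_real_derivative g x) (at x within {-n..n})"
    using x by (intro integral_has_real_derivative continuous_on_subset[OF g]) auto
  then have "((\<lambda>y. integral {-n..y} g + prim g (-n)) has_real_derivative g x) (at x within {-n..n})"
    using DERIV_add[OF _ DERIV_const] by fastforce
  then have "(prim g has_real_derivative g x) (at x within {-n..n})"
    by (rule has_field_derivative_transform_within[where d = 1])
      (use x in \<open>auto simp: hk_integral_eq_prim[OF loc]\<close>)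
  then have "(prim g has_real_derivative g x) (at x within {-n<..<n})"
    by (rule DERIV_subset) auto
  then show ?thesis using x by (metis at_within_open open_greaterThanLessThan)
qed

lemma prim_of_derivative:
  assumes "\<And>x. (f has_real_derivative f' x) (at x)" "continuous_on UNIV f'"
  shows "prim f' x = f x - f 0"
proof -
  have "((\<lambda>x. f x - prim f' x) has_real_derivative 0) (at x)" for x
    using DERIV_diff[OF assms(1) prim_has_real_derivative[OF assms(2)], of x] by simp
  then have "f x - prim f' x = f 0 - prim f' 0"
    using DERIV_isconst_all by blast
  then show ?thesis by simp
qed

text \<open>The two measures with densities \<open>g\<^sup>+\<close> and \<open>g\<^sup>-\<close> agree on half lines, hence everywhere.\<close>

lemma AE_zero_of_integrable:
  fixes g :: "real \<Rightarrow> real"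
  assumes g: "integrable lborel g" and z: "\<And>x. (LINT y:{x<..}|lborel. g y) = 0"
  shows "AE x in lborel. g x = 0"
proof -
  let ?p = "\<lambda>x. max (g x) 0" and ?m = "\<lambda>x. max (- g x) 0"
  have [measurable]: "g \<in> borel_measurable borel" using g by auto
  have ip: "integrable lborel ?p" and im: "integrable lborel ?m" using g by auto
  have em: "emeasure (density lborel (\<lambda>x. ennreal (h x))) A = ennreal (LINT x:A|lborel. h x)"
    if h: "integrable lborel h" "\<And>x. h x \<ge> 0" and A: "A \<in> sets borel" for h :: "real \<Rightarrow> real" and A
  proof -
    have [measurable]: "h \<in> borel_measurable borel" using h by auto
    have "emeasure (density lborel (\<lambda>x. ennreal (h x))) A = (\<integral>\<^sup>+x. ennreal (indicator A x *\<^sub>R h x) \<partial>lborel)"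
      using A by (subst emeasure_density) (auto intro!: nn_integral_cong simp: indicator_def)
    also have "\<dots> = ennreal (LINT x:A|lborel. h x)"
      unfolding set_lebesgue_integral_def
      using h A by (intro nn_integral_eq_integral integrable_mult_indicator[where 'b=real]) auto
    finally show ?thesis .
  qed
  have si: "set_integrable lborel A h" if "integrable lborel h" "A \<in> sets borel" for A and h :: "real \<Rightarrow> real"
    using that unfolding set_integrable_def by (intro integrable_mult_indicator) auto
  have split: "(LINT x:A|lborel. g x) = (LINT x:A|lborel. ?p x) - (LINT x:A|lborel. ?m x)" if "A \<in> sets borel" for A
  proof -
    have "(LINT x:A|lborel. g x) = (LINT x:A|lborel. ?p x - ?m x)"
      using that by (intro set_lebesgue_integral_cong) auto
    then show ?thesis using set_integral_diff(2)[OF si[OF ip that] si[OF im that]] by simp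
  qed
  have eq: "density lborel (\<lambda>x. ennreal (?p x)) = density lborel (\<lambda>x. ennreal (?m x))"
    using z split by (intro measure_eqI_lessThan) (auto simp: em[OF ip] em[OF im])
  have nn: "0 \<le> (LINT x:A|lborel. max (h x) 0)" for A and h :: "real \<Rightarrow> real"
    unfolding set_lebesgue_integral_def by (intro integral_nonneg_AE) auto
  have "(LINT x:A|lborel. g x) = 0" if A: "A \<in> sets borel" for A
  proof -
    have "ennreal (LINT x:A|lborel. ?p x) = ennreal (LINT x:A|lborel. ?m x)"
      using em[OF ip _ A] em[OF im _ A] eq by simp
    then have "(LINT x:A|lborel. ?p x) = (LINT x:A|lborel. ?m x)"
      by (subst (asm) ennreal_inj) (auto intro: nn)
    then show ?thesis using split[OF A] by simp
  qed
  then show ?thesis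
    using density_unique_real[OF g, of "\<lambda>_. 0"] by (simp add: set_lebesgue_integral_def)
qed


lemma AE_zero_on_interval:
  assumes g: "locally_integrable g" and z: "\<And>x. l \<le> x \<Longrightarrow> x \<le> r \<Longrightarrow> prim g x = prim g r"
  shows "AE x in lborel. x \<in> {l..r} \<longrightarrow> g x = 0"
proof -
  have "(LINT y:{x<..}|lborel. indicator {l..r} y *\<^sub>R g y) = 0" for x
  proof (cases "x < r")
    case True
    define x' where "x' = max l x"
    show ?thesis
    proof (cases "x' \<le> r")
      case x': True
      have [measurable]: "g \<in> borel_measurable borel" using g by auto
      have "(LINT y:{x<..}|lborel. indicator {l..r} y *\<^sub>R g y) = (LINT y:{x'..r}|lborel. g y)"
        unfolding set_lebesgue_integral_def
      proof (rule integral_cong_AE)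
        show "AE y in lborel. indicator {x<..} y *\<^sub>R indicator {l..r} y *\<^sub>R g y = indicator {x'..r} y *\<^sub>R g y"
          using AE_lborel_singleton[of x]
          by eventually_elim (auto simp: indicator_def x'_def)
      qed simp_all
      also have "\<dots> = prim g r - prim g x'" using x' g by (rule integral_eq_prim[rotated])
      finally show ?thesis using z[of x'] x' by (simp add: x'_def)
    next
      case False
      then have "(\<lambda>y. indicator {x<..} y *\<^sub>R indicator {l..r} y *\<^sub>R g y) = (\<lambda>_. 0)"
        using True by (auto simp: x'_def indicator_def)
      then show ?thesis unfolding set_lebesgue_integral_def by (simp only: integral_zero)
    qed
  next
    case False
    then have "(\<lambda>y. indicator {x<..} y *\<^sub>R indicator {l..r} y *\<^sub>R g y) = (\<lambda>_. 0)"
      by (auto simp: indicator_def)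
    then show ?thesis unfolding set_lebesgue_integral_def by (simp only: integral_zero)
  qed
  then have "AE y in lborel. indicator {l..r} y *\<^sub>R g y = 0"
    using locally_integrable_interval[OF g, of l r] unfolding set_integrable_def
    by (intro AE_zero_of_integrable) auto
  then show ?thesis by eventually_elim (auto simp: indicator_def)
qed

lemma AE_zero_if_prim_zero:
  assumes g: "locally_integrable g" and z: "\<And>x. prim g x = 0"
  shows "AE x in lborel. g x = 0"
proof -
  have "AE x in lborel. \<forall>n::nat. x \<in> {- real n..real n} \<longrightarrow> g x = 0"
    unfolding AE_all_countable by (intro allI AE_zero_on_interval[OF g]) (auto simp: z)
  then show ?thesis
  proof eventually_elim
    case (elim x)
    obtain n :: nat where "real n \<ge> \<bar>x\<bar>" using real_arch_simple by blast
    with elim[rule_format, of n] show ?case by (auto simp: abs_le_iff)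
  qed
qed

lemma AE_eq_if_prim_eq:
  assumes "locally_integrable f" "locally_integrable g" and "\<And>x. prim f x = prim g x"
  shows "AE x in lborel. f x = g x"
  using AE_zero_if_prim_zero[OF locally_integrable_diff[OF assms(1,2)]] assms
  by (simp add: prim_diff)

section \<open>Test functions and weak derivatives\<close>

lemma smooth_has_real_derivative:
  assumes "smooth f" shows "(f has_real_derivative deriv f x) (at x)"
proof -
  have "(deriv ^^ 0) f differentiable_on UNIV" using assms unfolding smooth_def by blast
  then show ?thesis
    by (simp add: differentiable_on_def DERIV_deriv_iff_real_differentiable)
qed

lemma smooth_deriv:
  assumes "smooth f" shows "smooth (deriv f)"
  unfolding smooth_def
proof
  fix n
  have "(deriv ^^ Suc n) f differentiable_on UNIV" using assms unfolding smooth_def by blast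
  then show "(deriv ^^ n) (deriv f) differentiable_on UNIV" by (simp only: funpow_Suc_right o_apply)
qed

lemma smooth_continuous: "smooth f \<Longrightarrow> continuous_on UNIV f"
  using smooth_has_real_derivative DERIV_isCont continuous_at_imp_continuous_on by blast

text \<open>Smoothness by coinduction: it suffices to be in a set of functions that is closed under
  differentiation.\<close>

lemma smooth_coinduct:
  assumes "f \<in> S"
    and step: "\<And>f. f \<in> S \<Longrightarrow> \<exists>f'\<in>S. \<forall>x. (f has_real_derivative f' x) (at x)"
  shows "smooth f"
  unfolding smooth_def
proof
  fix n
  have in_S: "(deriv ^^ n) f \<in> S"
  proof (induction n)
    case 0 show ?case using assms(1) by simp
  next
    case (Suc n)
    then obtain f' where f': "f' \<in> S" "\<And>x. ((deriv ^^ n) f has_real_derivative f' x) (at x)"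
      using step by blast
    then have "deriv ((deriv ^^ n) f) = f'" by (intro ext DERIV_imp_deriv)
    then show ?case using f'(1) by simp
  qed
  then show "(deriv ^^ n) f differentiable_on UNIV"
    using step[OF in_S] unfolding differentiable_on_def
    by (metis real_differentiable_def)
qed

lemma smooth_if_derivative_smooth:
  assumes "\<And>x. (f has_real_derivative f' x) (at x)" "smooth f'"
  shows "smooth f"
proof (rule smooth_coinduct[where S = "{f, f'} \<union> Collect smooth"])
  fix g assume "g \<in> {f, f'} \<union> Collect smooth"
  then show "\<exists>g'\<in>{f, f'} \<union> Collect smooth. \<forall>x. (g has_real_derivative g' x) (at x)"
    using assms smooth_has_real_derivative smooth_deriv by blast
qed simp

lemma smooth_affine_lincomb:
  assumes "smooth f" "smooth g"
  shows "smooth (\<lambda>x. p * f (t + c * x) + q * g (s + d * x))"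
proof (rule smooth_coinduct[where S = "{h. \<exists>f g p t c q s d. smooth f \<and> smooth g \<and> h = (\<lambda>x. p * f (t + c * x) + q * g (s + d * x))}"])
  fix h assume "h \<in> {h. \<exists>f g p t c q s d. smooth f \<and> smooth g \<and> h = (\<lambda>x. p * f (t + c * x) + q * g (s + d * x))}"
  then obtain f g p t c q s d where fg: "smooth f" "smooth g"
    and h: "h = (\<lambda>x. p * f (t + c * x) + q * g (s + d * x))" by blast
  have "(h has_real_derivative (p * c) * deriv f (t + c * x) + (q * d) * deriv g (s + d * x)) (at x)" for x
    unfolding h
    by (rule derivative_eq_intros DERIV_chain2[OF smooth_has_real_derivative[OF fg(1)]]
        DERIV_chain2[OF smooth_has_real_derivative[OF fg(2)]] refl | simp)+
  moreover have "(\<lambda>x. (p * c) * deriv f (t + c * x) + (q * d) * deriv g (s + d * x)) \<in>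
    {h. \<exists>f g p t c q s d. smooth f \<and> smooth g \<and> h = (\<lambda>x. p * f (t + c * x) + q * g (s + d * x))}"
    using fg[THEN smooth_deriv] by blast
  ultimately show "\<exists>h'\<in>{h. \<exists>f g p t c q s d. smooth f \<and> smooth g \<and> h = (\<lambda>x. p * f (t + c * x) + q * g (s + d * x))}.
      \<forall>x. (h has_real_derivative h' x) (at x)" by (intro bexI allI)
qed (use assms in blast)

lemma test_functionI:
  assumes "smooth \<phi>" and "\<And>x. \<bar>x\<bar> \<ge> R \<Longrightarrow> \<phi> x = 0"
  shows "test_function \<phi>"
proof -
  have "{x. \<phi> x \<noteq> 0} \<subseteq> {-R..R}"
  proof
    fix x assume "x \<in> {x. \<phi> x \<noteq> 0}"
    then have "\<not> \<bar>x\<bar> \<ge> R" using assms(2) by blast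
    then show "x \<in> {-R..R}" by auto
  qed
  then have "bounded {x. \<phi> x \<noteq> 0}" using bounded_subset bounded_closed_interval by blast
  then show ?thesis using assms(1) by (simp add: test_function_def)
qed

lemma test_function_support:
  assumes "test_function \<phi>"
  shows "\<exists>R>0. \<forall>x. R \<le> \<bar>x\<bar> \<longrightarrow> \<phi> x = 0 \<and> deriv \<phi> x = 0"
proof -
  have sm: "smooth \<phi>" and c: "compact (closure {x. \<phi> x \<noteq> 0})" using assms by (auto simp: test_function_def)
  then obtain r where r: "r > 0" "\<And>x. x \<in> closure {x. \<phi> x \<noteq> 0} \<Longrightarrow> norm x \<le> r"
    using compact_imp_bounded[OF c] unfolding bounded_pos by auto
  have z: "\<phi> x = 0" if "\<bar>x\<bar> > r" for x
  proof (rule ccontr)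
    assume "\<phi> x \<noteq> 0"
    then have "x \<in> closure {x. \<phi> x \<noteq> 0}" using closure_subset[of "{x. \<phi> x \<noteq> 0}"] by auto
    then show False using r(2) that by force
  qed
  have "\<phi> x = 0 \<and> deriv \<phi> x = 0" if x: "r + 1 \<le> \<bar>x\<bar>" for x
  proof
    show "\<phi> x = 0" using z[of x] x by simp
    have "((\<lambda>_. 0) has_real_derivative 0) (at x)" by simp
    then have "(\<phi> has_real_derivative 0) (at x)"
      by (rule has_field_derivative_transform_within[where d = 1]) (use x z in \<open>auto simp: dist_real_def\<close>)
    then show "deriv \<phi> x = 0" by (rule DERIV_imp_deriv)
  qed
  then show ?thesis using r(1) by (intro exI[of _ "r + 1"]) auto
qed

lemma test_function_deriv:
  assumes "test_function \<phi>" shows "test_function (deriv \<phi>)"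
proof -
  obtain R where R0: "R > 0" "\<forall>x. R \<le> \<bar>x\<bar> \<longrightarrow> \<phi> x = 0 \<and> deriv \<phi> x = 0"
    using test_function_support[OF assms] by blast
  have R: "R > 0" "\<And>x. R \<le> \<bar>x\<bar> \<Longrightarrow> \<phi> x = 0" "\<And>x. R \<le> \<bar>x\<bar> \<Longrightarrow> deriv \<phi> x = 0"
    using R0 by simp_all
  have "smooth (deriv \<phi>)" using assms by (intro smooth_deriv) (simp add: test_function_def)
  then show ?thesis by (rule test_functionI[OF _ R(3)])
qed

lemma continuous_on_UNIV_bounded_on_interval:
  fixes f :: "real \<Rightarrow> real"
  assumes "continuous_on UNIV f"
  shows "\<exists>B>0. \<forall>x\<in>{a..b}. \<bar>f x\<bar> \<le> B"
proof -
  have "compact (f ` {a..b})"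
    using assms by (intro compact_continuous_image) (auto intro: continuous_on_subset)
  then have "bounded (f ` {a..b})" by (rule compact_imp_bounded)
  then obtain B where "B > 0" "\<forall>y\<in>f ` {a..b}. norm y \<le> B" unfolding bounded_pos by blast
  then show ?thesis by (intro exI[of _ B]) auto
qed

lemma integrable_mult_compact_support:
  fixes f \<phi> :: "real \<Rightarrow> real"
  assumes f: "locally_integrable f" and c: "continuous_on UNIV \<phi>" and z: "\<And>x. \<bar>x\<bar> \<ge> R \<Longrightarrow> \<phi> x = 0"
  shows "integrable lborel (\<lambda>x. f x * \<phi> x)"
proof -
  have [measurable]: "f \<in> borel_measurable borel" "\<phi> \<in> borel_measurable borel"
    using f c by (auto intro: borel_measurable_continuous_onI)
  obtain B where B: "B > 0" "\<forall>x\<in>{-R..R}. \<bar>\<phi> x\<bar> \<le> B"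
    using continuous_on_UNIV_bounded_on_interval[OF c, of "-R" R] by blast
  have "integrable lborel (\<lambda>x. B * (indicator {-R..R} x *\<^sub>R f x))"
    using locally_integrable_interval[OF f, of "-R" R] by (simp add: set_integrable_def)
  then show ?thesis
  proof (rule Bochner_Integration.integrable_bound)
    show "AE x in lborel. norm (f x * \<phi> x) \<le> norm (B * (indicator {-R..R} x *\<^sub>R f x))"
    proof (rule AE_I2)
      fix x
      show "norm (f x * \<phi> x) \<le> norm (B * (indicator {-R..R} x *\<^sub>R f x))"
      proof (cases "x \<in> {-R..R}")
        case True
        then show ?thesis using B(1) mult_right_mono[OF B(2)[rule_format, OF True], of "\<bar>f x\<bar>"]
          by (simp add: abs_mult mult.commute)
      next
        case False
        then have "\<phi> x = 0" by (intro z) auto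
        then show ?thesis by simp
      qed
    qed
  qed simp
qed

lemma integrable_mult_test_function:
  assumes "locally_integrable f" "test_function \<phi>"
  shows "integrable lborel (\<lambda>x. f x * \<phi> x)"
proof -
  obtain R where R0: "R > 0" "\<forall>x. R \<le> \<bar>x\<bar> \<longrightarrow> \<phi> x = 0 \<and> deriv \<phi> x = 0"
    using test_function_support[OF assms(2)] by blast
  have R: "R > 0" "\<And>x. R \<le> \<bar>x\<bar> \<Longrightarrow> \<phi> x = 0" "\<And>x. R \<le> \<bar>x\<bar> \<Longrightarrow> deriv \<phi> x = 0"
    using R0 by simp_all
  have "continuous_on UNIV \<phi>" using assms(2) by (intro smooth_continuous) (simp add: test_function_def)
  then show ?thesis by (rule integrable_mult_compact_support[OF assms(1) _ R(2)])
qed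

lemma integral_derivative_Icc:
  assumes "\<And>x. (f has_real_derivative f' x) (at x)" "continuous_on UNIV f'" "a \<le> b"
  shows "(LINT x:{a..b}|lborel. f' x) = f b - f a"
  using integral_eq_prim[OF locally_integrable_continuous[OF assms(2)] assms(3)]
    prim_of_derivative[OF assms(1,2)] by simp

lemma integral_deriv_test_function:
  assumes \<phi>: "test_function \<phi>" shows "(LINT x|lborel. deriv \<phi> x) = 0"
proof -
  obtain R where R: "R > 0" "\<forall>x. R \<le> \<bar>x\<bar> \<longrightarrow> \<phi> x = 0 \<and> deriv \<phi> x = 0"
    using test_function_support[OF \<phi>] by blast
  have sm: "smooth \<phi>" using \<phi> by (simp add: test_function_def)
  have "indicator {-R..R} x *\<^sub>R deriv \<phi> x = deriv \<phi> x" for x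
    using R by (cases "x \<in> {-R..R}") auto
  then have "(LINT x|lborel. deriv \<phi> x) = (LINT x:{-R..R}|lborel. deriv \<phi> x)"
    unfolding set_lebesgue_integral_def by presburger
  also have "\<dots> = \<phi> R - \<phi> (-R)"
    using R(1) by (intro integral_derivative_Icc smooth_has_real_derivative smooth_continuous smooth_deriv sm) simp
  also have "\<dots> = 0" using R by simp
  finally show ?thesis .
qed

text \<open>Integration by parts against a test function, by Fubini on the triangle \<open>y \<le> x\<close>.\<close>

lemma integral_prim_mult_deriv:
  assumes g: "locally_integrable g" and \<phi>: "test_function \<phi>"
  shows "(LINT x|lborel. prim g x * deriv \<phi> x) = - (LINT x|lborel. g x * \<phi> x)"
proof -
  obtain R where R0: "R > 0" "\<forall>x. R \<le> \<bar>x\<bar> \<longrightarrow> \<phi> x = 0 \<and> deriv \<phi> x = 0"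
    using test_function_support[OF \<phi>] by blast
  have R: "R > 0" "\<And>x. R \<le> \<bar>x\<bar> \<Longrightarrow> \<phi> x = 0" "\<And>x. R \<le> \<bar>x\<bar> \<Longrightarrow> deriv \<phi> x = 0"
    using R0 by simp_all
  have sm: "smooth \<phi>" using \<phi> by (simp add: test_function_def)
  have c\<phi>: "continuous_on UNIV \<phi>" and c\<phi>': "continuous_on UNIV (deriv \<phi>)"
    using smooth_continuous[OF sm] smooth_continuous[OF smooth_deriv[OF sm]] .
  have [measurable]: "g \<in> borel_measurable borel" "\<phi> \<in> borel_measurable borel" "deriv \<phi> \<in> borel_measurable borel"
    using g c\<phi> c\<phi>' by (auto intro: borel_measurable_continuous_onI)
  have ftc: "(LINT x:{a..b}|lborel. deriv \<phi> x) = \<phi> b - \<phi> a" if "a \<le> b" for a b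
    using integral_derivative_Icc[OF smooth_has_real_derivative[OF sm] c\<phi>' that] .
  define k where "k x y = (indicator {-R..R} x * deriv \<phi> x) * (indicator {-R..x} y * g y)" for x y :: real
  have gi: "integrable lborel (\<lambda>y. indicator {a..b} y * g y)" for a b
    using locally_integrable_interval[OF g, of a b] by (simp add: set_integrable_def)
  have gabs: "(LINT y|lborel. \<bar>indicator {-R..x} y * g y\<bar>) \<le> (LINT y|lborel. \<bar>indicator {-R..R} y * g y\<bar>)" if "x \<le> R" for x
    using that by (intro integral_mono integrable_abs gi) (auto simp: indicator_def)
  have [measurable]: "(\<lambda>(x, y). k x y) \<in> borel_measurable (borel \<Otimes>\<^sub>M borel)"
  proof -
    have "(\<lambda>p. (indicator {-R..R} (fst p) * deriv \<phi> (fst p)) * ((if -R \<le> snd p \<and> snd p \<le> fst p then 1 else 0) * g (snd p)))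
       \<in> borel_measurable (borel \<Otimes>\<^sub>M borel)" by measurable
    also have "(\<lambda>p. (indicator {-R..R} (fst p) * deriv \<phi> (fst p)) * ((if -R \<le> snd p \<and> snd p \<le> fst p then 1 else 0) * g (snd p)))
      = (\<lambda>(x, y). k x y)" by (auto simp: k_def fun_eq_iff indicator_def)
    finally show ?thesis .
  qed
  have int: "integrable (lborel \<Otimes>\<^sub>M lborel) (\<lambda>(x, y). k x y)"
  proof (rule lborel_pair.Fubini_integrable)
    show "AE x in lborel. integrable lborel (\<lambda>y. case (x, y) of (x, y) \<Rightarrow> k x y)"
      using gi by (simp add: k_def)
    have "integrable lborel (\<lambda>x. \<bar>indicator {-R..R} x * deriv \<phi> x\<bar> * (LINT y|lborel. \<bar>indicator {-R..R} y * g y\<bar>))"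
      using locally_integrable_interval[OF locally_integrable_continuous[OF c\<phi>'], of "-R" R]
      by (intro integrable_mult_left integrable_abs) (simp add: set_integrable_def)
    then show "integrable lborel (\<lambda>x. LINT y|lborel. norm (case (x, y) of (x, y) \<Rightarrow> k x y))"
    proof (rule Bochner_Integration.integrable_bound)
      show "AE x in lborel. norm (LINT y|lborel. norm (case (x, y) of (x, y) \<Rightarrow> k x y)) \<le>
         norm (\<bar>indicator {-R..R} x * deriv \<phi> x\<bar> * (LINT y|lborel. \<bar>indicator {-R..R} y * g y\<bar>))"
      proof (rule AE_I2)
        fix x
        have eq: "(LINT y|lborel. norm (k x y)) = \<bar>indicator {-R..R} x * deriv \<phi> x\<bar> * (LINT y|lborel. \<bar>indicator {-R..x} y * g y\<bar>)"
          unfolding k_def by (subst integral_mult_right_zero[symmetric]) (simp add: abs_mult)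
        have nn: "0 \<le> (LINT y|lborel. \<bar>indicator {-R..z} y * g y\<bar>)" for z by (intro integral_nonneg_AE) auto
        show "norm (LINT y|lborel. norm (case (x, y) of (x, y) \<Rightarrow> k x y)) \<le>
         norm (\<bar>indicator {-R..R} x * deriv \<phi> x\<bar> * (LINT y|lborel. \<bar>indicator {-R..R} y * g y\<bar>))"
        proof (cases "x \<le> R")
          case True
          show ?thesis using mult_left_mono[OF gabs[OF True], of "\<bar>indicator {-R..R} x * deriv \<phi> x\<bar>"] eq nn
            by (simp add: abs_mult)
        next
          case False
          then show ?thesis using eq by (simp add: indicator_def)
        qed
      qed
    qed measurable
  qed measurable
  have left: "(LINT y|lborel. k x y) = prim g x * deriv \<phi> x - prim g (-R) * deriv \<phi> x" for x
  proof (cases "x \<in> {-R..R}")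
    case True
    have "(LINT y|lborel. k x y) = deriv \<phi> x * (LINT y:{-R..x}|lborel. g y)"
      using True unfolding k_def set_lebesgue_integral_def by simp
    also have "(LINT y:{-R..x}|lborel. g y) = prim g x - prim g (-R)"
      using integral_eq_prim[OF g, of "-R" x] True by simp
    finally show ?thesis by (simp add: algebra_simps)
  next
    case False
    then have "deriv \<phi> x = 0" by (intro R) auto
    then show ?thesis by (simp add: k_def)
  qed
  have right: "(LINT x|lborel. k x y) = - (g y * \<phi> y)" for y
  proof (cases "y \<in> {-R..R}")
    case True
    have "(LINT x|lborel. k x y) = (LINT x|lborel. g y * (indicator {y..R} x * deriv \<phi> x))"
      using True by (intro Bochner_Integration.integral_cong) (auto simp: k_def indicator_def)
    also have "\<dots> = g y * (LINT x:{y..R}|lborel. deriv \<phi> x)"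
      by (simp add: set_lebesgue_integral_def)
    also have "\<dots> = - (g y * \<phi> y)" using ftc[of y R] True R(1) R(2)[of R] by simp
    finally show ?thesis .
  next
    case False
    then have "\<phi> y = 0" by (intro R) auto
    moreover have "(\<lambda>x. k x y) = (\<lambda>_. 0)" using False by (auto simp: k_def indicator_def)
    ultimately show ?thesis by simp
  qed
  have i1: "integrable lborel (\<lambda>x. prim g x * deriv \<phi> x)"
    by (intro integrable_mult_test_function locally_integrable_continuous prim_continuous g test_function_deriv \<phi>)
  have i2: "integrable lborel (\<lambda>x. prim g (-R) * deriv \<phi> x)"
    using integrable_mult_test_function[OF locally_integrable_continuous test_function_deriv[OF \<phi>], of "\<lambda>_. prim g (-R)"] by simp
  have z: "(LINT x|lborel. deriv \<phi> x) = 0" using \<phi> by (rule integral_deriv_test_function)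
  have "(LINT x|lborel. prim g x * deriv \<phi> x) = (LINT x|lborel. (LINT y|lborel. k x y))"
    unfolding left using i1 i2 z by simp
  also have "\<dots> = (LINT y|lborel. (LINT x|lborel. k x y))"
    using lborel_pair.Fubini_integral[OF int] by simp
  also have "\<dots> = - (LINT x|lborel. g x * \<phi> x)" unfolding right by simp
  finally show ?thesis .
qed

lemma has_weak_deriv_if_AE_prim:
  assumes g: "locally_integrable g" and f: "f \<in> borel_measurable borel"
    and eq: "AE x in lborel. f x = c + prim g x"
  shows "has_weak_deriv f g"
proof -
  have cont: "continuous_on UNIV (\<lambda>x. c + prim g x)" by (intro continuous_intros prim_continuous g)
  have [measurable]: "f \<in> borel_measurable borel" by fact
  have [measurable]: "prim g \<in> borel_measurable borel" using prim_continuous[OF g] by (rule borel_measurable_continuous_onI)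
  have "locally_integrable f"
    using locally_integrable_cong_AE[OF locally_integrable_continuous[OF cont] f] eq by (auto simp: eq_commute)
  moreover have "(LINT x|lborel. f x * deriv \<phi> x) = - (LINT x|lborel. g x * \<phi> x)" if \<phi>: "test_function \<phi>" for \<phi>
  proof -
    have sm: "smooth \<phi>" using \<phi> by (simp add: test_function_def)
    have [measurable]: "deriv \<phi> \<in> borel_measurable borel"
      using smooth_continuous[OF smooth_deriv[OF sm]] by (rule borel_measurable_continuous_onI)
    have i: "integrable lborel (\<lambda>x. h x * deriv \<phi> x)" if "continuous_on UNIV h" for h
      using integrable_mult_test_function[OF locally_integrable_continuous[OF that] test_function_deriv[OF \<phi>]] .
    have z: "(LINT x|lborel. deriv \<phi> x) = 0" using \<phi> by (rule integral_deriv_test_function)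
    have "(LINT x|lborel. f x * deriv \<phi> x) = (LINT x|lborel. c * deriv \<phi> x + prim g x * deriv \<phi> x)"
      by (rule integral_cong_AE) (use eq in \<open>auto simp: algebra_simps\<close>)
    also have "\<dots> = - (LINT x|lborel. g x * \<phi> x)"
      using i[of "\<lambda>_. c"] i[OF prim_continuous[OF g]] z integral_prim_mult_deriv[OF g \<phi>] by simp
    finally show ?thesis .
  qed
  ultimately show ?thesis using g by (simp add: has_weak_deriv_def)
qed

text \<open>A mollifier is a smooth function of unit mass that vanishes for \<open>\<bar>x\<bar> \<ge> 1\<close>; it need not be
  nonnegative.\<close>

definition mollifier :: "(real \<Rightarrow> real) \<Rightarrow> bool" where
  "mollifier \<eta> \<longleftrightarrow> smooth \<eta> \<and> (\<forall>x. 1 \<le> \<bar>x\<bar> \<longrightarrow> \<eta> x = 0) \<and> (LINT x:{-1..1}|lborel. \<eta> x) = 1"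

text \<open>The indicator of an interval is the bounded pointwise limit of differences of rescaled
  primitives of the mollifier.\<close>

lemma AE_zero_if_orthogonal_test_functions:
  assumes \<eta>: "mollifier \<eta>" and g: "locally_integrable g"
    and orth: "\<And>\<phi>. test_function \<phi> \<Longrightarrow> (LINT x|lborel. g x * \<phi> x) = 0"
  shows "AE x in lborel. g x = 0"
proof -
  have sm: "smooth \<eta>" and \<eta>0: "\<And>x. 1 \<le> \<bar>x\<bar> \<Longrightarrow> \<eta> x = 0" and mass: "(LINT x:{-1..1}|lborel. \<eta> x) = 1"
    using \<eta> by (auto simp: mollifier_def)
  have c: "continuous_on UNIV \<eta>" using sm by (rule smooth_continuous)
  have l: "locally_integrable \<eta>" using c by (rule locally_integrable_continuous)
  define H where "H x = prim \<eta> x - prim \<eta> (-1)" for x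
  have H': "(H has_real_derivative \<eta> x) (at x)" for x
    unfolding H_def using DERIV_diff[OF prim_has_real_derivative[OF c] DERIV_const] by simp
  have smH: "smooth H" using H' sm by (rule smooth_if_derivative_smooth)
  have cH: "continuous_on UNIV H" using smH by (rule smooth_continuous)
  have [measurable]: "H \<in> borel_measurable borel" using cH by (rule borel_measurable_continuous_onI)
  have [measurable]: "g \<in> borel_measurable borel" using g by auto
  have H0: "H x = 0" if "x \<le> -1" for x
  proof -
    have "(LINT y:{x..-1}|lborel. \<eta> y) = (LINT y:{x..-1}|lborel. 0)"
      by (rule set_lebesgue_integral_cong) (auto intro!: \<eta>0)
    then show ?thesis using integral_eq_prim[OF l that] by (simp add: H_def)
  qed
  have H1: "H x = 1" if "x \<ge> 1" for x
  proof -
    have "(LINT y:{1..x}|lborel. \<eta> y) = (LINT y:{1..x}|lborel. 0)"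
      by (rule set_lebesgue_integral_cong) (auto intro!: \<eta>0)
    then have "prim \<eta> x = prim \<eta> 1" using integral_eq_prim[OF l that] by simp
    then show ?thesis using integral_eq_prim[OF l, of "-1" 1] mass by (simp add: H_def)
  qed
  obtain B where B0: "B > 0" "\<forall>x\<in>{-1..1}. \<bar>H x\<bar> \<le> B"
    using continuous_on_UNIV_bounded_on_interval[OF cH, of "-1" 1] by blast
  have B: "\<bar>H x\<bar> \<le> max B 1" for x
    using B0(2)[rule_format, of x] H0[of x] H1[of x] by (cases "x \<le> -1"; cases "x \<ge> 1") auto
  have "prim g a = prim g b" if ab: "a < b" for a b
  proof -
    define \<psi> where "\<psi> n x = H (real (Suc n) * (x - a)) - H (real (Suc n) * (x - b))" for n x
    have out: "\<psi> n x = 0" if "x \<notin> {a - 1..b + 1}" for n x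
    proof (cases "x < a - 1")
      case True
      have "real (Suc n) * (x - a) \<le> real (Suc n) * (-1)" "real (Suc n) * (x - b) \<le> real (Suc n) * (-1)"
        using True ab by (intro mult_left_mono; simp)+
      then show ?thesis unfolding \<psi>_def by (subst (1 2) H0) auto
    next
      case False
      then have x: "x > b + 1" using that by auto
      have big: "1 \<le> real (Suc n) * z" if "1 \<le> z" for z
        using mult_mono[of 1 "real (Suc n)" 1 z] that by simp
      have "1 \<le> real (Suc n) * (x - a)" "1 \<le> real (Suc n) * (x - b)"
        using x ab by (intro big; simp)+
      then show ?thesis unfolding \<psi>_def by (simp only: H1)
    qed
    have "smooth (\<psi> n)" for n
      using smooth_affine_lincomb[OF smH smH, of 1 "- real (Suc n) * a" "real (Suc n)" "-1" "- real (Suc n) * b" "real (Suc n)"]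
      by (simp add: \<psi>_def[abs_def] algebra_simps)
    then have test: "test_function (\<psi> n)" for n
    proof (rule test_functionI[where R = "\<bar>a\<bar> + \<bar>b\<bar> + 2"])
      fix x :: real assume "\<bar>a\<bar> + \<bar>b\<bar> + 2 \<le> \<bar>x\<bar>"
      then show "\<psi> n x = 0" by (intro out) auto
    qed
    have lim: "(\<lambda>n. \<psi> n x) \<longlonglongrightarrow> indicator {a..b} x" if x: "x \<noteq> a" "x \<noteq> b" for x
    proof -
      have step: "(\<lambda>n. H (real (Suc n) * (x - d))) \<longlonglongrightarrow> (if x > d then 1 else 0)" if "x \<noteq> d" for d
      proof -
        obtain m :: nat where m: "real m * \<bar>x - d\<bar> > 1"
          using reals_Archimedean3[of "\<bar>x - d\<bar>"] \<open>x \<noteq> d\<close> by fastforce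
        have "eventually (\<lambda>n. H (real (Suc n) * (x - d)) = (if x > d then 1 else 0)) sequentially"
          using eventually_ge_at_top[of m]
        proof eventually_elim
          case (elim n)
          have "real m * \<bar>x - d\<bar> \<le> real (Suc n) * \<bar>x - d\<bar>"
            using elim by (intro mult_right_mono) auto
          then have big: "real (Suc n) * \<bar>x - d\<bar> > 1" using m by linarith
          show ?case
          proof (cases "x > d")
            case True
            then show ?thesis using big by (subst H1) auto
          next
            case False
            then have "x - d = - \<bar>x - d\<bar>" by simp
            then have "real (Suc n) * (x - d) = - (real (Suc n) * \<bar>x - d\<bar>)"
              by (metis mult_minus_right)
            then show ?thesis using big False by (subst H0) auto
          qed
        qed
        then show ?thesis by (rule tendsto_eventually)
      qed
      have "(\<lambda>n. \<psi> n x) \<longlonglongrightarrow> (if x > a then 1 else 0) - (if x > b then 1 else 0)"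
        unfolding \<psi>_def using x by (intro tendsto_diff step)
      moreover have "(if x > a then 1 else 0) - (if x > b then 1 else 0) = (indicator {a..b} x :: real)"
        using x ab by (auto simp: indicator_def)
      ultimately show ?thesis by simp
    qed
    have "(\<lambda>n. LINT x|lborel. g x * \<psi> n x) \<longlonglongrightarrow> (LINT x|lborel. g x * indicator {a..b} x)"
    proof (rule integral_dominated_convergence[where w = "\<lambda>x. (2 * max B 1) * \<bar>indicator {a - 1..b + 1} x *\<^sub>R g x\<bar>"])
      show "integrable lborel (\<lambda>x. (2 * max B 1) * \<bar>indicator {a - 1..b + 1} x *\<^sub>R g x\<bar>)"
        using locally_integrable_interval[OF g, of "a - 1" "b + 1"]
        by (intro integrable_mult_right integrable_abs) (simp add: set_integrable_def)
      show "AE x in lborel. (\<lambda>n. g x * \<psi> n x) \<longlonglongrightarrow> g x * indicator {a..b} x"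
        using AE_lborel_singleton[of a] AE_lborel_singleton[of b]
        by eventually_elim (intro tendsto_mult tendsto_const lim)
      show "AE x in lborel. norm (g x * \<psi> n x) \<le> (2 * max B 1) * \<bar>indicator {a - 1..b + 1} x *\<^sub>R g x\<bar>" for n
      proof (rule AE_I2)
        fix x
        show "norm (g x * \<psi> n x) \<le> (2 * max B 1) * \<bar>indicator {a - 1..b + 1} x *\<^sub>R g x\<bar>"
        proof (cases "x \<in> {a - 1..b + 1}")
          case True
          have "\<bar>\<psi> n x\<bar> \<le> 2 * max B 1"
            using B[of "real (Suc n) * (x - a)"] B[of "real (Suc n) * (x - b)"] unfolding \<psi>_def by linarith
          then have "\<bar>g x\<bar> * \<bar>\<psi> n x\<bar> \<le> \<bar>g x\<bar> * (2 * max B 1)" by (rule mult_left_mono) simp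
          then show ?thesis using True by (simp add: abs_mult mult.commute)
        qed (simp add: out)
      qed
    qed (simp_all add: \<psi>_def)
    then have "(LINT x|lborel. g x * indicator {a..b} x) = 0"
      using orth[OF test] by (simp add: LIMSEQ_const_iff)
    then have "(LINT x:{a..b}|lborel. g x) = 0"
      by (simp add: set_lebesgue_integral_def mult.commute)
    then show ?thesis using integral_eq_prim[OF g, of a b] ab by simp
  qed
  then have "prim g x = 0" for x by (metis linorder_neqE_linordered_idom prim_0)
  then show ?thesis by (rule AE_zero_if_prim_zero[OF g])
qed

lemma has_weak_deriv_unique:
  assumes \<eta>: "mollifier \<eta>" and g: "has_weak_deriv f g" and h: "has_weak_deriv f h"
  shows "AE x in lborel. g x = h x"
proof -
  have lg: "locally_integrable g" and lh: "locally_integrable h"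
    using g h by (auto simp: has_weak_deriv_def)
  have "(LINT x|lborel. (g x - h x) * \<phi> x) = 0" if \<phi>: "test_function \<phi>" for \<phi>
  proof -
    have "(LINT x|lborel. g x * \<phi> x) = (LINT x|lborel. h x * \<phi> x)"
      using g h \<phi> by (simp add: has_weak_deriv_def)
    then show ?thesis
      using integrable_mult_test_function[OF lg \<phi>] integrable_mult_test_function[OF lh \<phi>]
      by (simp add: left_diff_distrib)
  qed
  then have "AE x in lborel. g x - h x = 0"
    by (intro AE_zero_if_orthogonal_test_functions[OF \<eta>] locally_integrable_diff lg lh)
  then show ?thesis by simp
qed

text \<open>The difference \<open>h\<close> of \<open>f\<close> and the primitive of \<open>g\<close> has zero weak derivative.  Any test function \<open>\<psi>\<close>,
  minus its integral times the mollifier, is the derivative of a test function; hence \<open>h\<close> minus the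
  integral of \<open>h \<eta>\<close> is orthogonal to all test functions.\<close>

lemma AE_prim_if_has_weak_deriv:
  assumes \<eta>: "mollifier \<eta>" and fg: "has_weak_deriv f g"
  shows "\<exists>c. AE x in lborel. f x = c + prim g x"
proof -
  have sm: "smooth \<eta>" and \<eta>0: "\<And>x. 1 \<le> \<bar>x\<bar> \<Longrightarrow> \<eta> x = 0" and mass: "(LINT x:{-1..1}|lborel. \<eta> x) = 1"
    using \<eta> by (auto simp: mollifier_def)
  have t\<eta>: "test_function \<eta>" using sm \<eta>0 by (rule test_functionI)
  have lf: "locally_integrable f" and lg: "locally_integrable g" using fg by (auto simp: has_weak_deriv_def)
  define h where "h x = f x - prim g x" for x
  have lp: "locally_integrable (prim g)" by (intro locally_integrable_continuous prim_continuous lg)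
  have lh: "locally_integrable h" unfolding h_def by (intro locally_integrable_diff lf lp)
  have h0: "(LINT x|lborel. h x * deriv \<phi> x) = 0" if \<phi>: "test_function \<phi>" for \<phi>
  proof -
    have "(LINT x|lborel. f x * deriv \<phi> x) = (LINT x|lborel. prim g x * deriv \<phi> x)"
      using fg \<phi> integral_prim_mult_deriv[OF lg \<phi>] by (simp add: has_weak_deriv_def)
    then show ?thesis
      using integrable_mult_test_function[OF lf test_function_deriv[OF \<phi>]]
        integrable_mult_test_function[OF lp test_function_deriv[OF \<phi>]]
      by (simp add: h_def left_diff_distrib)
  qed
  define c where "c = (LINT x|lborel. h x * \<eta> x)"
  have lc: "locally_integrable (\<lambda>_. d)" for d by (intro locally_integrable_continuous continuous_intros)
  have "(LINT x|lborel. (h x - c) * \<psi> x) = 0" if \<psi>: "test_function \<psi>" for \<psi>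
  proof -
    define m where "m = (LINT x|lborel. \<psi> x)"
    define \<theta> where "\<theta> x = \<psi> x - m * \<eta> x" for x
    have sm\<psi>: "smooth \<psi>" using \<psi> by (simp add: test_function_def)
    have sm\<theta>: "smooth \<theta>"
      using smooth_affine_lincomb[OF sm\<psi> sm, of 1 0 1 "-m" 0 1] by (simp add: \<theta>_def[abs_def])
    obtain R0 where R0: "R0 > 0" "\<forall>x. R0 \<le> \<bar>x\<bar> \<longrightarrow> \<psi> x = 0 \<and> deriv \<psi> x = 0"
      using test_function_support[OF \<psi>] by blast
    define R where "R = max R0 1"
    have R: "R > 0" "\<And>x. R \<le> \<bar>x\<bar> \<Longrightarrow> \<psi> x = 0" "\<And>x. R \<le> \<bar>x\<bar> \<Longrightarrow> \<eta> x = 0"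
      using R0 \<eta>0 by (auto simp: R_def)
    have \<theta>0: "\<theta> x = 0" if "R \<le> \<bar>x\<bar>" for x using R(2,3)[OF that] by (simp add: \<theta>_def)
    have c\<theta>: "continuous_on UNIV \<theta>" using sm\<theta> by (rule smooth_continuous)
    have l\<theta>: "locally_integrable \<theta>" using c\<theta> by (rule locally_integrable_continuous)
    have i\<psi>: "integrable lborel \<psi>" and i\<eta>: "integrable lborel \<eta>"
      using integrable_mult_test_function[OF lc[of 1] \<psi>] integrable_mult_test_function[OF lc[of 1] t\<eta>] by auto
    have "(LINT x|lborel. \<eta> x) = (LINT x:{-1..1}|lborel. \<eta> x)"
      unfolding set_lebesgue_integral_def
      by (intro Bochner_Integration.integral_cong) (auto simp: indicator_def intro!: \<eta>0)
    then have "(LINT x|lborel. \<theta> x) = 0" using i\<psi> i\<eta> mass by (simp add: \<theta>_def m_def)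
    moreover have "(LINT x|lborel. \<theta> x) = (LINT x:{-R..R}|lborel. \<theta> x)"
      unfolding set_lebesgue_integral_def
      by (intro Bochner_Integration.integral_cong) (auto simp: indicator_def intro!: \<theta>0)
    ultimately have tot: "prim \<theta> R = prim \<theta> (-R)"
      using integral_eq_prim[OF l\<theta>, of "-R" R] R(1) by simp
    define \<phi> where "\<phi> x = prim \<theta> x - prim \<theta> (-R)" for x
    have \<phi>': "(\<phi> has_real_derivative \<theta> x) (at x)" for x
      unfolding \<phi>_def using DERIV_diff[OF prim_has_real_derivative[OF c\<theta>] DERIV_const] by simp
    have "\<phi> x = 0" if "R \<le> \<bar>x\<bar>" for x
    proof (cases "x \<ge> R")
      case True
      have "(LINT y:{R..x}|lborel. \<theta> y) = (LINT y:{R..x}|lborel. 0)"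
        by (rule set_lebesgue_integral_cong) (auto intro!: \<theta>0)
      then show ?thesis using integral_eq_prim[OF l\<theta> True] tot by (simp add: \<phi>_def)
    next
      case False
      then have x: "x \<le> -R" using that by auto
      have "(LINT y:{x..-R}|lborel. \<theta> y) = (LINT y:{x..-R}|lborel. 0)"
        by (rule set_lebesgue_integral_cong) (auto intro!: \<theta>0)
      then show ?thesis using integral_eq_prim[OF l\<theta> x] by (simp add: \<phi>_def)
    qed
    then have "test_function \<phi>"
      by (rule test_functionI[OF smooth_if_derivative_smooth[OF \<phi>' sm\<theta>]])
    moreover have "deriv \<phi> = \<theta>" using \<phi>' by (intro ext DERIV_imp_deriv)
    ultimately have "(LINT x|lborel. h x * \<theta> x) = 0" using h0 by metis
    then have "(LINT x|lborel. h x * \<psi> x) = m * c"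
      using integrable_mult_test_function[OF lh \<psi>] integrable_mult_test_function[OF lh t\<eta>]
      by (simp add: \<theta>_def right_diff_distrib c_def mult.left_commute)
    then show ?thesis
      using integrable_mult_test_function[OF lh \<psi>] i\<psi> by (simp add: left_diff_distrib m_def)
  qed
  then have "AE x in lborel. h x - c = 0"
    by (intro AE_zero_if_orthogonal_test_functions[OF \<eta>] locally_integrable_diff lh lc)
  then have "AE x in lborel. f x = c + prim g x" by eventually_elim (simp add: h_def)
  then show ?thesis by blast
qed

lemma weak_deriv_AE_eq:
  assumes "mollifier \<eta>" "has_weak_deriv f g"
  shows "AE x in lborel. weak_deriv f x = g x" "has_weak_deriv f (weak_deriv f)"
proof -
  show w: "has_weak_deriv f (weak_deriv f)"
    unfolding weak_deriv_def using someI[of "has_weak_deriv f" g] assms(2) by blast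
  show "AE x in lborel. weak_deriv f x = g x" by (rule has_weak_deriv_unique[OF assms(1) w assms(2)])
qed

section \<open>Square integrable functions\<close>

lemma L2_measurable [dest]: "f \<in> L2 \<Longrightarrow> f \<in> borel_measurable borel"
  by (simp add: L2_def)

lemma L2_integrable_square: "f \<in> L2 \<Longrightarrow> integrable lborel (\<lambda>x. (f x)\<^sup>2)"
  by (simp add: L2_def)

lemma L2_norm_square: "(L2_norm f)\<^sup>2 = (LINT x|lborel. (f x)\<^sup>2)"
  by (simp add: L2_norm_def)

lemma L2I_bound:
  assumes [measurable]: "f \<in> borel_measurable borel" and g: "integrable lborel g"
    and le: "AE x in lborel. (f x)\<^sup>2 \<le> g x"
  shows "f \<in> L2" "(LINT x|lborel. (f x)\<^sup>2) \<le> (LINT x|lborel. g x)"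
proof -
  have i: "integrable lborel (\<lambda>x. (f x)\<^sup>2)"
    by (rule Bochner_Integration.integrable_bound[OF g]) (use le in auto)
  then show "f \<in> L2" by (simp add: L2_def)
  show "(LINT x|lborel. (f x)\<^sup>2) \<le> (LINT x|lborel. g x)" using i g le by (rule integral_mono_AE)
qed

lemma square_lincomb_le:
  fixes a b p q :: real
  shows "(p * a + q * b)\<^sup>2 \<le> 2 * p\<^sup>2 * a\<^sup>2 + 2 * q\<^sup>2 * b\<^sup>2"
  using zero_le_power2[of "p * a - q * b"] by (simp add: power2_eq_square algebra_simps)

lemma integrable_indicator_Icc: "integrable lborel (indicator {a..b::real} :: real \<Rightarrow> real)"
  by (rule integrable_real_indicator) (auto simp: emeasure_lborel_Icc_eq)

lemma L2_lincomb:
  assumes "f \<in> L2" "g \<in> L2"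
  shows "(\<lambda>x. p * f x + q * g x) \<in> L2"
    and "(LINT x|lborel. (p * f x + q * g x)\<^sup>2) \<le>
      2 * p\<^sup>2 * (LINT x|lborel. (f x)\<^sup>2) + 2 * q\<^sup>2 * (LINT x|lborel. (g x)\<^sup>2)"
proof -
  have [measurable]: "f \<in> borel_measurable borel" "g \<in> borel_measurable borel" using assms by auto
  have i: "integrable lborel (\<lambda>x. 2 * p\<^sup>2 * (f x)\<^sup>2 + 2 * q\<^sup>2 * (g x)\<^sup>2)"
    using assms[THEN L2_integrable_square] by auto
  have m: "(\<lambda>x. p * f x + q * g x) \<in> borel_measurable borel" by measurable
  note b = L2I_bound[OF m i AE_I2, OF square_lincomb_le]
  show "(\<lambda>x. p * f x + q * g x) \<in> L2" using b(1) .
  show "(LINT x|lborel. (p * f x + q * g x)\<^sup>2) \<le>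
      2 * p\<^sup>2 * (LINT x|lborel. (f x)\<^sup>2) + 2 * q\<^sup>2 * (LINT x|lborel. (g x)\<^sup>2)"
    using b(2) assms[THEN L2_integrable_square] by simp
qed

lemma L2_add: "f \<in> L2 \<Longrightarrow> g \<in> L2 \<Longrightarrow> (\<lambda>x. f x + g x) \<in> L2"
  using L2_lincomb(1)[of f g 1 1] by simp

lemma L2_diff: "f \<in> L2 \<Longrightarrow> g \<in> L2 \<Longrightarrow> (\<lambda>x. f x - g x) \<in> L2"
  using L2_lincomb(1)[of f g 1 "-1"] by simp

lemma L2_cong_AE:
  assumes "f \<in> L2" "g \<in> borel_measurable borel" "AE x in lborel. f x = g x"
  shows "g \<in> L2"
proof (rule L2I_bound(1)[OF assms(2) L2_integrable_square[OF assms(1)]])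
  show "AE x in lborel. (g x)\<^sup>2 \<le> (f x)\<^sup>2" using assms(3) by eventually_elim simp
qed

lemma L2_bounded_support:
  fixes R :: real
  assumes m: "f \<in> borel_measurable borel" and R: "R \<ge> 0"
    and b: "AE x in lborel. \<bar>f x\<bar> \<le> B" and z: "AE x in lborel. \<bar>x\<bar> > R \<longrightarrow> f x = 0"
  shows "f \<in> L2" "(LINT x|lborel. (f x)\<^sup>2) \<le> 2 * R * B\<^sup>2"
proof -
  have i: "integrable lborel (\<lambda>x. B\<^sup>2 * indicator {-R..R} x)"
    by (intro integrable_mult_right integrable_indicator_Icc)
  have le: "AE x in lborel. (f x)\<^sup>2 \<le> B\<^sup>2 * indicator {-R..R} x"
    using b z
  proof eventually_elim
    case (elim x)
    show ?case
    proof (cases "\<bar>x\<bar> > R")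
      case False
      have "\<bar>f x\<bar>\<^sup>2 \<le> B\<^sup>2" using elim(1) by (intro power_mono) auto
      then show ?thesis using False by (auto simp: indicator_def abs_le_iff)
    qed (use elim in auto)
  qed
  show "f \<in> L2" "(LINT x|lborel. (f x)\<^sup>2) \<le> 2 * R * B\<^sup>2"
    using L2I_bound[OF m i le] R by (simp_all add: mult.commute)
qed

lemma L2_continuous_bounded_support:
  fixes k :: "real \<Rightarrow> real"
  assumes c: "continuous_on UNIV k" and r: "0 \<le> r" and k0: "\<And>x. r < \<bar>x\<bar> \<Longrightarrow> k x = 0"
  shows "k \<in> L2"
proof -
  obtain B where B: "B > 0" "\<forall>x\<in>{-r..r}. \<bar>k x\<bar> \<le> B"
    using continuous_on_UNIV_bounded_on_interval[OF c, of "-r" r] by blast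
  have "\<bar>k x\<bar> \<le> B" for x
  proof (cases "r < \<bar>x\<bar>")
    case False
    then have "x \<in> {-r..r}" by auto
    then show ?thesis using B(2) by blast
  qed (use B(1) k0 in simp)
  then have b: "AE x in lborel. \<bar>k x\<bar> \<le> B" by simp
  have "AE x in lborel. r < \<bar>x\<bar> \<longrightarrow> k x = 0" by (intro AE_I2 impI k0)
  then show ?thesis by (rule L2_bounded_support(1)[OF borel_measurable_continuous_onI[OF c] r b])
qed

lemma L2_locally_integrable:
  assumes "f \<in> L2" shows "locally_integrable f"
proof (rule locally_integrableI)
  show [measurable]: "f \<in> borel_measurable borel" using assms by auto
  fix a b :: real
  have "integrable lborel (\<lambda>x. indicator {a..b} x + (f x)\<^sup>2)"
    using L2_integrable_square[OF assms] integrable_indicator_Icc by (intro Bochner_Integration.integrable_add)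
  then show "set_integrable lborel {a..b} f"
    unfolding set_integrable_def
  proof (rule Bochner_Integration.integrable_bound)
    show "AE x in lborel. norm (indicator {a..b} x *\<^sub>R f x) \<le> norm (indicator {a..b} x + (f x)\<^sup>2)"
    proof (rule AE_I2)
      fix x
      have "2 * \<bar>f x\<bar> \<le> 1 + (f x)\<^sup>2"
        using zero_le_power2[of "\<bar>f x\<bar> - 1"] by (simp add: power2_eq_square algebra_simps)
      then show "norm (indicator {a..b} x *\<^sub>R f x) \<le> norm (indicator {a..b} x + (f x)\<^sup>2)"
        by (auto simp: indicator_def)
    qed
  qed simp
qed

text \<open>The Cauchy--Schwarz inequality on an interval: the mean square dominates the square of the mean.\<close>

lemma integral_Icc_square_le:
  assumes f: "f \<in> L2" and ab: "a \<le> b"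
  shows "(LINT x:{a..b}|lborel. f x)\<^sup>2 \<le> (b - a) * (LINT x|lborel. (f x)\<^sup>2)"
proof (cases "a = b")
  case True
  have "(LINT x:{b..b}|lborel. f x) = 0"
    using integral_eq_prim[OF L2_locally_integrable[OF f], of b b] by simp
  then show ?thesis using True by simp
next
  case False
  define I where "I = (LINT x:{a..b}|lborel. f x)"
  define m where "m = I / (b - a)"
  have i1: "integrable lborel (\<lambda>x. indicator {a..b} x * f x)"
    using locally_integrable_interval[OF L2_locally_integrable[OF f], of a b] by (simp add: set_integrable_def)
  have i2: "integrable lborel (\<lambda>x. (f x)\<^sup>2)" using f by (rule L2_integrable_square)
  have i3: "integrable lborel (indicator {a..b} :: real \<Rightarrow> real)" by (rule integrable_indicator_Icc)
  have "0 \<le> (LINT x|lborel. (f x)\<^sup>2 - 2 * m * (indicator {a..b} x * f x) + m\<^sup>2 * indicator {a..b} x)"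
  proof (rule integral_nonneg_AE, rule AE_I2)
    fix x
    have "(f x)\<^sup>2 - 2 * m * (indicator {a..b} x * f x) + m\<^sup>2 * indicator {a..b} x = (f x - m * indicator {a..b} x)\<^sup>2"
      by (auto simp: indicator_def power2_eq_square algebra_simps)
    then show "0 \<le> (f x)\<^sup>2 - 2 * m * (indicator {a..b} x * f x) + m\<^sup>2 * indicator {a..b} x" by simp
  qed
  also have "\<dots> = (LINT x|lborel. (f x)\<^sup>2) - 2 * m * I + m\<^sup>2 * (b - a)"
  proof -
    have "(LINT x|lborel. indicator {a..b} x * f x) = I" by (simp add: I_def set_lebesgue_integral_def)
    then show ?thesis using i1 i2 i3 ab by simp
  qed
  also have "\<dots> = (LINT x|lborel. (f x)\<^sup>2) - I\<^sup>2 / (b - a)"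
  proof -
    have "m * (b - a) = I" using False by (simp add: m_def)
    then have "m\<^sup>2 * (b - a) = m * I" "m * I = I\<^sup>2 / (b - a)"
      by (simp_all add: power2_eq_square m_def)
    then show ?thesis by simp
  qed
  finally have "I\<^sup>2 / (b - a) \<le> (LINT x|lborel. (f x)\<^sup>2)" by simp
  then show ?thesis using False ab by (simp add: I_def field_simps)
qed

lemma L2_norm_tendsto_0_iff:
  "((\<lambda>h. L2_norm (q h)) \<longlongrightarrow> 0) F \<longleftrightarrow> ((\<lambda>h. LINT x|lborel. (q h x)\<^sup>2) \<longlongrightarrow> 0) F"
proof
  assume "((\<lambda>h. L2_norm (q h)) \<longlongrightarrow> 0) F"
  then show "((\<lambda>h. LINT x|lborel. (q h x)\<^sup>2) \<longlongrightarrow> 0) F"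
    using tendsto_power[of "\<lambda>h. L2_norm (q h)" 0 F 2] by (simp add: L2_norm_square)
next
  assume "((\<lambda>h. LINT x|lborel. (q h x)\<^sup>2) \<longlongrightarrow> 0) F"
  then show "((\<lambda>h. L2_norm (q h)) \<longlongrightarrow> 0) F"
    using tendsto_real_sqrt[of "\<lambda>h. LINT x|lborel. (q h x)\<^sup>2" 0 F] by (simp add: L2_norm_def)
qed

section \<open>Time derivatives in the mean square sense\<close>

lemma has_L2_time_deriv_quotient_L2:
  assumes "has_L2_time_deriv w v t"
  shows "(\<lambda>x. (w (t + h) x - w t x) / h - v x) \<in> L2"
  using L2_lincomb(1)[of "\<lambda>x. w (t + h) x - w t x" v "1 / h" "-1"] assms
  by (simp add: has_L2_time_deriv_def)

lemma has_L2_time_deriv_tendsto: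
  assumes "has_L2_time_deriv w v t"
  shows "((\<lambda>h. LINT x|lborel. ((w (t + h) x - w t x) / h - v x)\<^sup>2) \<longlongrightarrow> 0) (at 0)"
  using assms L2_norm_tendsto_0_iff[of "\<lambda>h x. (w (t + h) x - w t x) / h - v x"]
  by (simp add: has_L2_time_deriv_def)

text \<open>A linear combination of two differentiable curves; only the increments matter, up to null sets.\<close>

lemma has_L2_time_deriv_lincomb:
  assumes 1: "has_L2_time_deriv w1 v1 t1" and 2: "has_L2_time_deriv w2 v2 t2"
    and v: "v \<in> borel_measurable borel" "AE x in lborel. v x = p * v1 x + q * v2 x"
    and w: "\<And>h. w (t + h) \<in> borel_measurable borel"
    and inc: "\<And>h. AE x in lborel. w (t + h) x - w t x =
      p * (w1 (t1 + h) x - w1 t1 x) + q * (w2 (t2 + h) x - w2 t2 x)"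
  shows "has_L2_time_deriv w v t"
  unfolding has_L2_time_deriv_def
proof (intro conjI allI)
  have "(\<lambda>x. p * v1 x + q * v2 x) \<in> L2" using 1 2 by (intro L2_lincomb) (auto simp: has_L2_time_deriv_def)
  then show vL2: "v \<in> L2" using v by (intro L2_cong_AE[OF _ v(1)]) auto
  have [measurable]: "w (t + h) \<in> borel_measurable borel" "w t \<in> borel_measurable borel" for h
    using w[of h] w[of 0] by auto
  have [measurable]: "v \<in> borel_measurable borel" by fact
  show incL2: "(\<lambda>x. w (t + h) x - w t x) \<in> L2" for h
  proof (rule L2_cong_AE)
    show "(\<lambda>x. p * (w1 (t1 + h) x - w1 t1 x) + q * (w2 (t2 + h) x - w2 t2 x)) \<in> L2"
      using 1 2 by (intro L2_lincomb) (auto simp: has_L2_time_deriv_def)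
    show "AE x in lborel. p * (w1 (t1 + h) x - w1 t1 x) + q * (w2 (t2 + h) x - w2 t2 x) = w (t + h) x - w t x"
      using inc[of h] by eventually_elim simp
  qed simp
  let ?q1 = "\<lambda>h x. (w1 (t1 + h) x - w1 t1 x) / h - v1 x"
  let ?q2 = "\<lambda>h x. (w2 (t2 + h) x - w2 t2 x) / h - v2 x"
  let ?q = "\<lambda>h x. (w (t + h) x - w t x) / h - v x"
  have "((\<lambda>h. LINT x|lborel. (?q h x)\<^sup>2) \<longlongrightarrow> 0) (at 0)"
  proof (rule tendsto_sandwich[OF always_eventually always_eventually tendsto_const])
    show "\<forall>h. 0 \<le> (LINT x|lborel. (?q h x)\<^sup>2)" by simp
    show "\<forall>h. (LINT x|lborel. (?q h x)\<^sup>2) \<le>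
       2 * p\<^sup>2 * (LINT x|lborel. (?q1 h x)\<^sup>2) + 2 * q\<^sup>2 * (LINT x|lborel. (?q2 h x)\<^sup>2)"
    proof
      fix h
      have L: "?q1 h \<in> L2" "?q2 h \<in> L2" using 1 2 by (auto intro: has_L2_time_deriv_quotient_L2)
      then have [measurable]: "?q1 h \<in> borel_measurable borel" "?q2 h \<in> borel_measurable borel" by blast+
      have "(LINT x|lborel. (?q h x)\<^sup>2) = (LINT x|lborel. (p * ?q1 h x + q * ?q2 h x)\<^sup>2)"
      proof (rule integral_cong_AE)
        show "AE x in lborel. (?q h x)\<^sup>2 = (p * ?q1 h x + q * ?q2 h x)\<^sup>2"
          using v(2) inc[of h]
        proof eventually_elim
          case (elim x)
          then show ?case by (simp only: add_divide_distrib) (simp add: algebra_simps diff_divide_distrib)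
        qed
      qed simp_all
      then show "(LINT x|lborel. (?q h x)\<^sup>2) \<le>
       2 * p\<^sup>2 * (LINT x|lborel. (?q1 h x)\<^sup>2) + 2 * q\<^sup>2 * (LINT x|lborel. (?q2 h x)\<^sup>2)"
        using L2_lincomb(2)[OF L, of p q] by simp
    qed
    have "((\<lambda>h. 2 * p\<^sup>2 * (LINT x|lborel. (?q1 h x)\<^sup>2) + 2 * q\<^sup>2 * (LINT x|lborel. (?q2 h x)\<^sup>2))
        \<longlongrightarrow> 2 * p\<^sup>2 * 0 + 2 * q\<^sup>2 * 0) (at 0)"
      by (intro tendsto_intros has_L2_time_deriv_tendsto 1 2)
    then show "((\<lambda>h. 2 * p\<^sup>2 * (LINT x|lborel. (?q1 h x)\<^sup>2) + 2 * q\<^sup>2 * (LINT x|lborel. (?q2 h x)\<^sup>2)) \<longlongrightarrow> 0) (at 0)"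
      by simp
  qed
  then show "((\<lambda>h. L2_norm (?q h)) \<longlongrightarrow> 0) (at 0)" by (simp only: L2_norm_tendsto_0_iff)
qed

lemma has_L2_time_deriv_integral_tendsto:
  assumes w: "has_L2_time_deriv w v t" and ab: "a \<le> b"
  shows "((\<lambda>h. (LINT x:{a..b}|lborel. w (t + h) x - w t x) / h) \<longlongrightarrow> (LINT x:{a..b}|lborel. v x)) (at 0)"
proof -
  let ?q = "\<lambda>h x. (w (t + h) x - w t x) / h - v x"
  have vL2: "v \<in> L2" and iL2: "\<And>h. (\<lambda>x. w (t + h) x - w t x) \<in> L2"
    using w by (auto simp: has_L2_time_deriv_def)
  have eq: "(LINT x:{a..b}|lborel. ?q h x) = (LINT x:{a..b}|lborel. w (t + h) x - w t x) / h - (LINT x:{a..b}|lborel. v x)" for h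
  proof -
    have "set_integrable lborel {a..b} (\<lambda>x. (w (t + h) x - w t x) / h)"
      using locally_integrable_interval[OF L2_locally_integrable[OF iL2[of h]], of a b] by auto
    then show ?thesis
      using locally_integrable_interval[OF L2_locally_integrable[OF vL2], of a b] by simp
  qed
  have "((\<lambda>h. ((LINT x:{a..b}|lborel. w (t + h) x - w t x) / h - (LINT x:{a..b}|lborel. v x))\<^sup>2) \<longlongrightarrow> 0) (at 0)"
  proof (rule tendsto_sandwich[OF always_eventually always_eventually tendsto_const])
    show "\<forall>h. 0 \<le> ((LINT x:{a..b}|lborel. w (t + h) x - w t x) / h - (LINT x:{a..b}|lborel. v x))\<^sup>2" by simp
    show "\<forall>h. ((LINT x:{a..b}|lborel. w (t + h) x - w t x) / h - (LINT x:{a..b}|lborel. v x))\<^sup>2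
        \<le> (b - a) * (LINT x|lborel. (?q h x)\<^sup>2)"
      using integral_Icc_square_le[OF has_L2_time_deriv_quotient_L2[OF w] ab] by (simp only: eq) simp
    show "((\<lambda>h. (b - a) * (LINT x|lborel. (?q h x)\<^sup>2)) \<longlongrightarrow> 0) (at 0)"
      using tendsto_mult[OF tendsto_const has_L2_time_deriv_tendsto[OF w], of "b - a"] by simp
  qed
  then have "((\<lambda>h. sqrt (((LINT x:{a..b}|lborel. w (t + h) x - w t x) / h - (LINT x:{a..b}|lborel. v x))\<^sup>2)) \<longlongrightarrow> sqrt 0) (at 0)"
    by (rule tendsto_real_sqrt)
  then show ?thesis by (simp add: tendsto_rabs_zero_iff LIM_zero_iff)
qed

text \<open>The derivative is determined by the rates of change of the integrals over bounded intervals.\<close>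

lemma has_L2_time_deriv_AE_eq:
  assumes w: "has_L2_time_deriv w v t" and k: "locally_integrable k"
    and lim: "\<And>a b. a \<le> b \<Longrightarrow>
      ((\<lambda>h. (LINT x:{a..b}|lborel. w (t + h) x - w t x) / h) \<longlongrightarrow> (LINT x:{a..b}|lborel. k x)) (at 0)"
  shows "AE x in lborel. v x = k x"
proof -
  have lv: "locally_integrable v" using w by (intro L2_locally_integrable) (auto simp: has_L2_time_deriv_def)
  have eq: "prim v b - prim v a = prim k b - prim k a" if "a \<le> b" for a b
    using tendsto_unique[OF _ has_L2_time_deriv_integral_tendsto[OF w that] lim[OF that]]
    by (simp add: integral_eq_prim[OF lv that] integral_eq_prim[OF k that])
  have "prim v x = prim k x" for x
    using eq[of 0 x] eq[of x 0] by (cases "0 \<le> x") auto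
  then show ?thesis by (rule AE_eq_if_prim_eq[OF lv k])
qed

lemma has_L2_time_deriv_unique:
  assumes "has_L2_time_deriv w v t" "has_L2_time_deriv w v' t"
  shows "AE x in lborel. v x = v' x"
  using assms
  by (intro has_L2_time_deriv_AE_eq[OF assms(1)] has_L2_time_deriv_integral_tendsto L2_locally_integrable)
    (auto simp: has_L2_time_deriv_def)

lemma L2_time_deriv_AE_eq:
  assumes "has_L2_time_deriv w v t"
  shows "has_L2_time_deriv w (L2_time_deriv w t) t" "AE x in lborel. L2_time_deriv w t x = v x"
proof -
  show *: "has_L2_time_deriv w (L2_time_deriv w t) t"
    unfolding L2_time_deriv_def using someI[of "\<lambda>v. has_L2_time_deriv w v t" v] assms by blast
  show "AE x in lborel. L2_time_deriv w t x = v x" using * assms by (rule has_L2_time_deriv_unique)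
qed

section \<open>Continuous representatives of Sobolev functions\<close>

lemma has_weak_deriv_diff:
  assumes f: "has_weak_deriv f f'" and g: "has_weak_deriv g g'"
  shows "has_weak_deriv (\<lambda>x. f x - g x) (\<lambda>x. f' x - g' x)"
proof -
  have l: "locally_integrable f" "locally_integrable f'" "locally_integrable g" "locally_integrable g'"
    using f g by (auto simp: has_weak_deriv_def)
  have "(LINT x|lborel. (f x - g x) * deriv \<phi> x) = - (LINT x|lborel. (f' x - g' x) * \<phi> x)"
    if \<phi>: "test_function \<phi>" for \<phi>
    using f g \<phi> l[THEN integrable_mult_test_function, OF \<phi>] l[THEN integrable_mult_test_function, OF test_function_deriv[OF \<phi>]]
    by (simp add: has_weak_deriv_def left_diff_distrib)
  then show ?thesis using l by (simp add: has_weak_deriv_def locally_integrable_diff)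
qed

text \<open>The embedding of \<open>H\<^sup>1\<close> into the bounded functions, by averaging a pointwise estimate over an
  interval of length \<open>1\<close>.\<close>

lemma sobolev_bound:
  assumes \<eta>: "mollifier \<eta>" and fL2: "f \<in> L2" and gL2: "g \<in> L2" and fg: "has_weak_deriv f g"
    and c: "continuous_on UNIV k" and fk: "AE x in lborel. f x = k x"
  shows "(k x)\<^sup>2 \<le> 2 * (LINT x|lborel. (f x)\<^sup>2) + 2 * (LINT x|lborel. (g x)\<^sup>2)"
proof -
  let ?F = "LINT x|lborel. (f x)\<^sup>2" and ?G = "LINT x|lborel. (g x)\<^sup>2"
  have lg: "locally_integrable g" using gL2 by (rule L2_locally_integrable)
  obtain e where "AE x in lborel. f x = e + prim g x" using AE_prim_if_has_weak_deriv[OF \<eta> fg] by blast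
  with fk have "AE x in lborel. k x = e + prim g x" by eventually_elim simp
  then have k: "k x = e + prim g x" for x
    by (intro continuous_AE_eq c) (auto intro!: continuous_intros prim_continuous lg)
  have [measurable]: "f \<in> borel_measurable borel" "k \<in> borel_measurable borel"
    using fL2 c by (auto intro: borel_measurable_continuous_onI)
  have le: "(k x)\<^sup>2 \<le> 2 * (k y)\<^sup>2 + 2 * ?G" if "y \<in> {x..x + 1}" for y
  proof -
    have "(prim g y - prim g x)\<^sup>2 \<le> (y - x) * ?G"
      using integral_Icc_square_le[OF gL2, of x y] integral_eq_prim[OF lg, of x y] that by simp
    also have "\<dots> \<le> ?G" using that by (intro mult_left_le_one_le) auto
    finally have "2 * (prim g y - prim g x)\<^sup>2 \<le> 2 * ?G" by simp
    then show ?thesis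
      using square_lincomb_le[of 1 "k y" "-1" "prim g y - prim g x"] by (simp add: k)
  qed
  have kL2: "k \<in> L2" using L2_cong_AE[OF fL2 _ fk] by simp
  have ik: "set_integrable lborel {x..x + 1} (\<lambda>y. (k y)\<^sup>2)"
    using L2_integrable_square[OF kL2] unfolding set_integrable_def by (intro integrable_mult_indicator) auto
  have ig: "set_integrable lborel {x..x + 1} (\<lambda>y. 2 * ?G)"
    unfolding set_integrable_def using integrable_indicator_Icc by simp
  have i1: "set_integrable lborel {x..x + 1} (\<lambda>y. 2 * (k y)\<^sup>2 + 2 * ?G)"
    by (rule set_integral_add(1)[OF set_integrable_mult_right[OF ik] ig])
  have "(k x)\<^sup>2 = (LINT y:{x..x + 1}|lborel. (k x)\<^sup>2)" by (simp add: set_lebesgue_integral_def)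
  also have "\<dots> \<le> (LINT y:{x..x + 1}|lborel. 2 * (k y)\<^sup>2 + 2 * ?G)"
    by (rule set_integral_mono[OF _ i1 le]) (simp add: set_integrable_def integrable_indicator_Icc)
  also have "\<dots> = 2 * (LINT y:{x..x + 1}|lborel. (k y)\<^sup>2) + 2 * ?G"
    using set_integral_add(2)[OF set_integrable_mult_right[OF ik] ig]
    by (simp add: set_lebesgue_integral_def)
  also have "(LINT y:{x..x + 1}|lborel. (k y)\<^sup>2) \<le> (LINT y|lborel. (k y)\<^sup>2)"
    unfolding set_lebesgue_integral_def
    using ik L2_integrable_square[OF kL2] by (intro integral_mono) (auto simp: set_integrable_def indicator_def)
  also have "(LINT y|lborel. (k y)\<^sup>2) = ?F"
    by (rule integral_cong_AE) (use fk in auto)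
  finally show ?thesis by simp
qed

text \<open>By the embedding, the continuous representatives depend continuously on time, uniformly in space;
  hence they are jointly continuous.\<close>

lemma C_H1_continuous_representative:
  assumes \<eta>: "mollifier \<eta>" and u: "C_H1 u"
  shows "\<exists>v. continuous_on UNIV (\<lambda>(t, x). v t x) \<and> (\<forall>t. AE x in lborel. u t x = v t x)"
proof -
  have "\<exists>g c. u t \<in> L2 \<and> g \<in> L2 \<and> has_weak_deriv (u t) g \<and> (AE x in lborel. u t x = c + prim g x)" for t
    using u AE_prim_if_has_weak_deriv[OF \<eta>] unfolding C_H1_def H1_def by blast
  then obtain g c where g: "\<And>t. u t \<in> L2" "\<And>t. g t \<in> L2" "\<And>t. has_weak_deriv (u t) (g t)"
    "\<And>t. AE x in lborel. u t x = c t + prim (g t) x" by metis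
  define v where "v t x = c t + prim (g t) x" for t x
  have cv: "continuous_on UNIV (v t)" for t
    unfolding v_def using g(2) by (intro continuous_intros prim_continuous L2_locally_integrable)
  have uv: "AE x in lborel. u t x = v t x" for t using g(4) by (simp add: v_def)
  have bound: "\<bar>v s x - v t x\<bar> \<le> 2 * H1_norm (\<lambda>x. u s x - u t x)" for s t x
  proof -
    let ?d = "\<lambda>x. u s x - u t x"
    have wd: "has_weak_deriv ?d (\<lambda>x. g s x - g t x)" using g(3) by (intro has_weak_deriv_diff)
    have ae: "AE x in lborel. g s x - g t x = weak_deriv ?d x"
      using weak_deriv_AE_eq(1)[OF \<eta> wd] by (auto simp: eq_commute)
    have wd': "has_weak_deriv ?d (weak_deriv ?d)" by (rule weak_deriv_AE_eq(2)[OF \<eta> wd])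
    have gL2: "weak_deriv ?d \<in> L2"
      using wd' by (intro L2_cong_AE[OF L2_diff[OF g(2) g(2)] _ ae]) (auto simp: has_weak_deriv_def)
    have "(v s x - v t x)\<^sup>2 \<le> 2 * (LINT x|lborel. (?d x)\<^sup>2) + 2 * (LINT x|lborel. (weak_deriv ?d x)\<^sup>2)"
    proof (rule sobolev_bound[where k = "\<lambda>x. v s x - v t x" and x = x, OF \<eta> L2_diff[OF g(1)[of s] g(1)[of t]] gL2 wd'])
      show "continuous_on UNIV (\<lambda>x. v s x - v t x)" by (intro continuous_intros cv)
      show "AE x in lborel. ?d x = v s x - v t x" using uv[of s] uv[of t] by eventually_elim simp
    qed
    also have "\<dots> = 2 * (H1_norm ?d)\<^sup>2" by (simp add: H1_norm_def L2_norm_square)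
    also have "\<dots> \<le> (2 * H1_norm ?d)\<^sup>2" by (simp add: power_mult_distrib)
    finally have "\<bar>v s x - v t x\<bar> \<le> \<bar>2 * H1_norm ?d\<bar>" by (simp only: abs_le_square_iff)
    moreover have "0 \<le> H1_norm ?d" by (simp add: H1_norm_def)
    ultimately show ?thesis by simp
  qed
  have "((\<lambda>p. v (fst p) (snd p)) \<longlongrightarrow> v t x) (at (t, x))" for t x
  proof (rule LIM_zero_cancel, rule Lim_null_comparison)
    let ?b = "\<lambda>p. 2 * H1_norm (\<lambda>x. u (fst p) x - u t x) + \<bar>v t (snd p) - v t x\<bar>"
    show "\<forall>\<^sub>F p in at (t, x). norm (v (fst p) (snd p) - v t x) \<le> ?b p"
    proof (rule always_eventually, rule allI)
      fix p :: "real \<times> real"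
      show "norm (v (fst p) (snd p) - v t x) \<le> ?b p"
        using bound[of "fst p" "snd p" t] by auto
    qed
    have h: "((\<lambda>s. H1_norm (\<lambda>x. u s x - u t x)) \<longlongrightarrow> 0) (nhds t)"
    proof -
      have "((\<lambda>s. H1_norm (\<lambda>x. u s x - u t x)) \<longlongrightarrow> 0) (at t)" using u by (simp add: C_H1_def)
      moreover have "H1_norm (\<lambda>x. u t x - u t x) = 0"
      proof -
        have "has_weak_deriv (\<lambda>x. u t x - u t x) (\<lambda>x. g t x - g t x)" using g(3) by (intro has_weak_deriv_diff)
        then have "AE x in lborel. (weak_deriv (\<lambda>x. u t x - u t x) x)\<^sup>2 = 0"
          using weak_deriv_AE_eq(1)[OF \<eta>] by auto
        then have "(LINT x|lborel. (weak_deriv (\<lambda>x. u t x - u t x) x)\<^sup>2) = 0"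
          by (rule integral_eq_zero_AE)
        then show ?thesis by (simp add: H1_norm_def L2_norm_square)
      qed
      ultimately show ?thesis by (simp add: tendsto_nhds_iff)
    qed
    have 1: "((\<lambda>p. H1_norm (\<lambda>x. u (fst p) x - u t x)) \<longlongrightarrow> 0) (at (t, x))"
      by (rule filterlim_compose[OF h]) (use tendsto_fst[OF tendsto_ident_at, of "(t, x)" UNIV] in simp)
    have 2: "((\<lambda>p. v t (snd p)) \<longlongrightarrow> v t x) (at (t, x))"
    proof (rule isCont_tendsto_compose[where g = "v t" and f = snd])
      show "isCont (v t) x" using cv[of t] by (simp add: continuous_on_eq_continuous_at)
      show "(snd \<longlongrightarrow> x) (at (t, x))" using tendsto_snd[OF tendsto_ident_at, of "(t, x)" UNIV] by simp
    qed
    have "(?b \<longlongrightarrow> 2 * 0 + \<bar>v t x - v t x\<bar>) (at (t, x))" by (intro tendsto_intros 1 2)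
    then show "(?b \<longlongrightarrow> 0) (at (t, x))" by simp
  qed
  then have "continuous_on UNIV (\<lambda>(t, x). v t x)"
    by (auto simp: continuous_on_def split_beta)
  then show ?thesis using uv by blast
qed

section \<open>Primitives depending on a parameter\<close>

lemma prim_cong_on:
  assumes "\<And>y. min 0 x < y \<Longrightarrow> y < max 0 x \<Longrightarrow> f y = g y"
  shows "prim f x = prim g x"
  unfolding prim_def by (rule interval_integral_cong) (use assms in \<open>auto simp: einterval_iff min_def max_def split: if_splits\<close>)

lemma prim_eq_if_zero_between:
  assumes g: "locally_integrable g" and z: "\<And>y. min a b \<le> y \<Longrightarrow> y \<le> max a b \<Longrightarrow> g y = 0"
  shows "prim g a = prim g b"
proof -
  have "prim g (max a b) - prim g (min a b) = (LINT y:{min a b..max a b}|lborel. g y)"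
    using integral_eq_prim[OF g, of "min a b" "max a b"] by simp
  also have "\<dots> = (LINT y:{min a b..max a b}|lborel. 0)"
    by (rule set_lebesgue_integral_cong) (auto intro: z)
  finally have "prim g (max a b) = prim g (min a b)" by simp
  then show ?thesis by (simp add: max_def min_def split: if_splits)
qed

text \<open>Rescaling turns the variable endpoint into a fixed one.\<close>

lemma prim_eq_integral_unit:
  assumes g: "continuous_on UNIV g"
  shows "prim g t = integral {0..1} (\<lambda>r. t * g (t * r))"
proof -
  have "((\<lambda>r. t * g (t * r)) has_integral (prim g (t * 1) - prim g (t * 0))) {0..1}"
  proof (rule fundamental_theorem_of_calculus)
    fix r :: real
    have "((\<lambda>r. prim g (t * r)) has_real_derivative g (t * r) * t) (at r)"
      by (rule DERIV_chain2[OF prim_has_real_derivative[OF g]]) (auto intro!: derivative_eq_intros)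
    then have "((\<lambda>r. prim g (t * r)) has_vector_derivative g (t * r) * t) (at r)"
      by (simp only: has_real_derivative_iff_has_vector_derivative)
    then show "((\<lambda>r. prim g (t * r)) has_vector_derivative t * g (t * r)) (at r within {0..1})"
      by (simp add: mult.commute has_vector_derivative_at_within)
  qed simp
  then have "((\<lambda>r. t * g (t * r)) has_integral prim g t) {0..1}" by simp
  then show ?thesis by (rule integral_unique[symmetric])
qed

lemma continuous_on_uncurry_compose:
  assumes k: "continuous_on UNIV (\<lambda>(s, p). k s p)" and "continuous_on A f" "continuous_on A g"
  shows "continuous_on A (\<lambda>z. k (f z) (g z))"
proof -
  have "continuous_on A (\<lambda>z. (\<lambda>(s, p). k s p) (f z, g z))"
    by (rule continuous_on_compose2[OF k]) (auto intro!: continuous_intros assms)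
  then show ?thesis by simp
qed

lemma prim_param_continuous:
  fixes k :: "real \<Rightarrow> real \<Rightarrow> real"
  assumes k: "continuous_on UNIV (\<lambda>(s, p). k s p)"
  shows "continuous_on UNIV (\<lambda>(t, p). prim (\<lambda>s. k s p) t)"
proof -
  have c: "continuous_on UNIV (\<lambda>s. k s p)" for p
    by (intro continuous_on_uncurry_compose[OF k] continuous_intros)
  have "continuous_on UNIV (\<lambda>q. integral (cbox 0 1) (\<lambda>r. fst q * k (fst q * r) (snd q)))"
  proof (rule integral_continuous_on_param)
    show "continuous_on (UNIV \<times> cbox 0 1) (\<lambda>(q, r). fst q * k (fst q * r) (snd q))"
      unfolding split_beta by (intro continuous_intros continuous_on_uncurry_compose[OF k])
  qed
  then show ?thesis by (simp add: split_beta prim_eq_integral_unit[OF c])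
qed

lemma prim_param_derivative:
  fixes k k' :: "real \<Rightarrow> real \<Rightarrow> real"
  assumes k: "continuous_on UNIV (\<lambda>(s, p). k s p)" and k': "continuous_on UNIV (\<lambda>(s, p). k' s p)"
    and d: "\<And>s p. ((\<lambda>p. k s p) has_real_derivative k' s p) (at p)"
  shows "((\<lambda>p. prim (\<lambda>s. k s p) t) has_real_derivative prim (\<lambda>s. k' s p) t) (at p)"
proof -
  have c: "continuous_on UNIV (\<lambda>s. k s p)" "continuous_on UNIV (\<lambda>s. k' s p)" for p
    by (intro continuous_on_uncurry_compose[OF k] continuous_on_uncurry_compose[OF k'] continuous_intros)+
  have "((\<lambda>p. integral (cbox 0 1) (\<lambda>r. t * k (t * r) p)) has_real_derivative
      integral (cbox 0 1) (\<lambda>r. t * k' (t * r) p)) (at p within UNIV)"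
  proof (rule leibniz_rule_field_derivative)
    show "((\<lambda>p. t * k (t * r) p) has_real_derivative t * k' (t * r) p) (at p within UNIV)" for p r
      using DERIV_cmult[OF d] by simp
    show "(\<lambda>r. t * k (t * r) p) integrable_on cbox 0 1" for p
      by (intro integrable_continuous continuous_intros continuous_on_compose2[OF c(1)]) auto
    show "continuous_on (UNIV \<times> cbox 0 1) (\<lambda>(p, r). t * k' (t * r) p)"
      unfolding split_beta by (intro continuous_intros continuous_on_uncurry_compose[OF k'])
  qed auto
  then show ?thesis by (simp add: prim_eq_integral_unit[OF c(1)] prim_eq_integral_unit[OF c(2)])
qed

text \<open>Leibniz' rule with the parameter as upper endpoint.\<close>

lemma prim_diagonal_derivative:
  fixes k k' :: "real \<Rightarrow> real \<Rightarrow> real"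
  assumes k: "continuous_on UNIV (\<lambda>(s, p). k s p)" and k': "continuous_on UNIV (\<lambda>(s, p). k' s p)"
    and d: "\<And>s p. ((\<lambda>p. k s p) has_real_derivative k' s p) (at p)"
  shows "((\<lambda>t. prim (\<lambda>s. k s t) t) has_real_derivative k t t + prim (\<lambda>s. k' s t) t) (at t)"
proof -
  have c: "continuous_on UNIV (\<lambda>s. k s p)" for p
    by (intro continuous_on_uncurry_compose[OF k] continuous_intros)
  have "((\<lambda>(p, y). prim (\<lambda>s. k s p) y) has_derivative
      (\<lambda>(tp, ty). prim (\<lambda>s. k' s t) t * tp + blinfun_mult_right (k t t) ty)) (at (t, t) within UNIV \<times> UNIV)"
  proof (rule has_derivative_partialsI[where f = "\<lambda>p y. prim (\<lambda>s. k s p) y"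
        and fy = "\<lambda>p y. blinfun_mult_right (k y p)" and fx = "(*) (prim (\<lambda>s. k' s t) t)"])
    show "((\<lambda>p. prim (\<lambda>s. k s p) t) has_derivative (*) (prim (\<lambda>s. k' s t) t)) (at t within UNIV)"
      using prim_param_derivative[OF assms] by (simp add: has_field_derivative_def)
    show "(prim (\<lambda>s. k s p) has_derivative blinfun_apply (blinfun_mult_right (k y p))) (at y within UNIV)" for p y
      using prim_has_real_derivative[OF c[of p], of y] by (simp add: has_field_derivative_def)
    have "continuous_on UNIV (\<lambda>z. blinfun_mult_right (k (snd z) (fst z)))"
      by (intro continuous_intros continuous_on_uncurry_compose[OF k])
    then have "isCont (\<lambda>z. blinfun_mult_right (k (snd z) (fst z))) (t, t)"
      unfolding continuous_on_eq_continuous_at[OF open_UNIV] by blast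
    then show "continuous (at (t, t) within UNIV \<times> UNIV) (\<lambda>(p, y). blinfun_mult_right (k y p))"
      by (simp add: case_prod_unfold)
  qed auto
  then have "((\<lambda>(p, y). prim (\<lambda>s. k s p) y) has_derivative
      (\<lambda>(tp, ty). prim (\<lambda>s. k' s t) t * tp + k t t * ty)) (at (t, t))"
    by (simp add: split_beta)
  moreover have "((\<lambda>t. (t, t)) has_derivative (\<lambda>h. (h, h))) (at t)"
    by (intro derivative_intros)
  ultimately have "((\<lambda>t. (\<lambda>(p, y). prim (\<lambda>s. k s p) y) (t, t)) has_derivative
      (\<lambda>h. (\<lambda>(tp, ty). prim (\<lambda>s. k' s t) t * tp + k t t * ty) (h, h))) (at t)"
    by (rule has_derivative_compose[rotated])
  moreover have "(\<lambda>h. (\<lambda>(tp, ty). prim (\<lambda>s. k' s t) t * tp + k t t * ty) (h, h))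
      = (*) (k t t + prim (\<lambda>s. k' s t) t)"
    by (simp add: fun_eq_iff algebra_simps)
  ultimately show ?thesis by (simp add: has_field_derivative_def)
qed

lemma integral_param_derivative:
  fixes k k' :: "real \<Rightarrow> real \<Rightarrow> real"
  assumes k: "continuous_on UNIV (\<lambda>(t, x). k t x)" and k': "continuous_on UNIV (\<lambda>(t, x). k' t x)"
    and d: "\<And>t x. ((\<lambda>t. k t x) has_real_derivative k' t x) (at t)"
  shows "((\<lambda>t. integral {a..b} (k t)) has_real_derivative integral {a..b} (k' t)) (at t)"
proof -
  have "((\<lambda>t. integral (cbox a b) (k t)) has_real_derivative integral (cbox a b) (k' t)) (at t within UNIV)"
  proof (rule leibniz_rule_field_derivative)
    show "k t integrable_on cbox a b" for t
      by (intro integrable_continuous continuous_on_uncurry_compose[OF k] continuous_intros)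
    show "continuous_on (UNIV \<times> cbox a b) (\<lambda>(t, x). k' t x)"
      by (rule continuous_on_subset[OF k']) auto
  qed (use d in auto)
  then show ?thesis by simp
qed

section \<open>The Duhamel term of a localized source\<close>

text \<open>A source that is jointly continuous in time and space and vanishes for \<open>\<bar>y\<bar> \<ge> 1\<close>.\<close>

definition localized_source :: "(real \<Rightarrow> real \<Rightarrow> real) \<Rightarrow> bool" where
  "localized_source F \<longleftrightarrow> continuous_on UNIV (\<lambda>(s, y). F s y) \<and> (\<forall>s y. 1 \<le> \<bar>y\<bar> \<longrightarrow> F s y = 0)"

text \<open>The integral of the source from time \<open>0\<close> to time \<open>t\<close> along the left-moving characteristic that
  starts at \<open>z\<close> at time \<open>0\<close>, so that it is at \<open>z - t\<close> at time \<open>t\<close>.  As \<open>prim\<close> is oriented, negative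
  times are covered.\<close>

definition left_char :: "(real \<Rightarrow> real \<Rightarrow> real) \<Rightarrow> real \<Rightarrow> real \<Rightarrow> real" where
  "left_char F t z = prim (\<lambda>s. F s (z - s)) t"

text \<open>The same along the right-moving characteristic that starts at \<open>z\<close>.\<close>

definition right_char :: "(real \<Rightarrow> real \<Rightarrow> real) \<Rightarrow> real \<Rightarrow> real \<Rightarrow> real" where
  "right_char F t z = prim (\<lambda>s. F s (z + s)) t"

text \<open>The integral of the source over the backward light cone of \<open>(t, x)\<close>.\<close>

definition duhamel :: "(real \<Rightarrow> real \<Rightarrow> real) \<Rightarrow> real \<Rightarrow> real \<Rightarrow> real" where
  "duhamel F t x =
    (LBINT s=ereal 0..ereal t. (LBINT y=ereal (x - (t - s))..ereal (x + (t - s)). F s y))"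

lemma localized_source_continuous:
  assumes "localized_source F" "continuous_on A f" "continuous_on A g"
  shows "continuous_on A (\<lambda>z. F (f z) (g z))"
  using continuous_on_uncurry_compose[OF _ assms(2,3)] assms(1) unfolding localized_source_def by blast

lemma localized_source_zero: "localized_source F \<Longrightarrow> 1 \<le> \<bar>y\<bar> \<Longrightarrow> F s y = 0"
  unfolding localized_source_def by blast

lemma localized_source_reflect:
  assumes "localized_source F" shows "localized_source (\<lambda>s y. F s (- y))"
proof -
  have "continuous_on UNIV (\<lambda>z. F (fst z) (- snd z))"
    by (intro localized_source_continuous[OF assms] continuous_intros)
  moreover have "F s (- y) = 0" if "1 \<le> \<bar>y\<bar>" for s y using localized_source_zero[OF assms] that by simp
  ultimately show ?thesis unfolding localized_source_def split_beta by blast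
qed

lemma right_char_eq_reflect: "right_char F t z = left_char (\<lambda>s y. F s (- y)) t (- z)"
  by (simp add: right_char_def left_char_def add.commute)

lemma left_char_continuous:
  assumes F: "localized_source F" and "continuous_on A f" "continuous_on A g"
  shows "continuous_on A (\<lambda>x. left_char F (f x) (g x))"
proof (rule continuous_on_uncurry_compose[OF _ assms(2,3)])
  have "continuous_on UNIV (\<lambda>(s, p). F s (p - s))"
    unfolding split_beta by (intro localized_source_continuous[OF F] continuous_intros)
  then show "continuous_on UNIV (\<lambda>(t, p). left_char F t p)"
    unfolding left_char_def by (rule prim_param_continuous)
qed

lemma right_char_continuous:
  assumes F: "localized_source F" and "continuous_on A f" "continuous_on A g"
  shows "continuous_on A (\<lambda>x. right_char F (f x) (g x))"
  unfolding right_char_eq_reflect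
  by (intro left_char_continuous localized_source_reflect F assms continuous_intros)

lemma left_char_derivative:
  assumes F: "localized_source F"
  shows "((\<lambda>t. left_char F t z) has_real_derivative F t (z - t)) (at t)"
  unfolding left_char_def
  by (intro prim_has_real_derivative localized_source_continuous[OF F] continuous_intros)

lemma left_char_locally_integrable: "localized_source F \<Longrightarrow> locally_integrable (left_char F t)"
  by (intro locally_integrable_continuous left_char_continuous continuous_intros)

lemma right_char_locally_integrable: "localized_source F \<Longrightarrow> locally_integrable (right_char F t)"
  by (intro locally_integrable_continuous right_char_continuous continuous_intros)

lemma left_char_zero:
  assumes F: "localized_source F" and z: "1 + \<bar>t\<bar> \<le> \<bar>z\<bar>"
  shows "left_char F t z = 0"
proof -
  have "left_char F t z = prim (\<lambda>_. 0) t"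
    unfolding left_char_def
    by (rule prim_cong_on, rule localized_source_zero[OF F]) (use z in auto)
  then show ?thesis by (simp add: prim_def)
qed

lemma right_char_zero:
  assumes F: "localized_source F" and z: "1 + \<bar>t\<bar> \<le> \<bar>z\<bar>"
  shows "right_char F t z = 0"
  unfolding right_char_eq_reflect using z by (intro left_char_zero localized_source_reflect F) simp

text \<open>A characteristic has left the support of the source for good once \<open>t \<ge> \<bar>z\<bar> + 1\<close>.\<close>

lemma left_char_stationary:
  assumes F: "localized_source F" and "\<bar>z\<bar> + 1 \<le> t" "\<bar>z\<bar> + 1 \<le> t'"
  shows "left_char F t z = left_char F t' z"
  unfolding left_char_def
proof (rule prim_eq_if_zero_between)
  show "locally_integrable (\<lambda>s. F s (z - s))"
    by (intro locally_integrable_continuous localized_source_continuous[OF F] continuous_intros)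
  show "F s (z - s) = 0" if "min t t' \<le> s" for s
    by (rule localized_source_zero[OF F]) (use assms that in auto)
qed

lemma right_char_stationary:
  assumes F: "localized_source F" and "\<bar>z\<bar> + 1 \<le> t" "\<bar>z\<bar> + 1 \<le> t'"
  shows "right_char F t z = right_char F t' z"
  unfolding right_char_eq_reflect using assms(2,3) by (intro left_char_stationary localized_source_reflect F) simp_all

lemma right_char_derivative:
  assumes F: "localized_source F"
  shows "((\<lambda>t. right_char F t z) has_real_derivative F t (z + t)) (at t)"
  unfolding right_char_def
  by (intro prim_has_real_derivative localized_source_continuous[OF F] continuous_intros)

lemma duhamel_eq_prim:
  assumes F: "localized_source F"
  shows "duhamel F t x = prim (\<lambda>s. prim (F s) (x + (t - s)) - prim (F s) (x - (t - s))) t"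
proof -
  have "locally_integrable (F s)" for s
    by (intro locally_integrable_continuous localized_source_continuous[OF F] continuous_intros)
  then show ?thesis
    unfolding duhamel_def prim_def[of "\<lambda>s. prim (F s) (x + (t - s)) - prim (F s) (x - (t - s))"]
    by (simp add: LBINT_eq_prim)
qed

lemma source_prim_continuous:
  assumes F: "localized_source F" and "continuous_on A f" "continuous_on A g"
  shows "continuous_on A (\<lambda>z. prim (F (f z)) (g z))"
proof -
  have "continuous_on UNIV (\<lambda>(s, p). F p s)"
    unfolding split_beta by (intro localized_source_continuous[OF F] continuous_intros)
  then have "continuous_on UNIV (\<lambda>(y, s). prim (\<lambda>y. F s y) y)" by (rule prim_param_continuous)
  from continuous_on_uncurry_compose[OF this assms(3,2)] show ?thesis .
qed

lemma source_prim_derivative: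
  assumes F: "localized_source F"
  shows "(prim (F s) has_real_derivative F s y) (at y)"
  by (intro prim_has_real_derivative localized_source_continuous[OF F] continuous_intros)

lemma duhamel_derivative_space:
  assumes F: "localized_source F"
  shows "((\<lambda>x. duhamel F t x) has_real_derivative left_char F t (x + t) - right_char F t (x - t)) (at x)"
proof -
  have 1: "((\<lambda>x. prim (F s) (x + (t - s))) has_real_derivative F s (x + (t - s)) * 1) (at x)" for s x
    by (rule DERIV_chain2[OF source_prim_derivative[OF F]]) (auto intro!: derivative_eq_intros)
  have 2: "((\<lambda>x. prim (F s) (x - (t - s))) has_real_derivative F s (x - (t - s)) * 1) (at x)" for s x
    by (rule DERIV_chain2[OF source_prim_derivative[OF F]]) (auto intro!: derivative_eq_intros)
  have d: "((\<lambda>x. prim (F s) (x + (t - s)) - prim (F s) (x - (t - s))) has_real_derivative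
      F s (x + (t - s)) - F s (x - (t - s))) (at x)" for s x
    using DERIV_diff[OF 1[of s x] 2[of s x]] by simp
  have l: "locally_integrable (\<lambda>s. F s (x + (t - s)))" "locally_integrable (\<lambda>s. F s (x - (t - s)))"
    by (intro locally_integrable_continuous localized_source_continuous[OF F] continuous_intros)+
  have "((\<lambda>x. prim (\<lambda>s. prim (F s) (x + (t - s)) - prim (F s) (x - (t - s))) t) has_real_derivative
      prim (\<lambda>s. F s (x + (t - s)) - F s (x - (t - s))) t) (at x)"
    by (rule prim_param_derivative) (auto simp: split_beta intro!: d source_prim_continuous[OF F]
      localized_source_continuous[OF F] continuous_intros)
  also have "prim (\<lambda>s. F s (x + (t - s)) - F s (x - (t - s))) t = left_char F t (x + t) - right_char F t (x - t)"
    using prim_diff[OF l] by (simp add: left_char_def right_char_def algebra_simps)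
  finally show ?thesis by (simp only: duhamel_eq_prim[OF F])
qed

text \<open>The moving endpoint contributes nothing, since the cone degenerates at its vertex.\<close>

lemma duhamel_derivative_time:
  assumes F: "localized_source F"
  shows "((\<lambda>t. duhamel F t x) has_real_derivative left_char F t (x + t) + right_char F t (x - t)) (at t)"
proof -
  have 1: "((\<lambda>t. prim (F s) (x + (t - s))) has_real_derivative F s (x + (t - s)) * 1) (at t)" for s t
    by (rule DERIV_chain2[OF source_prim_derivative[OF F]]) (auto intro!: derivative_eq_intros)
  have 2: "((\<lambda>t. prim (F s) (x - (t - s))) has_real_derivative F s (x - (t - s)) * (-1)) (at t)" for s t
    by (rule DERIV_chain2[OF source_prim_derivative[OF F]]) (auto intro!: derivative_eq_intros)
  have d: "((\<lambda>t. prim (F s) (x + (t - s)) - prim (F s) (x - (t - s))) has_real_derivative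
      F s (x + (t - s)) + F s (x - (t - s))) (at t)" for s t
    using DERIV_diff[OF 1[of s t] 2[of s t]] by simp
  have l: "locally_integrable (\<lambda>s. F s (x + (t - s)))" "locally_integrable (\<lambda>s. F s (x - (t - s)))"
    by (intro locally_integrable_continuous localized_source_continuous[OF F] continuous_intros)+
  have "((\<lambda>t. prim (\<lambda>s. prim (F s) (x + (t - s)) - prim (F s) (x - (t - s))) t) has_real_derivative
      (prim (F t) (x + (t - t)) - prim (F t) (x - (t - t))) + prim (\<lambda>s. F s (x + (t - s)) + F s (x - (t - s))) t) (at t)"
    by (rule prim_diagonal_derivative) (auto simp: split_beta intro!: d source_prim_continuous[OF F]
      localized_source_continuous[OF F] continuous_intros)
  also have "(prim (F t) (x + (t - t)) - prim (F t) (x - (t - t))) + prim (\<lambda>s. F s (x + (t - s)) + F s (x - (t - s))) t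
      = left_char F t (x + t) + right_char F t (x - t)"
    using prim_add[OF l] by (simp add: left_char_def right_char_def algebra_simps)
  finally show ?thesis by (simp only: duhamel_eq_prim[OF F])
qed

lemma duhamel_continuous:
  assumes F: "localized_source F"
  shows "continuous_on UNIV (\<lambda>(t, x). duhamel F t x)"
proof -
  have "continuous_on UNIV (\<lambda>q. integral (cbox 0 1) (\<lambda>r. fst q * (prim (F (fst q * r)) (snd q + (fst q - fst q * r))
      - prim (F (fst q * r)) (snd q - (fst q - fst q * r)))))"
  proof (rule integral_continuous_on_param)
    show "continuous_on (UNIV \<times> cbox 0 1) (\<lambda>(q, r). fst q * (prim (F (fst q * r)) (snd q + (fst q - fst q * r))
      - prim (F (fst q * r)) (snd q - (fst q - fst q * r))))"
      unfolding split_beta by (intro continuous_intros source_prim_continuous[OF F])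
  qed
  moreover have "duhamel F t x = integral {0..1} (\<lambda>r. t * (prim (F (t * r)) (x + (t - t * r)) - prim (F (t * r)) (x - (t - t * r))))" for t x
    unfolding duhamel_eq_prim[OF F]
    by (intro prim_eq_integral_unit continuous_intros source_prim_continuous[OF F])
  ultimately show ?thesis by (simp add: split_beta)
qed

lemma duhamel_zero:
  assumes F: "localized_source F" and x: "1 + \<bar>t\<bar> \<le> \<bar>x\<bar>"
  shows "duhamel F t x = 0"
proof -
  have "prim (F s) (x + (t - s)) = prim (F s) (x - (t - s))" if "min 0 t < s" "s < max 0 t" for s
  proof (rule prim_eq_if_zero_between)
    show "locally_integrable (F s)"
      by (intro locally_integrable_continuous localized_source_continuous[OF F] continuous_intros)
    show "F s y = 0" if y: "min (x + (t - s)) (x - (t - s)) \<le> y" "y \<le> max (x + (t - s)) (x - (t - s))" for y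
      by (rule localized_source_zero[OF F]) (use x y \<open>min 0 t < s\<close> \<open>s < max 0 t\<close> in auto)
  qed
  then have "duhamel F t x = prim (\<lambda>_. 0) t"
    unfolding duhamel_eq_prim[OF F] by (intro prim_cong_on) simp
  then show ?thesis by (simp add: prim_def)
qed

lemma duhamel_0 [simp]: "duhamel F 0 x = 0"
  by (simp add: duhamel_def)

text \<open>A classical time derivative is one in the mean square sense if the increments are supported in a
  bounded set: by the mean value theorem the difference quotients converge uniformly.\<close>

lemma has_L2_time_deriv_classical:
  assumes d: "\<And>s x. ((\<lambda>s. w s x) has_real_derivative w' s x) (at s)"
    and w: "\<And>s. continuous_on UNIV (w s)" and w': "continuous_on UNIV (\<lambda>(s, x). w' s x)"
    and R: "R \<ge> 0" and supp: "\<And>h x. R + \<bar>h\<bar> < \<bar>x\<bar> \<Longrightarrow> w (t + h) x = w t x"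
  shows "has_L2_time_deriv w (w' t) t"
  unfolding has_L2_time_deriv_def L2_norm_tendsto_0_iff
proof (intro conjI allI)
  have cw': "continuous_on UNIV (w' s)" for s
    by (intro continuous_on_uncurry_compose[OF w'] continuous_intros)
  have [measurable]: "w s \<in> borel_measurable borel" "w' s \<in> borel_measurable borel" for s
    using w cw' by (auto intro: borel_measurable_continuous_onI)
  have z: "w' t x = 0" if "R < \<bar>x\<bar>" for x
  proof -
    have "((\<lambda>s. w t x) has_real_derivative 0) (at t)" by simp
    then have "((\<lambda>s. w s x) has_real_derivative 0) (at t)"
    proof (rule has_field_derivative_transform_within)
      show "w t x = w s x" if "dist s t < \<bar>x\<bar> - R" for s
        using supp[of "s - t" x] that by (simp add: dist_real_def)
    qed (use that in auto)
    then show ?thesis by (rule DERIV_unique[OF d])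
  qed
  show "w' t \<in> L2" by (rule L2_continuous_bounded_support[OF cw' R z])
  show "(\<lambda>x. w (t + h) x - w t x) \<in> L2" for h
  proof (rule L2_continuous_bounded_support)
    show "continuous_on UNIV (\<lambda>x. w (t + h) x - w t x)" by (intro continuous_intros w)
    show "w (t + h) x - w t x = 0" if "R + \<bar>h\<bar> < \<bar>x\<bar>" for x using supp[OF that] by simp
    show "0 \<le> R + \<bar>h\<bar>" using R by simp
  qed
  show "((\<lambda>h. LINT x|lborel. ((w (t + h) x - w t x) / h - w' t x)\<^sup>2) \<longlongrightarrow> 0) (at 0)"
    unfolding tendsto_iff
  proof (intro allI impI)
    fix e :: real assume e: "e > 0"
    \<comment> \<open>Chosen such that \<open>2 * (R + 1) * b\<^sup>2 = e / 2\<close>.\<close>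
    define b where "b = sqrt (e / (4 * (R + 1)))"
    have b: "b > 0" "b\<^sup>2 = e / (4 * (R + 1))" using e R by (auto simp: b_def)
    let ?K = "{t - 1..t + 1} \<times> {-(R + 1)..R + 1}"
    have "uniformly_continuous_on ?K (\<lambda>(s, x). w' s x)"
      by (rule compact_uniformly_continuous) (auto intro!: compact_Times continuous_on_subset[OF w'])
    then obtain \<delta> where \<delta>: "\<delta> > 0" "\<forall>p\<in>?K. \<forall>q\<in>?K. dist q p < \<delta> \<longrightarrow>
        dist ((\<lambda>(s, x). w' s x) q) ((\<lambda>(s, x). w' s x) p) < b"
      unfolding uniformly_continuous_on_def using b(1) by blast
    have near: "\<bar>w' s x - w' t x\<bar> \<le> b" if "\<bar>s - t\<bar> < min \<delta> 1" "\<bar>x\<bar> \<le> R + 1" for s x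
    proof -
      have "(s, x) \<in> ?K" "(t, x) \<in> ?K" "dist (s, x) (t, x) < \<delta>"
        using that by (auto simp: dist_prod_def dist_real_def)
      then show ?thesis using \<delta>(2) by (fastforce simp: dist_real_def)
    qed
    have "\<forall>\<^sub>F h in at 0. h \<noteq> 0 \<and> \<bar>h\<bar> < min \<delta> 1"
      unfolding eventually_at using \<delta>(1) by (intro exI[of _ "min \<delta> 1"]) auto
    then show "\<forall>\<^sub>F h in at 0. dist (LINT x|lborel. ((w (t + h) x - w t x) / h - w' t x)\<^sup>2) 0 < e"
    proof eventually_elim
      case (elim h)
      let ?q = "\<lambda>x. (w (t + h) x - w t x) / h - w' t x"
      have q: "\<bar>?q x\<bar> \<le> b" if x: "\<bar>x\<bar> \<le> R + 1" for x
      proof -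
        obtain s where s: "\<bar>s - t\<bar> \<le> \<bar>h\<bar>" "w (t + h) x - w t x = h * w' s x"
        proof (cases "h > 0")
          case True
          then have "t < t + h" by simp
          from MVT2[OF this, of "\<lambda>s. w s x" "\<lambda>s. w' s x", OF d]
          obtain s where "t < s" "s < t + h" "w (t + h) x - w t x = (t + h - t) * w' s x" by blast
          then show ?thesis using that[of s] by auto
        next
          case False
          then have "t + h < t" using elim by simp
          from MVT2[OF this, of "\<lambda>s. w s x" "\<lambda>s. w' s x", OF d]
          obtain s where "t + h < s" "s < t" "w t x - w (t + h) x = (t - (t + h)) * w' s x" by blast
          then show ?thesis using that[of s] by auto
        qed
        then have "?q x = w' s x - w' t x" using elim by simp
        then show ?thesis using near[of s x] s(1) x elim by simp
      qed
      have q0: "?q x = 0" if "R + 1 < \<bar>x\<bar>" for x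
        using that elim supp[of h x] z[of x] by simp
      have "(LINT x|lborel. (?q x)\<^sup>2) \<le> 2 * (R + 1) * b\<^sup>2"
      proof (rule L2_bounded_support(2))
        show "AE x in lborel. \<bar>?q x\<bar> \<le> b"
        proof (rule AE_I2)
          show "\<bar>?q x\<bar> \<le> b" for x using q[of x] q0[of x] b(1) by (cases "\<bar>x\<bar> \<le> R + 1") auto
        qed
        show "AE x in lborel. R + 1 < \<bar>x\<bar> \<longrightarrow> ?q x = 0" by (intro AE_I2 impI q0)
      qed (use R in simp_all)
      also have "\<dots> = e / 2"
      proof -
        have "b\<^sup>2 * (4 * (R + 1)) = e" using b(2) R by simp
        then show ?thesis by (simp add: algebra_simps)
      qed
      also have "\<dots> < e" using e by simp
      finally show ?case by (simp add: dist_real_def)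
    qed
  qed
qed

section \<open>Energy\<close>

lemma hk_integral_shift_support:
  fixes g :: "real \<Rightarrow> real"
  assumes g: "continuous_on UNIV g" and z: "\<And>x. r \<le> \<bar>x\<bar> \<Longrightarrow> g x = 0"
    and r: "0 \<le> r" and ab: "a \<le> t - r" "t + r \<le> b"
  shows "integral {a..b} (\<lambda>x. g (x - t)) = integral {-r..r} g"
proof -
  have l: "locally_integrable g" using g by (rule locally_integrable_continuous)
  have ls: "locally_integrable (\<lambda>x. g (x - t))" using l by (rule locally_integrable_shift)
  have "integral {a..b} (\<lambda>x. g (x - t)) = prim (\<lambda>x. g (x - t)) b - prim (\<lambda>x. g (x - t)) a"
    using ab r by (intro hk_integral_eq_prim ls) simp
  also have "\<dots> = prim g (b - t) - prim g (a - t)"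
    using prim_shift[OF l, of "-t"] by simp
  also have "prim g (b - t) = prim g r"
    by (rule prim_eq_if_zero_between[OF l]) (rule z, use ab r in auto)
  also have "prim g (a - t) = prim g (-r)"
    by (rule prim_eq_if_zero_between[OF l]) (rule z, use ab r in auto)
  also have "prim g r - prim g (-r) = integral {-r..r} g"
    using r by (simp add: hk_integral_eq_prim[OF l])
  finally show ?thesis .
qed

text \<open>On the support of \<open>K\<close> the solution is \<open>v = c - duhamel F / 2\<close> from time \<open>T\<close> on.  There,
  \<open>left_char F t (x + t)\<close> is \<open>- (v\<^sub>t + v\<^sub>x)\<close> and \<open>right_char F t (x - t)\<close> is \<open>- (v\<^sub>t - v\<^sub>x)\<close>.  The
  integrals of their squares over all labels \<open>z\<close>, together with \<open>\<integral> K v\<^sup>4\<close>, add up to four times an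
  energy that keeps track of the waves that have left the support of \<open>K\<close>; it is conserved.  As all
  terms are nonnegative, each is bounded.  Labelling by \<open>z\<close> fixes the domain of integration, so that
  no flux through a boundary occurs, and \<open>left_char\<close> and \<open>right_char\<close> need to be differentiated in
  time only.\<close>

lemma energy_bound:
  fixes K :: "real \<Rightarrow> real" and v F :: "real \<Rightarrow> real \<Rightarrow> real"
  assumes K: "continuous_on UNIV K" "\<And>x. 0 \<le> K x" "\<And>x. 1 \<le> \<bar>x\<bar> \<Longrightarrow> K x = 0"
    and F: "localized_source F" and Fv: "\<And>s y. F s y = K y * v s y ^ 3"
    and T: "0 \<le> T"
    and rep: "\<And>t x. T \<le> t \<Longrightarrow> \<bar>x\<bar> \<le> 1 \<Longrightarrow> v t x = c - duhamel F t x / 2"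
  shows "\<exists>C. \<forall>t\<ge>T. \<forall>M\<ge>t + 1. integral {-M..M} (\<lambda>z. (left_char F t z)\<^sup>2) \<le> C \<and>
    integral {-M..M} (\<lambda>z. (right_char F t z)\<^sup>2) \<le> C"
proof -
  let ?P = "left_char F" and ?N = "right_char F"
  define V where "V t x = c - duhamel F t x / 2" for t x
  define V' where "V' t x = - (?P t (x + t) + ?N t (x - t)) / 2" for t x
  \<comment> \<open>From time \<open>T\<close> on, \<open>V\<close> agrees with \<open>v\<close> where \<open>K\<close> does not vanish; it is differentiable in time
    everywhere.\<close>
  have FV: "F t x = K x * V t x ^ 3" if "T \<le> t" for t x
  proof (cases "\<bar>x\<bar> \<le> 1")
    case True
    then show ?thesis using rep[OF that] by (simp add: Fv V_def)
  next
    case False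
    then show ?thesis using localized_source_zero[OF F, of x t] K(3)[of x] by simp
  qed
  have dV: "((\<lambda>t. V t x) has_real_derivative V' t x) (at t)" for t x
    unfolding V_def V'_def
    using DERIV_diff[OF DERIV_const[of c] DERIV_cdivide[OF duhamel_derivative_time[OF F, of x t], of 2]]
    by (simp add: minus_divide_left)
  have cV: "continuous_on A (\<lambda>z. V (f z) (g z))" if "continuous_on A f" "continuous_on A g"
    for A and f g :: "real \<times> real \<Rightarrow> real"
    unfolding V_def by (intro continuous_intros continuous_on_uncurry_compose[OF duhamel_continuous[OF F]] that) simp
  define Pot where "Pot t = integral {-1..1} (\<lambda>x. K x * V t x ^ 4)" for t
  define Q where "Q M t = integral {-M..M} (\<lambda>z. (?P t z)\<^sup>2) + integral {-M..M} (\<lambda>z. (?N t z)\<^sup>2)" for M t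
  have cont_sq: "(\<lambda>z. (?P t z)\<^sup>2) integrable_on {a..b}" "(\<lambda>z. (?N t z)\<^sup>2) integrable_on {a..b}" for t a b
    by (intro integrable_continuous_interval continuous_intros left_char_continuous right_char_continuous F)+
  have dPot: "(Pot has_real_derivative integral {-1..1} (\<lambda>x. 4 * (K x * V t x ^ 3) * V' t x)) (at t)" for t
    unfolding Pot_def
  proof (rule integral_param_derivative)
    show "((\<lambda>t. K x * V t x ^ 4) has_real_derivative 4 * (K x * V t x ^ 3) * V' t x) (at t)" for t x
      by (rule derivative_eq_intros dV refl | simp)+
    show "continuous_on UNIV (\<lambda>(t, x). K x * V t x ^ 4)"
      unfolding split_beta by (intro continuous_intros cV continuous_on_compose2[OF K(1)]) auto
    show "continuous_on UNIV (\<lambda>(t, x). 4 * (K x * V t x ^ 3) * V' t x)"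
      unfolding split_beta V'_def
      by (intro continuous_intros cV continuous_on_compose2[OF K(1)] left_char_continuous right_char_continuous F) auto
  qed
  have dQ: "(Q M has_real_derivative integral {-M..M} (\<lambda>z. 2 * (?P t z * F t (z - t)))
      + integral {-M..M} (\<lambda>z. 2 * (?N t z * F t (z + t)))) (at t)" for M t
    unfolding Q_def
  proof (rule DERIV_add; rule integral_param_derivative)
    show "((\<lambda>t. (?P t z)\<^sup>2) has_real_derivative 2 * (?P t z * F t (z - t))) (at t)" for t z
      by (rule derivative_eq_intros left_char_derivative[OF F] refl | simp)+
    show "((\<lambda>t. (?N t z)\<^sup>2) has_real_derivative 2 * (?N t z * F t (z + t))) (at t)" for t z
      by (rule derivative_eq_intros right_char_derivative[OF F] refl | simp)+
    show "continuous_on UNIV (\<lambda>(t, z). (?P t z)\<^sup>2)" "continuous_on UNIV (\<lambda>(t, z). (?N t z)\<^sup>2)"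
      "continuous_on UNIV (\<lambda>(t, z). 2 * (?P t z * F t (z - t)))"
      "continuous_on UNIV (\<lambda>(t, z). 2 * (?N t z * F t (z + t)))"
      unfolding split_beta
      by (intro continuous_intros left_char_continuous right_char_continuous localized_source_continuous[OF F] F)+
  qed
  have zero: "((\<lambda>t. Q M t + Pot t) has_real_derivative 0) (at t)" if t: "T \<le> t" "t + 1 \<le> M" for M t
  proof -
    have iP: "integral {-M..M} (\<lambda>z. 2 * (?P t z * F t (z - t))) = integral {-1..1} (\<lambda>x. 2 * (?P t (x + t) * F t x))"
    proof -
      have "continuous_on UNIV (\<lambda>x. 2 * (?P t (x + t) * F t x))"
        by (intro continuous_intros left_char_continuous localized_source_continuous[OF F] F)
      from hk_integral_shift_support[OF this, of 1 "-M" t M] show ?thesis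
        using t T by (simp add: localized_source_zero[OF F])
    qed
    have iN: "integral {-M..M} (\<lambda>z. 2 * (?N t z * F t (z + t))) = integral {-1..1} (\<lambda>x. 2 * (?N t (x - t) * F t x))"
    proof -
      have "continuous_on UNIV (\<lambda>x. 2 * (?N t (x - t) * F t x))"
        by (intro continuous_intros right_char_continuous localized_source_continuous[OF F] F)
      from hk_integral_shift_support[OF this, of 1 "-M" "-t" M] show ?thesis
        using t T by (simp add: localized_source_zero[OF F])
    qed
    have i1: "(\<lambda>x. 2 * (?P t (x + t) * F t x)) integrable_on {-1..1}"
      "(\<lambda>x. 2 * (?N t (x - t) * F t x)) integrable_on {-1..1}"
      "(\<lambda>x. 4 * (K x * V t x ^ 3) * V' t x) integrable_on {-1..1}"
      unfolding FV[OF t(1), symmetric] V'_def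
      by (intro integrable_continuous_interval continuous_intros left_char_continuous right_char_continuous
          localized_source_continuous[OF F] F; simp)+
    have "integral {-1..1} (\<lambda>x. 2 * (?P t (x + t) * F t x)) + integral {-1..1} (\<lambda>x. 2 * (?N t (x - t) * F t x))
        + integral {-1..1} (\<lambda>x. 4 * (K x * V t x ^ 3) * V' t x)
      = integral {-1..1} (\<lambda>x. (2 * (?P t (x + t) * F t x) + 2 * (?N t (x - t) * F t x)) + 4 * (K x * V t x ^ 3) * V' t x)"
      using i1 by (simp only: integral_add integrable_add)
    also have "(\<lambda>x. (2 * (?P t (x + t) * F t x) + 2 * (?N t (x - t) * F t x)) + 4 * (K x * V t x ^ 3) * V' t x) = (\<lambda>_. 0)"
      unfolding FV[OF t(1), symmetric] V'_def by (simp add: fun_eq_iff field_simps)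
    finally have "integral {-M..M} (\<lambda>z. 2 * (?P t z * F t (z - t))) + integral {-M..M} (\<lambda>z. 2 * (?N t z * F t (z + t)))
        + integral {-1..1} (\<lambda>x. 4 * (K x * V t x ^ 3) * V' t x) = 0"
      by (simp only: iP iN) simp
    then show ?thesis using DERIV_add[OF dQ[of M t] dPot[of t]] by (simp only:)
  qed
  have cons: "Q M t + Pot t = Q M T + Pot T" if t: "T \<le> t" "t + 1 \<le> M" for M t
  proof (cases "T = t")
    case False
    then have "T < t" using t by simp
    then show ?thesis
    proof (rule DERIV_isconst_end)
      have "isCont (\<lambda>t. Q M t + Pot t) s" for s by (rule DERIV_isCont[OF DERIV_add[OF dQ dPot]])
      then show "continuous_on {T..t} (\<lambda>t. Q M t + Pot t)" by (simp add: continuous_at_imp_continuous_on)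
      show "((\<lambda>t. Q M t + Pot t) has_real_derivative 0) (at s)" if "T < s" "s < t" for s
        using that t by (intro zero) auto
    qed
  qed simp
  \<comment> \<open>At time \<open>T\<close> only a bounded set of labels has been reached, so the bound does not depend on \<open>M\<close>.\<close>
  have start: "Q M T = Q (1 + T) T" if "T + 1 \<le> M" for M
  proof -
    have "integral {-M..M} (\<lambda>z. (?P T z)\<^sup>2) = integral {-(1 + T)..1 + T} (\<lambda>z. (?P T z)\<^sup>2)"
    proof -
      have "continuous_on UNIV (\<lambda>z. (?P T z)\<^sup>2)" by (intro continuous_intros left_char_continuous F)
      from hk_integral_shift_support[OF this, of "1 + T" "-M" 0 M] show ?thesis
        using that T by (simp add: left_char_zero[OF F])
    qed
    moreover have "integral {-M..M} (\<lambda>z. (?N T z)\<^sup>2) = integral {-(1 + T)..1 + T} (\<lambda>z. (?N T z)\<^sup>2)"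
    proof -
      have "continuous_on UNIV (\<lambda>z. (?N T z)\<^sup>2)" by (intro continuous_intros right_char_continuous F)
      from hk_integral_shift_support[OF this, of "1 + T" "-M" 0 M] show ?thesis
        using that T by (simp add: right_char_zero[OF F])
    qed
    ultimately show ?thesis by (simp add: Q_def)
  qed
  have Pot0: "0 \<le> Pot t" for t
  proof -
    have "continuous_on {-1..1} (\<lambda>x. K x * V t x ^ 4)"
    proof -
      have "continuous_on UNIV (\<lambda>x. duhamel F t x)"
        by (intro continuous_on_uncurry_compose[OF duhamel_continuous[OF F]] continuous_intros)
      then have "continuous_on {-1..1} (duhamel F t)" by (rule continuous_on_subset) simp
      then show ?thesis
        unfolding V_def by (intro continuous_intros continuous_on_subset[OF K(1)]) auto
    qed
    then show ?thesis
      unfolding Pot_def by (intro integral_nonneg integrable_continuous_interval) (simp_all add: K(2))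
  qed
  have nn: "0 \<le> integral {a..b} (\<lambda>z. (?P t z)\<^sup>2)" "0 \<le> integral {a..b} (\<lambda>z. (?N t z)\<^sup>2)" for a b t
    by (intro integral_nonneg cont_sq; simp)+
  have "integral {-M..M} (\<lambda>z. (?P t z)\<^sup>2) \<le> Q (1 + T) T + Pot T \<and>
      integral {-M..M} (\<lambda>z. (?N t z)\<^sup>2) \<le> Q (1 + T) T + Pot T" if "T \<le> t" "t + 1 \<le> M" for t M
    using cons[OF that] start[of M] that Pot0[of t] nn(1)[of "-M" M t] nn(2)[of "-M" M t]
    by (simp add: Q_def)
  then show ?thesis by blast
qed

section \<open>Convergence in the weighted space\<close>

lemma jap_ge: "1 \<le> jap x" "\<bar>x\<bar> \<le> jap x"
proof -
  show "1 \<le> jap x" by (simp add: jap_def)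
  have "\<bar>x\<bar> = sqrt (x\<^sup>2)" by simp
  also have "\<dots> \<le> jap x" unfolding jap_def by (intro real_sqrt_le_mono) simp
  finally show "\<bar>x\<bar> \<le> jap x" .
qed

lemma jap_pos [simp]: "0 < jap x"
  using jap_ge(1)[of x] by linarith

lemma jap_measurable [measurable]: "jap \<in> borel_measurable borel"
  unfolding jap_def[abs_def] by measurable

lemma integrable_if_integral_Icc_bounded:
  fixes f :: "real \<Rightarrow> real"
  assumes f: "locally_integrable f" and nn: "\<And>x. 0 \<le> f x"
    and b: "\<And>n::nat. n0 \<le> n \<Longrightarrow> integral {- real n..real n} f \<le> C"
  shows "integrable lborel f" "(LINT x|lborel. f x) \<le> C"
proof -
  let ?f = "\<lambda>n x. indicator {- real n..real n} x *\<^sub>R f x"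
  have i: "integrable lborel (?f n)" for n
    using locally_integrable_interval[OF f] by (simp add: set_integrable_def)
  have [measurable]: "f \<in> borel_measurable borel" using f by auto
  have mono: "mono (\<lambda>n. ?f n x)" for x
    by (intro monoI) (auto simp: indicator_def nn)
  have lim: "(\<lambda>n. ?f n x) \<longlonglongrightarrow> f x" for x
  proof -
    obtain m where m: "real m \<ge> \<bar>x\<bar>" using real_arch_simple by blast
    have "eventually (\<lambda>n. ?f n x = f x) sequentially"
      using eventually_ge_at_top[of m]
      by eventually_elim (use m in \<open>auto simp: indicator_def abs_le_iff\<close>)
    then show ?thesis by (rule tendsto_eventually)
  qed
  have eq: "(LINT x|lborel. ?f n x) = integral {- real n..real n} f" for n
    using set_borel_integral_eq_integral(2)[OF locally_integrable_interval[OF f, of "- real n" "real n"]]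
    by (simp add: set_lebesgue_integral_def)
  have inc: "incseq (\<lambda>n. LINT x|lborel. ?f n x)"
    using mono by (intro incseq_SucI integral_mono i) (auto simp: mono_iff_le_Suc)
  have le: "(LINT x|lborel. ?f n x) \<le> C" for n
  proof -
    have "(LINT x|lborel. ?f n x) \<le> (LINT x|lborel. ?f (max n n0) x)"
      using inc by (rule incseqD) simp
    also have "\<dots> \<le> C" unfolding eq by (rule b) simp
    finally show ?thesis .
  qed
  obtain L where L: "(\<lambda>n. LINT x|lborel. ?f n x) \<longlonglongrightarrow> L" using incseq_convergent[OF inc] le by metis
  have meas: "f \<in> borel_measurable lborel" by simp
  note mc = integrable_monotone_convergence[OF i AE_I2[OF mono] AE_I2[OF lim] L meas]
    integral_monotone_convergence[OF i AE_I2[OF mono] AE_I2[OF lim] L meas]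
  show "integrable lborel f" by (rule mc(1))
  have "(LINT x|lborel. f x) = L" by (rule mc(2))
  also have "L \<le> C" using LIMSEQ_le_const2[OF L] le by blast
  finally show "(LINT x|lborel. f x) \<le> C" .
qed

text \<open>The transported quantity is stationary at \<open>z\<close> from time \<open>\<bar>z\<bar> + 1\<close> on, so at time \<open>t\<close> it
  differs from its limit only where the weight is at most \<open>1 / (t - 1)\<close>; there, boundedness in the
  unweighted norm suffices.\<close>

lemma weighted_convergence_if_stationary:
  fixes p :: "real \<Rightarrow> real \<Rightarrow> real"
  assumes c: "continuous_on UNIV (\<lambda>(t, z). p t z)"
    and stat: "\<And>z t t'. \<bar>z\<bar> + 1 \<le> t \<Longrightarrow> \<bar>z\<bar> + 1 \<le> t' \<Longrightarrow> p t z = p t' z"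
    and bound: "\<And>t M. T \<le> t \<Longrightarrow> t + 1 \<le> M \<Longrightarrow> integral {-M..M} (\<lambda>z. (p t z)\<^sup>2) \<le> C"
  shows "(\<lambda>z. p (\<bar>z\<bar> + 1) z) \<in> L2"
    and "((\<lambda>t. LINT z|lborel. (p t z - p (\<bar>z\<bar> + 1) z)\<^sup>2 / jap z) \<longlongrightarrow> 0) at_top"
proof -
  let ?q = "\<lambda>z. p (\<bar>z\<bar> + 1) z"
  have cp: "continuous_on UNIV (p t)" for t by (intro continuous_on_uncurry_compose[OF c] continuous_intros)
  have cq: "continuous_on UNIV ?q" by (intro continuous_on_uncurry_compose[OF c] continuous_intros)
  have [measurable]: "p t \<in> borel_measurable borel" "?q \<in> borel_measurable borel" for t
    using cp cq by (auto intro: borel_measurable_continuous_onI)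
  have lq: "locally_integrable (\<lambda>z. (?q z)\<^sup>2)" by (intro locally_integrable_continuous continuous_on_power cq)
  have lp: "locally_integrable (\<lambda>z. (p t z)\<^sup>2)" for t by (intro locally_integrable_continuous continuous_on_power cp)
  have P: "integrable lborel (\<lambda>z. (p t z)\<^sup>2)" "(LINT z|lborel. (p t z)\<^sup>2) \<le> C" if t: "T \<le> t" for t
  proof -
    have b: "integral {- real n..real n} (\<lambda>z. (p t z)\<^sup>2) \<le> C" if "nat \<lceil>t + 1\<rceil> \<le> n" for n
      using that by (intro bound t) linarith
    note * = integrable_if_integral_Icc_bounded[OF lp _ b]
    show "integrable lborel (\<lambda>z. (p t z)\<^sup>2)" by (rule *(1)) simp_all
    show "(LINT z|lborel. (p t z)\<^sup>2) \<le> C" by (rule *(2)) simp_all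
  qed
  have b: "integral {- real n..real n} (\<lambda>z. (?q z)\<^sup>2) \<le> C" if n: "nat \<lceil>T\<rceil> \<le> n" for n
  proof -
    have "integral {- real n..real n} (\<lambda>z. (?q z)\<^sup>2) = integral {- real n..real n} (\<lambda>z. (p (real n + 1) z)\<^sup>2)"
    proof (rule Henstock_Kurzweil_Integration.integral_cong)
      fix z assume "z \<in> {- real n..real n}"
      then have "?q z = p (real n + 1) z" by (intro stat) auto
      then show "(?q z)\<^sup>2 = (p (real n + 1) z)\<^sup>2" by simp
    qed
    also have "\<dots> \<le> integral {- (real n + 2)..real n + 2} (\<lambda>z. (p (real n + 1) z)\<^sup>2)"
      by (intro integral_subset_le integrable_continuous_interval continuous_on_power continuous_on_subset[OF cp]) auto
    also have "\<dots> \<le> C" using n by (intro bound) linarith+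
    finally show ?thesis .
  qed
  have Q: "integrable lborel (\<lambda>z. (?q z)\<^sup>2)" "(LINT z|lborel. (?q z)\<^sup>2) \<le> C"
  proof -
    note * = integrable_if_integral_Icc_bounded[OF lq _ b]
    show "integrable lborel (\<lambda>z. (?q z)\<^sup>2)" by (rule *(1)[where ?n0.0 = "nat \<lceil>T\<rceil>"]) simp_all
    show "(LINT z|lborel. (?q z)\<^sup>2) \<le> C" by (rule *(2)[where ?n0.0 = "nat \<lceil>T\<rceil>"]) simp_all
  qed
  show qL2: "?q \<in> L2" using Q(1) by (simp add: L2_def)
  let ?d = "\<lambda>t z. (p t z - ?q z)\<^sup>2 / jap z"
  have le: "(LINT z|lborel. ?d t z) \<le> 4 * C / (t - 1)" if t: "T \<le> t" "1 < t" for t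
  proof -
    let ?b = "\<lambda>z. (2 * (p t z)\<^sup>2 + 2 * (?q z)\<^sup>2) / (t - 1)"
    have pw: "?d t z \<le> ?b z" for z
    proof (cases "\<bar>z\<bar> + 1 \<le> t")
      case True
      then have "p t z = ?q z" by (intro stat) auto
      then show ?thesis using t by simp
    next
      case False
      then have j: "t - 1 \<le> jap z" using jap_ge(2)[of z] by linarith
      have "(p t z - ?q z)\<^sup>2 \<le> 2 * (p t z)\<^sup>2 + 2 * (?q z)\<^sup>2"
        using square_lincomb_le[of 1 "p t z" "-1" "?q z"] by simp
      then show ?thesis using j t by (intro frac_le) auto
    qed
    have ib: "integrable lborel ?b" using P(1)[OF t(1)] Q(1) by simp
    have "(LINT z|lborel. ?d t z) \<le> (LINT z|lborel. ?b z)"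
    proof (rule integral_mono)
      show "integrable lborel (?d t)"
        by (rule Bochner_Integration.integrable_bound[OF ib])
          (use pw t in \<open>auto simp: abs_of_pos less_imp_le\<close>)
    qed (use ib pw in auto)
    also have "\<dots> = (2 * (LINT z|lborel. (p t z)\<^sup>2) + 2 * (LINT z|lborel. (?q z)\<^sup>2)) / (t - 1)"
      using P(1)[OF t(1)] Q(1) by simp
    also have "\<dots> \<le> 4 * C / (t - 1)"
      using P(2)[OF t(1)] Q(2) t by (intro divide_right_mono) auto
    finally show ?thesis .
  qed
  show "((\<lambda>t. LINT z|lborel. ?d t z) \<longlongrightarrow> 0) at_top"
  proof (rule tendsto_sandwich[OF _ _ tendsto_const])
    show "\<forall>\<^sub>F t in at_top. 0 \<le> (LINT z|lborel. ?d t z)"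
      by (intro always_eventually allI integral_nonneg_AE AE_I2) (simp add: less_imp_le)
    show "\<forall>\<^sub>F t in at_top. (LINT z|lborel. ?d t z) \<le> 4 * C / (t - 1)"
      using eventually_ge_at_top[of T] eventually_gt_at_top[of 1] by eventually_elim (rule le)
    have "filterlim (\<lambda>t::real. -1 + t) at_top at_top"
      by (rule filterlim_tendsto_add_at_top[OF tendsto_const filterlim_ident])
    then have "filterlim (\<lambda>t::real. t - 1) at_top at_top" by simp
    then show "((\<lambda>t. 4 * C / (t - 1)) \<longlongrightarrow> 0) at_top"
      by (intro tendsto_divide_0[OF tendsto_const] filterlim_at_top_imp_at_infinity)
  qed
qed

section \<open>The free wave in null form\<close>

lemma linear_wave_eq_prim:
  assumes "locally_integrable g"
  shows "linear_wave f g t x = (f (x + t) + f (x - t)) / 2 + (prim g (x + t) - prim g (x - t)) / 2"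
  by (simp add: linear_wave_def LBINT_eq_prim[OF assms])

lemma linear_wave_measurable:
  assumes [measurable]: "f \<in> borel_measurable borel" and g: "locally_integrable g"
  shows "linear_wave f g t \<in> borel_measurable borel"
proof -
  have [measurable]: "prim g \<in> borel_measurable borel"
    using prim_continuous[OF g] by (rule borel_measurable_continuous_onI)
  have "linear_wave f g t = (\<lambda>x. (f (x + t) + f (x - t)) / 2 + (prim g (x + t) - prim g (x - t)) / 2)"
    using linear_wave_eq_prim[OF g] by auto
  then show ?thesis by simp
qed

lemma linear_wave_null_form:
  assumes a: "locally_integrable a" and g: "locally_integrable g"
    and f: "AE x in lborel. f x = c + prim a x"
  shows "AE x in lborel. linear_wave f g t x =
    c + prim (\<lambda>x. a x + g x) (x + t) / 2 - prim (\<lambda>x. g x - a x) (x - t) / 2"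
  using AE_shift(1)[OF f, of t] AE_shift(2)[OF f, of t]
proof eventually_elim
  case (elim x)
  then show ?case
    by (simp only: linear_wave_eq_prim[OF g] prim_add[OF a g] prim_diff[OF g a]) (simp add: field_simps)
qed

text \<open>A curve that is differentiable in the mean square sense and is the sum of a free wave in null
  form and a Duhamel term has the expected derivative.\<close>

lemma L2_time_deriv_of_null_form:
  assumes F: "localized_source F" and A: "locally_integrable A" and B: "locally_integrable B"
    and w: "has_L2_time_deriv w v t"
    and rep: "\<And>s. AE x in lborel. w s x =
      c + prim A (x + s) / 2 - prim B (x - s) / 2 - duhamel F s x / 2"
  shows "AE x in lborel. v x =
    (A (x + t) + B (x - t)) / 2 - (left_char F t (x + t) + right_char F t (x - t)) / 2"
proof (rule has_L2_time_deriv_AE_eq[OF w])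
  let ?k = "\<lambda>x. (A (x + t) + B (x - t)) / 2 - (left_char F t (x + t) + right_char F t (x - t)) / 2"
  let ?C = "\<lambda>s x. left_char F s (x + s) + right_char F s (x - s)"
  have lAB: "locally_integrable (\<lambda>x. A (x + t) + B (x - t))"
    by (intro locally_integrable_add locally_integrable_shift A B)
  have cC: "continuous_on UNIV (?C s)" for s
    by (intro continuous_intros left_char_continuous right_char_continuous F)
  then have lC: "locally_integrable (?C s)" for s by (rule locally_integrable_continuous)
  show lk: "locally_integrable ?k"
    using locally_integrable_lincomb[OF lAB lC[of t], of "1/2" "-1/2"] by simp
  fix a b :: real assume ab: "a \<le> b"
  have cA: "continuous_on UNIV (prim A)" and cB: "continuous_on UNIV (prim B)"
    by (intro prim_continuous A B)+
  have lA: "locally_integrable (prim A)" and lB: "locally_integrable (prim B)"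
    using cA cB by (auto intro: locally_integrable_continuous)
  have cD: "continuous_on UNIV (duhamel F s)" for s
    by (intro continuous_on_uncurry_compose[OF duhamel_continuous[OF F]] continuous_intros)
  let ?r = "\<lambda>s x. c + prim A (x + s) / 2 - prim B (x - s) / 2 - duhamel F s x / 2"
  have cr: "continuous_on UNIV (?r s)" for s
    by (intro continuous_intros continuous_on_compose2[OF cA] continuous_on_compose2[OF cB] cD) auto
  have lr: "set_integrable lborel {a..b} (?r s)" for s
    by (intro locally_integrable_interval locally_integrable_continuous cr)
  define J where "J s = (LINT x:{a..b}|lborel. ?r s x)" for s
  have J: "J s = c * (b - a) + (prim (prim A) (b + s) - prim (prim A) (a + s)) / 2
      - (prim (prim B) (b - s) - prim (prim B) (a - s)) / 2 - integral {a..b} (duhamel F s) / 2" for s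
  proof -
    have "J s = integral {a..b} (?r s)"
      unfolding J_def using set_borel_integral_eq_integral(2)[OF lr] .
    also have "(?r s has_integral c * (b - a) + (prim (prim A) (b + s) - prim (prim A) (a + s)) / 2
      - (prim (prim B) (b - s) - prim (prim B) (a - s)) / 2 - integral {a..b} (duhamel F s) / 2) {a..b}"
    proof (intro has_integral_diff has_integral_add has_integral_divide)
      show "((\<lambda>x. c) has_integral c * (b - a)) {a..b}"
        using has_integral_const_real[of c a b] ab by (simp add: mult.commute)
      show "((\<lambda>x. prim A (x + s)) has_integral prim (prim A) (b + s) - prim (prim A) (a + s)) {a..b}"
      proof (rule fundamental_theorem_of_calculus[OF ab])
        fix x
        have "((\<lambda>x. prim (prim A) (x + s)) has_real_derivative prim A (x + s) * 1) (at x)"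
          by (rule DERIV_chain2[OF prim_has_real_derivative[OF cA]]) (auto intro!: derivative_eq_intros)
        then show "((\<lambda>x. prim (prim A) (x + s)) has_vector_derivative prim A (x + s)) (at x within {a..b})"
          by (simp add: has_real_derivative_iff_has_vector_derivative has_vector_derivative_at_within)
      qed
      show "((\<lambda>x. prim B (x - s)) has_integral prim (prim B) (b - s) - prim (prim B) (a - s)) {a..b}"
      proof (rule fundamental_theorem_of_calculus[OF ab])
        fix x
        have "((\<lambda>x. prim (prim B) (x - s)) has_real_derivative prim B (x - s) * 1) (at x)"
          by (rule DERIV_chain2[OF prim_has_real_derivative[OF cB]]) (auto intro!: derivative_eq_intros)
        then show "((\<lambda>x. prim (prim B) (x - s)) has_vector_derivative prim B (x - s)) (at x within {a..b})"
          by (simp add: has_real_derivative_iff_has_vector_derivative has_vector_derivative_at_within)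
      qed
      show "(duhamel F s has_integral integral {a..b} (duhamel F s)) {a..b}"
        by (intro integrable_integral integrable_continuous_interval continuous_on_subset[OF cD]) auto
    qed
    then have "integral {a..b} (?r s) = c * (b - a) + (prim (prim A) (b + s) - prim (prim A) (a + s)) / 2
      - (prim (prim B) (b - s) - prim (prim B) (a - s)) / 2 - integral {a..b} (duhamel F s) / 2"
      by (rule integral_unique)
    finally show ?thesis .
  qed
  have dA: "((\<lambda>s. prim (prim A) (y + s)) has_real_derivative prim A (y + t) * 1) (at t)" for y
    by (rule DERIV_chain2[OF prim_has_real_derivative[OF cA]]) (auto intro!: derivative_eq_intros)
  have dB: "((\<lambda>s. prim (prim B) (y - s)) has_real_derivative prim B (y - t) * (-1)) (at t)" for y
    by (rule DERIV_chain2[OF prim_has_real_derivative[OF cB]]) (auto intro!: derivative_eq_intros)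
  have dD: "((\<lambda>s. integral {a..b} (duhamel F s)) has_real_derivative integral {a..b} (?C t)) (at t)"
  proof (rule integral_param_derivative)
    show "continuous_on UNIV (\<lambda>(s, x). ?C s x)"
      unfolding split_beta by (intro continuous_intros left_char_continuous right_char_continuous F)
  qed (intro duhamel_continuous duhamel_derivative_time F)+
  have "(J has_real_derivative (prim A (b + t) - prim A (a + t)) / 2 + (prim B (b - t) - prim B (a - t)) / 2
      - integral {a..b} (?C t) / 2) (at t)"
    unfolding J[abs_def]
    by (rule derivative_eq_intros dA dB dD refl | simp add: field_simps)+
  also have "(prim A (b + t) - prim A (a + t)) / 2 + (prim B (b - t) - prim B (a - t)) / 2
      - integral {a..b} (?C t) / 2 = (LINT x:{a..b}|lborel. ?k x)"
  proof -
    have i: "set_integrable lborel {a..b} (\<lambda>x. A (x + t))" "set_integrable lborel {a..b} (\<lambda>x. B (x - t))"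
      "set_integrable lborel {a..b} (?C t)"
      by (intro locally_integrable_interval locally_integrable_shift A B lC)+
    have "(LINT x:{a..b}|lborel. ?k x) = ((LINT x:{a..b}|lborel. A (x + t)) + (LINT x:{a..b}|lborel. B (x - t))) / 2
       - (LINT x:{a..b}|lborel. ?C t x) / 2"
      using i by simp
    also have "(LINT x:{a..b}|lborel. A (x + t)) = prim A (b + t) - prim A (a + t)"
      using integral_eq_prim[OF locally_integrable_shift(1)[OF A] ab] prim_shift[OF A] by simp
    also have "(LINT x:{a..b}|lborel. B (x - t)) = prim B (b - t) - prim B (a - t)"
      using integral_eq_prim[OF locally_integrable_shift(2)[OF B] ab] prim_shift[OF B, of "-t"] by simp
    also have "(LINT x:{a..b}|lborel. ?C t x) = integral {a..b} (?C t)"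
      using set_borel_integral_eq_integral(2)[OF i(3)] .
    finally show ?thesis by (simp add: field_simps)
  qed
  finally have "(J has_real_derivative (LINT x:{a..b}|lborel. ?k x)) (at t)" .
  then have lim: "((\<lambda>h. (J (t + h) - J t) / h) \<longlongrightarrow> (LINT x:{a..b}|lborel. ?k x)) (at 0)"
    by (simp add: DERIV_def)
  have eq: "(LINT x:{a..b}|lborel. w (t + h) x - w t x) = J (t + h) - J t" for h
  proof -
    have [measurable]: "(\<lambda>x. w (t + h) x - w t x) \<in> borel_measurable borel"
      using w by (auto simp: has_L2_time_deriv_def)
    have [measurable]: "?r s \<in> borel_measurable borel" for s using cr by (rule borel_measurable_continuous_onI)
    have "(LINT x:{a..b}|lborel. w (t + h) x - w t x) = (LINT x:{a..b}|lborel. ?r (t + h) x - ?r t x)"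
    proof (rule set_lebesgue_integral_cong_AE)
      show "AE x\<in>{a..b} in lborel. w (t + h) x - w t x = ?r (t + h) x - ?r t x"
        using rep[of "t + h"] rep[of t] by eventually_elim simp
      show "(\<lambda>x. ?r (t + h) x - ?r t x) \<in> borel_measurable lborel"
        using borel_measurable_diff[of "?r (t + h)" borel "?r t"] by simp
    qed simp_all
    also have "\<dots> = J (t + h) - J t" unfolding J_def by (rule set_integral_diff(2)[OF lr lr])
    finally show ?thesis .
  qed
  show "((\<lambda>h. (LINT x:{a..b}|lborel. w (t + h) x - w t x) / h) \<longlongrightarrow> (LINT x:{a..b}|lborel. ?k x)) (at 0)"
    unfolding eq by (rule lim)
qed

section \<open>The solution transported back by the linear group\<close>

lemma has_L2_time_deriv_moving_prim:
  assumes q: "continuous_on UNIV q" and R: "0 \<le> R" and z: "\<And>x. R \<le> \<bar>x\<bar> \<Longrightarrow> q x = 0"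
  shows "has_L2_time_deriv (\<lambda>s x. prim q (x + s)) q 0"
    and "has_L2_time_deriv (\<lambda>s x. prim q (x - s)) (\<lambda>x. - q x) 0"
proof -
  have lq: "locally_integrable q" using q by (rule locally_integrable_continuous)
  have cp: "continuous_on UNIV (prim q)" by (intro prim_continuous lq)
  have "has_L2_time_deriv (\<lambda>s x. prim q (x + s)) ((\<lambda>s x. q (x + s)) 0) 0"
  proof (rule has_L2_time_deriv_classical)
    show "((\<lambda>s. prim q (x + s)) has_real_derivative q (x + s)) (at s)" for s x
    proof -
      have "((\<lambda>s. x + s) has_real_derivative 1) (at s)" by (auto intro!: derivative_eq_intros)
      from DERIV_chain2[OF prim_has_real_derivative[OF q] this] show ?thesis by simp
    qed
    show "prim q (x + (0 + h)) = prim q (x + 0)" if "R + \<bar>h\<bar> < \<bar>x\<bar>" for h x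
      by (rule prim_eq_if_zero_between[OF lq], rule z) (use that in auto)
    show "continuous_on UNIV (\<lambda>(s, x). q (x + s))"
      unfolding split_beta by (intro continuous_on_compose2[OF q] continuous_intros) auto
    show "continuous_on UNIV (\<lambda>x. prim q (x + s))" for s
      by (intro continuous_on_compose2[OF cp] continuous_intros) auto
  qed (rule R)
  then show "has_L2_time_deriv (\<lambda>s x. prim q (x + s)) q 0" by simp
  have "has_L2_time_deriv (\<lambda>s x. prim q (x - s)) ((\<lambda>s x. - q (x - s)) 0) 0"
  proof (rule has_L2_time_deriv_classical)
    show "((\<lambda>s. prim q (x - s)) has_real_derivative - q (x - s)) (at s)" for s x
    proof -
      have "((\<lambda>s. x - s) has_real_derivative -1) (at s)" by (auto intro!: derivative_eq_intros)
      from DERIV_chain2[OF prim_has_real_derivative[OF q] this] show ?thesis by simp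
    qed
    show "prim q (x - (0 + h)) = prim q (x - 0)" if "R + \<bar>h\<bar> < \<bar>x\<bar>" for h x
      by (rule prim_eq_if_zero_between[OF lq], rule z) (use that in auto)
    show "continuous_on UNIV (\<lambda>(s, x). - q (x - s))"
      unfolding split_beta by (intro continuous_on_compose2[OF q] continuous_intros) auto
    show "continuous_on UNIV (\<lambda>x. prim q (x - s))" for s
      by (intro continuous_on_compose2[OF cp] continuous_intros) auto
  qed (rule R)
  then show "has_L2_time_deriv (\<lambda>s x. prim q (x - s)) (\<lambda>x. - q x) 0" by simp
qed

lemma has_L2_time_deriv_duhamel_0:
  assumes F: "localized_source F"
  shows "has_L2_time_deriv (duhamel F) (\<lambda>_. 0) 0"
proof -
  have "has_L2_time_deriv (duhamel F) ((\<lambda>s x. left_char F s (x + s) + right_char F s (x - s)) 0) 0"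
  proof (rule has_L2_time_deriv_classical[where R = 1])
    show "continuous_on UNIV (duhamel F s)" for s
      by (intro continuous_on_uncurry_compose[OF duhamel_continuous[OF F]] continuous_intros)
    show "continuous_on UNIV (\<lambda>(s, x). left_char F s (x + s) + right_char F s (x - s))"
      unfolding split_beta by (intro continuous_intros left_char_continuous right_char_continuous F)
    show "duhamel F (0 + h) x = duhamel F 0 x" if "1 + \<bar>h\<bar> < \<bar>x\<bar>" for h x
      using duhamel_zero[OF F, of h x] that by simp
  qed (simp_all add: duhamel_derivative_time[OF F])
  then show ?thesis by (simp add: left_char_def right_char_def)
qed

text \<open>Backwards evolution from time \<open>t\<close> undoes the linear evolution and leaves the integrals of the
  source along characteristics.  The difficulty is that the time derivative in the definition of the
  group must be shown to exist; it is reduced to the differentiability of the given solution at time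
  \<open>0\<close>, since the two curves differ by curves that are classically differentiable.\<close>

lemma wave_group_of_solution:
  fixes a u0 u1 :: "real \<Rightarrow> real" and t :: real
  assumes F: "localized_source F"
    and a: "locally_integrable a" and u1: "locally_integrable u1"
    and um: "\<And>s. u s \<in> borel_measurable borel"
    and du: "\<And>s. \<exists>v. has_L2_time_deriv u v s"
    and rep: "\<And>s. AE x in lborel. u s x = c + prim (\<lambda>x. a x + u1 x) (x + s) / 2
      - prim (\<lambda>x. u1 x - a x) (x - s) / 2 - duhamel F s x / 2"
  defines "W \<equiv> wave_group (- t) (u t, L2_time_deriv u t)"
  shows "has_weak_deriv (fst W) (\<lambda>x. a x - (left_char F t x - right_char F t x) / 2)"
    and "snd W \<in> L2"
    and "AE x in lborel. snd W x = u1 x - (left_char F t x + right_char F t x) / 2"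
proof -
  let ?A = "\<lambda>x. a x + u1 x" and ?B = "\<lambda>x. u1 x - a x"
  let ?P = "left_char F t" and ?N = "right_char F t"
  have A: "locally_integrable ?A" and B: "locally_integrable ?B"
    by (intro locally_integrable_add locally_integrable_diff a u1)+
  have P: "locally_integrable ?P" and N: "locally_integrable ?N"
    by (intro left_char_locally_integrable right_char_locally_integrable F)+
  have cP: "continuous_on UNIV ?P" and cN: "continuous_on UNIV ?N"
    by (intro left_char_continuous right_char_continuous F continuous_intros)+
  have [measurable]: "a \<in> borel_measurable borel" "u1 \<in> borel_measurable borel"
    "?P \<in> borel_measurable borel" "?N \<in> borel_measurable borel" "u s \<in> borel_measurable borel" for s
    using a u1 P N um by auto
  define g where "g = L2_time_deriv u t"
  have dg: "has_L2_time_deriv u g t" using du L2_time_deriv_AE_eq(1) unfolding g_def by blast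
  have gL2: "g \<in> L2" using dg by (simp add: has_L2_time_deriv_def)
  have lg: "locally_integrable g" using gL2 by (rule L2_locally_integrable)
  have g: "AE x in lborel. g x = (?A (x + t) + ?B (x - t)) / 2 - (?P (x + t) + ?N (x - t)) / 2"
    by (rule L2_time_deriv_of_null_form[OF F A B dg rep])
  define k1 where "k1 x = ?A x - ?P x" for x
  define k2 where "k2 x = ?B x - ?N x" for x
  have k1: "locally_integrable k1" and k2: "locally_integrable k2"
    unfolding k1_def k2_def by (intro locally_integrable_diff A B P N)+
  have [measurable]: "k1 \<in> borel_measurable borel" "k2 \<in> borel_measurable borel" "g \<in> borel_measurable borel"
    using k1 k2 lg by auto
  \<comment> \<open>The spatial derivative of \<open>u t\<close>.  The null combinations \<open>ux + g\<close> and \<open>g - ux\<close> are translates of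
    \<open>k1\<close> and \<open>k2\<close>, and the free evolution by \<open>- t\<close> removes the translations.\<close>
  define ux where "ux x = (1/2) * k1 (x + t) + (-1/2) * k2 (x - t)" for x
  have ux: "locally_integrable ux"
    unfolding ux_def by (intro locally_integrable_lincomb locally_integrable_shift k1 k2)
  have [measurable]: "ux \<in> borel_measurable borel" using ux by auto
  have duh: "duhamel F t x = duhamel F t 0 + (prim ?P (x + t) - prim ?P t) - (prim ?N (x - t) - prim ?N (- t))" for x
  proof -
    have "prim (\<lambda>x. ?P (x + t) - ?N (x - t)) x = duhamel F t x - duhamel F t 0"
      by (rule prim_of_derivative[OF duhamel_derivative_space[OF F]])
        (intro continuous_intros left_char_continuous right_char_continuous F)
    moreover have "prim (\<lambda>x. ?P (x + t) - ?N (x - t)) x = prim (\<lambda>x. ?P (x + t)) x - prim (\<lambda>x. ?N (x - t)) x"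
      by (intro prim_diff locally_integrable_shift P N)
    ultimately show ?thesis using prim_shift[OF P, of t x] prim_shift[OF N, of "-t" x] by simp
  qed
  have pk1: "prim k1 y = prim ?A y - prim ?P y" and pk2: "prim k2 y = prim ?B y - prim ?N y" for y
    unfolding k1_def k2_def by (intro prim_diff A B P N)+
  have pux: "prim ux x = (prim k1 (x + t) - prim k1 t) / 2 - (prim k2 (x - t) - prim k2 (- t)) / 2" for x
  proof -
    have "prim ux x = 1/2 * prim (\<lambda>x. k1 (x + t)) x + (-1/2) * prim (\<lambda>x. k2 (x - t)) x"
      unfolding ux_def by (intro prim_lincomb locally_integrable_shift k1 k2)
    then show ?thesis using prim_shift[OF k1, of t x] prim_shift[OF k2, of "-t" x] by simp
  qed
  define c' where "c' = c + prim ?A t / 2 - prim ?B (- t) / 2 - duhamel F t 0 / 2"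
  have ut: "AE x in lborel. u t x = c' + prim ux x"
    using rep[of t]
  proof eventually_elim
    case (elim x)
    show ?case unfolding elim duh[of x] pux pk1 pk2 c'_def by (simp add: field_simps)
  qed
  have sum: "prim (\<lambda>x. ux x + g x) y = prim k1 (y + t) - prim k1 t" for y
  proof -
    have "AE x in lborel. ux x + g x = k1 (x + t)"
      using g by eventually_elim (simp add: ux_def k1_def k2_def field_simps)
    then have "prim (\<lambda>x. ux x + g x) y = prim (\<lambda>x. k1 (x + t)) y" by (intro prim_cong_AE) simp_all
    then show ?thesis by (simp add: prim_shift[OF k1])
  qed
  have diff: "prim (\<lambda>x. g x - ux x) y = prim k2 (y - t) - prim k2 (- t)" for y
  proof -
    have "AE x in lborel. g x - ux x = k2 (x - t)"
      using g by eventually_elim (simp add: ux_def k1_def k2_def field_simps)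
    then have "prim (\<lambda>x. g x - ux x) y = prim (\<lambda>x. k2 (x - t)) y" by (intro prim_cong_AE) simp_all
    then show ?thesis using prim_shift[OF k2, of "-t" y] by simp
  qed
  define c'' where "c'' = c' - prim k1 t / 2 + prim k2 (- t) / 2"
  let ?w = "linear_wave (u t) g"
  have W: "W = (?w (- t), L2_time_deriv ?w (- t))" by (simp add: W_def wave_group_def g_def)
  have wm: "?w s \<in> borel_measurable borel" for s by (rule linear_wave_measurable[OF um lg])
  have w: "AE x in lborel. ?w s x = c'' + prim k1 (x + (s + t)) / 2 - prim k2 (x - (s + t)) / 2" for s
    using linear_wave_null_form[OF ux lg ut, of s]
  proof eventually_elim
    case (elim x)
    show ?case unfolding elim sum diff c''_def by (simp add: algebra_simps diff_divide_distrib)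
  qed
  show "has_weak_deriv (fst W) (\<lambda>x. a x - (?P x - ?N x) / 2)"
  proof -
    have eq: "(\<lambda>x. a x - (?P x - ?N x) / 2) = (\<lambda>x. (1/2) * k1 x + (-1/2) * k2 x)"
      by (simp add: fun_eq_iff k1_def k2_def field_simps)
    have "AE x in lborel. fst W x = c'' + prim (\<lambda>x. (1/2) * k1 x + (-1/2) * k2 x) x"
      unfolding prim_lincomb[OF k1 k2] using w[of "-t"] by eventually_elim (simp add: W)
    then show ?thesis
      unfolding eq using wm[of "-t"]
      by (intro has_weak_deriv_if_AE_prim[where c = c''] locally_integrable_lincomb k1 k2) (simp_all add: W)
  qed
  \<comment> \<open>Near time \<open>- t\<close>, the increments of the transported wave are those of \<open>u\<close> near \<open>0\<close>, up to the
    Duhamel term and the primitives of the continuous functions \<open>left_char F t\<close> and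
    \<open>right_char F t\<close>.\<close>
  obtain v0 where v0: "has_L2_time_deriv u v0 0" using du by blast
  have v0_eq: "AE x in lborel. v0 x = u1 x"
    using L2_time_deriv_of_null_form[OF F A B v0 rep]
    by eventually_elim (simp add: left_char_def right_char_def)
  have D1: "has_L2_time_deriv (\<lambda>h x. u h x + duhamel F h x / 2) u1 0"
  proof (rule has_L2_time_deriv_lincomb[OF v0 has_L2_time_deriv_duhamel_0[OF F], of _ 1 "1/2"])
    show "AE x in lborel. u1 x = 1 * v0 x + 1 / 2 * 0" using v0_eq by eventually_elim simp
    have "continuous_on UNIV (duhamel F s)" for s
      by (intro continuous_on_uncurry_compose[OF duhamel_continuous[OF F]] continuous_intros)
    then have [measurable]: "duhamel F s \<in> borel_measurable borel" for s by (rule borel_measurable_continuous_onI)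
    show "(\<lambda>x. u (0 + h) x + duhamel F (0 + h) x / 2) \<in> borel_measurable borel" for h by measurable
  qed (auto simp: field_simps)
  have [measurable]: "prim ?P \<in> borel_measurable borel" "prim ?N \<in> borel_measurable borel"
    using prim_continuous[OF P] prim_continuous[OF N] by (auto intro: borel_measurable_continuous_onI)
  have D2: "has_L2_time_deriv (\<lambda>h x. prim ?P (x + h) / 2 - prim ?N (x - h) / 2) (\<lambda>x. (?P x + ?N x) / 2) 0"
  proof (rule has_L2_time_deriv_lincomb[of "\<lambda>h x. prim ?P (x + h)" ?P 0 "\<lambda>h x. prim ?N (x - h)" "\<lambda>x. - ?N x" 0 _ "1/2" "-1/2"])
    show "has_L2_time_deriv (\<lambda>h x. prim ?P (x + h)) ?P 0"
      by (rule has_L2_time_deriv_moving_prim(1)[OF cP, of "1 + \<bar>t\<bar>"]) (auto intro: left_char_zero[OF F])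
    show "has_L2_time_deriv (\<lambda>h x. prim ?N (x - h)) (\<lambda>x. - ?N x) 0"
      by (rule has_L2_time_deriv_moving_prim(2)[OF cN, of "1 + \<bar>t\<bar>"]) (auto intro: right_char_zero[OF F])
  qed (auto simp: field_simps)
  have D3: "has_L2_time_deriv ?w (\<lambda>x. u1 x - (?P x + ?N x) / 2) (- t)"
  proof (rule has_L2_time_deriv_lincomb[OF D1 D2, of _ 1 "-1"])
    show "AE x in lborel. u1 x - (?P x + ?N x) / 2 = 1 * u1 x + -1 * ((?P x + ?N x) / 2)"
      by (intro AE_I2) (simp only: mult_1 mult_minus_left diff_conv_add_uminus)
    show "?w (- t + h) \<in> borel_measurable borel" for h by (rule wm)
    show "AE x in lborel. ?w (- t + h) x - ?w (- t) x =
        1 * (u (0 + h) x + duhamel F (0 + h) x / 2 - (u 0 x + duhamel F 0 x / 2))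
      + -1 * (prim ?P (x + (0 + h)) / 2 - prim ?N (x - (0 + h)) / 2 - (prim ?P (x + 0) / 2 - prim ?N (x - 0) / 2))" for h
      using w[of "-t + h"] w[of "-t"] rep[of h] rep[of 0]
    proof eventually_elim
      case (elim x)
      show ?case using elim by (simp add: pk1 pk2 field_simps)
    qed
  qed simp
  show "AE x in lborel. snd W x = u1 x - (?P x + ?N x) / 2"
    using L2_time_deriv_AE_eq(2)[OF D3] by (simp add: W)
  show "snd W \<in> L2" using L2_time_deriv_AE_eq(1)[OF D3] by (simp add: W has_L2_time_deriv_def)
qed

section \<open>The norm of the weighted space\<close>

text \<open>The square of the weighted \<open>L\<^sup>2\<close> norm.\<close>

abbreviation weighted_square :: "(real \<Rightarrow> real) \<Rightarrow> real" where
  "weighted_square f \<equiv> (LINT x|lborel. (f x)\<^sup>2 / jap x)"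

text \<open>Division by the square root of the weight reduces the weighted space to \<open>L\<^sup>2\<close>.\<close>

lemma weighted_L2_iff:
  "f \<in> weighted_L2 \<longleftrightarrow> f \<in> borel_measurable borel \<and> (\<lambda>x. f x / sqrt (jap x)) \<in> L2"
proof -
  have sq: "(f x / sqrt (jap x))\<^sup>2 = (f x)\<^sup>2 / jap x" for x
    by (simp add: power_divide less_imp_le)
  have "(\<lambda>x. f x / sqrt (jap x)) \<in> borel_measurable borel" if [measurable]: "f \<in> borel_measurable borel"
    by measurable
  then show ?thesis by (auto simp: weighted_L2_def L2_def sq)
qed

lemma weighted_L2_lincomb:
  assumes "f \<in> weighted_L2" "g \<in> weighted_L2"
  shows "(\<lambda>x. p * f x + q * g x) \<in> weighted_L2"
    and "weighted_square (\<lambda>x. p * f x + q * g x) \<le> 2 * p\<^sup>2 * weighted_square f + 2 * q\<^sup>2 * weighted_square g"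
proof -
  have sq: "(h x / sqrt (jap x))\<^sup>2 = (h x)\<^sup>2 / jap x" for x and h :: "real \<Rightarrow> real"
    by (simp add: power_divide less_imp_le)
  have [measurable]: "f \<in> borel_measurable borel" "g \<in> borel_measurable borel"
    using assms by (auto simp: weighted_L2_iff)
  have L: "(\<lambda>x. f x / sqrt (jap x)) \<in> L2" "(\<lambda>x. g x / sqrt (jap x)) \<in> L2"
    using assms by (auto simp: weighted_L2_iff)
  have eq: "p * (f x / sqrt (jap x)) + q * (g x / sqrt (jap x)) = (p * f x + q * g x) / sqrt (jap x)" for x
    by (simp add: add_divide_distrib)
  have "(\<lambda>x. p * f x + q * g x) \<in> borel_measurable borel" by measurable
  then show "(\<lambda>x. p * f x + q * g x) \<in> weighted_L2"
    using L2_lincomb(1)[OF L, of p q] unfolding eq weighted_L2_iff by blast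
  show "weighted_square (\<lambda>x. p * f x + q * g x) \<le> 2 * p\<^sup>2 * weighted_square f + 2 * q\<^sup>2 * weighted_square g"
    using L2_lincomb(2)[OF L, of p q] unfolding eq sq sq[of "\<lambda>x. p * f x + q * g x"] .
qed

lemma weighted_L2_diff:
  assumes "f \<in> weighted_L2" "g \<in> weighted_L2"
  shows "(\<lambda>x. f x - g x) \<in> weighted_L2"
  using weighted_L2_lincomb(1)[OF assms, of 1 "-1"] by simp

lemma L2_imp_weighted_L2:
  assumes "f \<in> L2" shows "f \<in> weighted_L2"
proof -
  have [measurable]: "f \<in> borel_measurable borel" using assms by auto
  have "(\<lambda>x. f x / sqrt (jap x)) \<in> L2"
  proof (rule L2I_bound(1)[OF _ L2_integrable_square[OF assms]])
    show "AE x in lborel. (f x / sqrt (jap x))\<^sup>2 \<le> (f x)\<^sup>2"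
    proof (rule AE_I2)
      fix x
      have "(f x)\<^sup>2 / jap x \<le> (f x)\<^sup>2 / 1" using jap_ge(1)[of x] by (intro frac_le) auto
      then show "(f x / sqrt (jap x))\<^sup>2 \<le> (f x)\<^sup>2" by (simp add: power_divide less_imp_le)
    qed
  qed measurable
  then show ?thesis by (simp add: weighted_L2_iff)
qed

lemma weighted_square_nonneg: "0 \<le> weighted_square f"
  by (intro integral_nonneg_AE AE_I2) (simp add: less_imp_le)

lemma weighted_square_eq_0:
  assumes f: "f \<in> weighted_L2" and z: "weighted_square f = 0"
  shows "AE x in lborel. f x = 0"
proof -
  have "integrable lborel (\<lambda>x. (f x)\<^sup>2 / jap x)" using f by (simp add: weighted_L2_def)
  then have "AE x in lborel. (f x)\<^sup>2 / jap x = 0"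
    using z by (subst integral_nonneg_eq_0_iff_AE[symmetric]) (auto simp: less_imp_le)
  then show ?thesis
  proof eventually_elim
    case (elim x)
    then show ?case using jap_pos[of x] by (simp del: jap_pos)
  qed
qed

lemma weighted_square_cong_AE:
  assumes [measurable]: "f \<in> borel_measurable borel" "g \<in> borel_measurable borel"
    and "AE x in lborel. f x = g x"
  shows "weighted_square f = weighted_square g"
  by (rule integral_cong_AE) (use assms(3) in auto)

text \<open>A limit in the weighted norm is unique up to null sets.\<close>

lemma weighted_limit_unique:
  assumes d: "\<And>t. d t \<in> weighted_L2" and f: "f \<in> weighted_L2" and g: "g \<in> weighted_L2"
    and lf: "((\<lambda>t. weighted_square (\<lambda>x. d t x - f x)) \<longlongrightarrow> 0) F"
    and lg: "((\<lambda>t. weighted_square (\<lambda>x. d t x - g x)) \<longlongrightarrow> 0) F" and F: "F \<noteq> bot"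
  shows "AE x in lborel. f x = g x"
proof -
  have "weighted_square (\<lambda>x. f x - g x) \<le> 2 * weighted_square (\<lambda>x. d t x - f x) + 2 * weighted_square (\<lambda>x. d t x - g x)" for t
    using weighted_L2_lincomb(2)[OF weighted_L2_diff[OF d f] weighted_L2_diff[OF d g], of "-1" t 1 t] by simp
  moreover have "((\<lambda>t. 2 * weighted_square (\<lambda>x. d t x - f x) + 2 * weighted_square (\<lambda>x. d t x - g x)) \<longlongrightarrow> 2 * 0 + 2 * 0) F"
    by (intro tendsto_intros lf lg)
  ultimately have "weighted_square (\<lambda>x. f x - g x) \<le> 2 * 0 + 2 * 0"
    by (intro tendsto_lowerbound[OF _ _ F]) (auto intro!: always_eventually)
  then have "weighted_square (\<lambda>x. f x - g x) = 0"
    using weighted_square_nonneg[of "\<lambda>x. f x - g x"] by simp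
  from weighted_square_eq_0[OF weighted_L2_diff[OF f g] this] show ?thesis by simp
qed

text \<open>Convergence in the norm of \<open>Y\<close> splits into convergence of the weak derivatives of the first
  components and convergence of the second components.  It suffices to know these
  up to null sets, as \<open>d t\<close> and \<open>e t\<close>.\<close>

lemma Y_norm_tendsto_0_iff:
  assumes \<eta>: "mollifier \<eta>"
    and W1: "\<And>t. has_weak_deriv (fst (W t)) (d t)"
    and W2: "\<And>t. snd (W t) \<in> borel_measurable borel" "\<And>t. AE x in lborel. snd (W t) x = e t x"
    and e: "\<And>t. e t \<in> borel_measurable borel"
    and U: "has_weak_deriv U \<alpha>" and V: "V \<in> borel_measurable borel"
  shows "((\<lambda>t. Y_norm (W t - (U, V))) \<longlongrightarrow> 0) F \<longleftrightarrow>
    ((\<lambda>t. weighted_square (\<lambda>x. d t x - \<alpha> x)) \<longlongrightarrow> 0) F \<and> ((\<lambda>t. weighted_square (\<lambda>x. e t x - V x)) \<longlongrightarrow> 0) F"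
    (is "?L \<longleftrightarrow> (?a \<longlongrightarrow> 0) F \<and> (?b \<longlongrightarrow> 0) F")
proof -
  have [measurable]: "d t \<in> borel_measurable borel" "\<alpha> \<in> borel_measurable borel"
    "e t \<in> borel_measurable borel" "V \<in> borel_measurable borel" "snd (W t) \<in> borel_measurable borel" for t
    using W1[of t] U e V W2(1) by (auto simp: has_weak_deriv_def)
  have Y: "Y_norm (W t - (U, V)) = sqrt (?a t + ?b t)" for t
  proof -
    have diff: "W t - (U, V) = (\<lambda>x. fst (W t) x - U x, \<lambda>x. snd (W t) x - V x)"
      by (cases "W t") (simp add: fun_diff_def)
    have wd: "has_weak_deriv (\<lambda>x. fst (W t) x - U x) (\<lambda>x. d t x - \<alpha> x)" by (rule has_weak_deriv_diff[OF W1 U])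
    have "weak_deriv (\<lambda>x. fst (W t) x - U x) \<in> borel_measurable borel"
      using weak_deriv_AE_eq(2)[OF \<eta> wd] by (auto simp: has_weak_deriv_def)
    then have 1: "weighted_square (weak_deriv (\<lambda>x. fst (W t) x - U x)) = ?a t"
      using weak_deriv_AE_eq(1)[OF \<eta> wd] by (intro weighted_square_cong_AE) simp_all
    have "AE x in lborel. snd (W t) x - V x = e t x - V x" using W2(2)[of t] by eventually_elim simp
    then have 2: "weighted_square (\<lambda>x. snd (W t) x - V x) = ?b t" by (intro weighted_square_cong_AE) simp_all
    show ?thesis unfolding Y_norm_def diff by (simp add: 1 2)
  qed
  have nn: "0 \<le> ?a t" "0 \<le> ?b t" for t by (rule weighted_square_nonneg)+
  show ?thesis
  proof
    assume ?L
    then have "((\<lambda>t. (sqrt (?a t + ?b t))\<^sup>2) \<longlongrightarrow> 0\<^sup>2) F" unfolding Y by (rule tendsto_power)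
    then have s: "((\<lambda>t. ?a t + ?b t) \<longlongrightarrow> 0) F" using nn by simp
    show "(?a \<longlongrightarrow> 0) F \<and> (?b \<longlongrightarrow> 0) F"
      by (intro conjI tendsto_sandwich[OF _ _ tendsto_const s] always_eventually allI) (use nn in auto)
  next
    assume "(?a \<longlongrightarrow> 0) F \<and> (?b \<longlongrightarrow> 0) F"
    then have "((\<lambda>t. sqrt (?a t + ?b t)) \<longlongrightarrow> sqrt (0 + 0)) F" by (intro tendsto_intros) auto
    then show ?L unfolding Y by simp
  qed
qed

section \<open>Scattering\<close>

lemma admissible_zero:
  assumes K: "admissible K" and x: "1 \<le> \<bar>x\<bar>"
  shows "K x = 0"
proof -
  have c: "continuous_on UNIV K" using K smooth_continuous by (simp add: admissible_def)
  have out: "K x = 0" if "1 < \<bar>x\<bar>" for x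
  proof (rule ccontr)
    assume "K x \<noteq> 0"
    then have "x \<in> closure {x. K x \<noteq> 0}" using closure_subset[of "{x. K x \<noteq> 0}"] by auto
    then have "x \<in> {-1..1}" using K by (auto simp: admissible_def)
    then show False using that by auto
  qed
  \<comment> \<open>The support condition allows the endpoints; there \<open>K\<close> vanishes by continuity.\<close>
  show ?thesis
  proof (cases "x = 1 \<or> x = -1")
    case True
    have lim: "(\<lambda>n. K (x * (1 + 1 / real (Suc n)))) \<longlonglongrightarrow> K (x * (1 + 0))"
    proof (rule continuous_on_tendsto_compose[OF c])
      show "(\<lambda>n. x * (1 + 1 / real (Suc n))) \<longlonglongrightarrow> x * (1 + 0)"
        by (intro tendsto_intros LIMSEQ_Suc lim_1_over_n)
    qed auto
    have "K (x * (1 + 1 / real (Suc n))) = 0" for n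
      using True by (intro out) (auto simp: abs_mult)
    then have "(\<lambda>n. 0) \<longlonglongrightarrow> K x" using lim by simp
    then show ?thesis by (simp add: LIMSEQ_const_iff)
  next
    case False
    then show ?thesis using x by (intro out) auto
  qed
qed

text \<open>The coupling function itself, normalized, serves as the mollifier.\<close>

lemma mollifier_of_admissible:
  assumes K: "admissible K" shows "\<exists>\<eta>. mollifier \<eta>"
proof -
  have sm: "smooth K" and nn: "\<And>x. 0 \<le> K x" and K0: "0 < K 0" using K by (auto simp: admissible_def)
  have c: "continuous_on UNIV K" using sm by (rule smooth_continuous)
  define m where "m = (LINT x:{-1..1}|lborel. K x)"
  have m: "m = integral {-1..1} K"
    unfolding m_def
    by (intro set_borel_integral_eq_integral(2) locally_integrable_interval locally_integrable_continuous c)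
  have cI: "continuous_on {-1..1} K" using c by (rule continuous_on_subset) simp
  have "m \<noteq> 0"
  proof
    assume "m = 0"
    then have "\<forall>x\<in>{-1..1}. K x = 0"
      using integral_eq_0_iff[OF cI] nn m by simp
    then show False using K0 by (metis atLeastAtMost_iff less_irrefl neg_le_0_iff_le zero_le_one)
  qed
  have "mollifier (\<lambda>x. (1 / m) * K x)"
    unfolding mollifier_def
  proof (intro conjI allI impI)
    show "smooth (\<lambda>x. (1 / m) * K x)" using smooth_affine_lincomb[OF sm sm, of "1 / m" 0 1 0 0 0] by simp
    show "(1 / m) * K x = 0" if "1 \<le> \<bar>x\<bar>" for x using admissible_zero[OF K that] by simp
    show "(LINT x:{-1..1}|lborel. (1 / m) * K x) = 1"
      using \<open>m \<noteq> 0\<close> by (simp add: m_def)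
  qed
  then show ?thesis by blast
qed

text \<open>For data supported in \<open>{-R..R}\<close> the free wave is constant inside the light cone: the values of
  \<open>u0\<close> at \<open>x + t\<close> and \<open>x - t\<close> vanish, and only half the total integral of \<open>u1\<close> is left.\<close>

lemma free_wave_constant_in_cone:
  assumes a: "locally_integrable a" and u1: "locally_integrable u1"
    and u0: "AE x in lborel. u0 x = c + prim a x"
    and z0: "AE x in lborel. R < \<bar>x\<bar> \<longrightarrow> u0 x = 0" and z1: "AE x in lborel. R < \<bar>x\<bar> \<longrightarrow> u1 x = 0"
    and R: "0 \<le> R" and xt: "R + 1 \<le> x + t" "x - t \<le> - (R + 1)"
  shows "c + prim (\<lambda>x. a x + u1 x) (x + t) / 2 - prim (\<lambda>x. u1 x - a x) (x - t) / 2
    = (prim u1 (R + 1) - prim u1 (- (R + 1))) / 2"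
proof -
  have pa: "c + prim a y = 0" if "R < \<bar>y\<bar>" for y
  proof -
    \<comment> \<open>The cutoff factor makes the identity hold almost everywhere on the whole line, so that
      continuity gives it everywhere.\<close>
    have "(c + prim a y) * max 0 (\<bar>y\<bar> - R) = 0" for y
    proof (rule continuous_AE_eq[where f = "\<lambda>y. (c + prim a y) * max 0 (\<bar>y\<bar> - R)" and g = "\<lambda>_. 0"])
      show "continuous_on UNIV (\<lambda>y. (c + prim a y) * max 0 (\<bar>y\<bar> - R))"
        by (intro continuous_intros prim_continuous a)
      show "AE y in lborel. (c + prim a y) * max 0 (\<bar>y\<bar> - R) = 0"
        using u0 z0 by eventually_elim (auto simp: max_def)
    qed simp
    from this[of y] show ?thesis using that by (auto simp: max_def split: if_splits)
  qed
  have const: "prim u1 b = prim u1 b'" if "b \<le> b'" "\<And>y. b \<le> y \<Longrightarrow> y \<le> b' \<Longrightarrow> R < \<bar>y\<bar>" for b b'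
  proof -
    have "prim u1 b' - prim u1 b = (LINT y:{b..b'}|lborel. u1 y)"
      by (rule integral_eq_prim[OF u1 that(1), symmetric])
    also have "\<dots> = (LINT y:{b..b'}|lborel. 0)"
    proof (rule set_lebesgue_integral_cong_AE)
      show "AE y\<in>{b..b'} in lborel. u1 y = 0"
        using z1 by eventually_elim (use that(2) in auto)
    qed (use u1 in auto)
    finally show ?thesis by simp
  qed
  have 1: "prim u1 (R + 1) = prim u1 (x + t)" by (rule const) (use xt R in auto)
  have 2: "prim u1 (x - t) = prim u1 (- (R + 1))" by (rule const) (use xt R in auto)
  have 3: "c + prim a (x + t) = 0" "c + prim a (x - t) = 0" by (rule pa, use xt R in auto)+
  have 4: "prim a (x + t) = - c" "prim a (x - t) = - c" using 3 by simp_all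
  show ?thesis
    unfolding prim_add[OF a u1] prim_diff[OF u1 a] 1 2[symmetric] 4 by (simp add: field_simps)
qed

lemma ess_compact_support_interval:
  assumes "ess_compact_support f"
  shows "\<exists>R\<ge>0. AE x in lborel. R < \<bar>x\<bar> \<longrightarrow> f x = 0"
proof -
  obtain C where C: "compact C" "AE x in lborel. x \<notin> C \<longrightarrow> f x = 0"
    using assms by (auto simp: ess_compact_support_def)
  obtain R where R: "R > 0" "\<forall>x\<in>C. norm x \<le> R"
    using compact_imp_bounded[OF C(1)] unfolding bounded_pos by blast
  have "AE x in lborel. R < \<bar>x\<bar> \<longrightarrow> f x = 0"
    using C(2) by eventually_elim (use R(2) in force)
  then show ?thesis using R(1) by (intro exI[of _ R]) auto
qed

theorem theorem1p1:
  fixes K u0 u1 :: "real \<Rightarrow> real" and u :: "real \<Rightarrow> real \<Rightarrow> real"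
  assumes "admissible K"
    and "(u0, u1) \<in> X_space"
    and "global_solution K u0 u1 u"
  shows "\<exists>U V. (U, V) \<in> Y_space \<and> scatters_to u (U, V) \<and>
           (\<forall>U' V'. (U', V') \<in> Y_space \<and> scatters_to u (U', V') \<longrightarrow> Y_eq (U', V') (U, V))"
proof -
  have smK: "smooth K" and Knn: "\<And>x. 0 \<le> K x" using assms(1) by (auto simp: admissible_def)
  have cK: "continuous_on UNIV K" using smK by (rule smooth_continuous)
  have K0: "\<And>x. 1 \<le> \<bar>x\<bar> \<Longrightarrow> K x = 0" by (rule admissible_zero[OF assms(1)])
  obtain \<eta> where \<eta>: "mollifier \<eta>" using mollifier_of_admissible[OF assms(1)] by blast
  have CH: "C_H1 u" and CL: "C1_L2 u"
    and duh: "\<And>t. AE x in lborel. u t x = linear_wave u0 u1 t x -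
          (LBINT s=ereal 0..ereal t. (LBINT y=ereal (x - (t - s))..ereal (x + (t - s)). K y * (u s y) ^ 3)) / 2"
    using assms(3) by (auto simp: global_solution_def)
  have u0H: "u0 \<in> H1" and u1L: "u1 \<in> L2" and s0: "ess_compact_support u0" and s1: "ess_compact_support u1"
    using assms(2) by (auto simp: X_space_def)
  obtain a where aL: "a \<in> L2" and wa: "has_weak_deriv u0 a" using u0H by (auto simp: H1_def)
  obtain c where u0: "AE x in lborel. u0 x = c + prim a x" using AE_prim_if_has_weak_deriv[OF \<eta> wa] by blast
  have a: "locally_integrable a" and u1: "locally_integrable u1"
    using aL u1L by (auto intro: L2_locally_integrable)
  have [measurable]: "a \<in> borel_measurable borel" "u1 \<in> borel_measurable borel" using a u1 by auto
  have um [measurable]: "u s \<in> borel_measurable borel" for s using CL by (auto simp: C1_L2_def)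
  have [measurable]: "K \<in> borel_measurable borel" using cK by (rule borel_measurable_continuous_onI)

  obtain v where cv: "continuous_on UNIV (\<lambda>(t, x). v t x)" and uv: "\<And>t. AE x in lborel. u t x = v t x"
    using C_H1_continuous_representative[OF \<eta> CH] by blast
  have cvt: "continuous_on UNIV (v t)" for t
    by (intro continuous_on_uncurry_compose[OF cv] continuous_intros)
  have [measurable]: "v t \<in> borel_measurable borel" for t using cvt by (rule borel_measurable_continuous_onI)
  define F where "F s y = K y * v s y ^ 3" for s y
  have F: "localized_source F"
    unfolding localized_source_def
  proof (intro conjI allI impI)
    show "continuous_on UNIV (\<lambda>(s, y). F s y)"
      unfolding F_def split_beta
      by (intro continuous_intros continuous_on_compose2[OF cK] continuous_on_uncurry_compose[OF cv]) auto
    show "F s y = 0" if "1 \<le> \<bar>y\<bar>" for s y using K0[OF that] by (simp add: F_def)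
  qed
  have inner: "(LBINT y=ereal p..ereal q. K y * (u s y) ^ 3) = (LBINT y=ereal p..ereal q. F s y)" for p q s
  proof (rule interval_integral_cong_AE)
    show "AE y\<in>einterval (min (ereal p) (ereal q)) (max (ereal p) (ereal q)) in lborel. K y * u s y ^ 3 = F s y"
      using uv[of s] by eventually_elim (simp add: F_def)
  qed (simp_all add: F_def)
  let ?A = "\<lambda>x. a x + u1 x" and ?B = "\<lambda>x. u1 x - a x"
  have A: "locally_integrable ?A" and B: "locally_integrable ?B"
    by (intro locally_integrable_add locally_integrable_diff a u1)+
  have rep: "AE x in lborel. u t x = c + prim ?A (x + t) / 2 - prim ?B (x - t) / 2 - duhamel F t x / 2" for t
    using duh[of t] linear_wave_null_form[OF a u1 u0, of t]
    by eventually_elim (simp add: inner duhamel_def)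
  \<comment> \<open>Both sides are continuous, so the Duhamel formula holds for the representative at every point.\<close>
  have vrep: "v t x = c + prim ?A (x + t) / 2 - prim ?B (x - t) / 2 - duhamel F t x / 2" for t x
  proof (rule continuous_AE_eq[OF cvt])
    show "continuous_on UNIV (\<lambda>x. c + prim ?A (x + t) / 2 - prim ?B (x - t) / 2 - duhamel F t x / 2)"
      by (intro continuous_intros continuous_on_compose2[OF prim_continuous[OF A]]
          continuous_on_compose2[OF prim_continuous[OF B]] continuous_on_uncurry_compose[OF duhamel_continuous[OF F]]) auto
    show "AE x in lborel. v t x = c + prim ?A (x + t) / 2 - prim ?B (x - t) / 2 - duhamel F t x / 2"
      using rep[of t] uv[of t] by eventually_elim simp
  qed

  \<comment> \<open>From time \<open>R + 2\<close> on, the free wave is constant on the support of \<open>K\<close>.\<close>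
  obtain R0 where R0: "0 \<le> R0" "AE x in lborel. R0 < \<bar>x\<bar> \<longrightarrow> u0 x = 0"
    using ess_compact_support_interval[OF s0] by blast
  obtain R1 where R1: "0 \<le> R1" "AE x in lborel. R1 < \<bar>x\<bar> \<longrightarrow> u1 x = 0"
    using ess_compact_support_interval[OF s1] by blast
  define R where "R = max R0 R1"
  have R: "0 \<le> R" "AE x in lborel. R < \<bar>x\<bar> \<longrightarrow> u0 x = 0" "AE x in lborel. R < \<bar>x\<bar> \<longrightarrow> u1 x = 0"
    using R0 R1 by (auto simp: R_def)
  let ?P = "left_char F" and ?N = "right_char F"
  obtain C where C: "\<forall>t\<ge>R + 2. \<forall>M\<ge>t + 1. integral {-M..M} (\<lambda>z. (?P t z)\<^sup>2) \<le> C \<and>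
      integral {-M..M} (\<lambda>z. (?N t z)\<^sup>2) \<le> C"
  proof -
    have "\<exists>C. \<forall>t\<ge>R + 2. \<forall>M\<ge>t + 1. integral {-M..M} (\<lambda>z. (?P t z)\<^sup>2) \<le> C \<and>
      integral {-M..M} (\<lambda>z. (?N t z)\<^sup>2) \<le> C"
    proof (rule energy_bound[OF cK Knn K0 F])
      show "F s y = K y * v s y ^ 3" for s y by (simp add: F_def)
      show "0 \<le> R + 2" using R(1) by simp
      show "v t x = (prim u1 (R + 1) - prim u1 (- (R + 1))) / 2 - duhamel F t x / 2"
        if "R + 2 \<le> t" "\<bar>x\<bar> \<le> 1" for t x
      proof -
        have "R + 1 \<le> x + t" "x - t \<le> - (R + 1)" using that by auto
        from free_wave_constant_in_cone[OF a u1 u0 R(2,3,1) this] show ?thesis by (simp add: vrep)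
      qed
    qed
    then show ?thesis using that by blast
  qed

  \<comment> \<open>The final values of the characteristic integrals; these are attained at time \<open>\<bar>z\<bar> + 1\<close>.\<close>
  define P where "P z = ?P (\<bar>z\<bar> + 1) z" for z
  define N where "N z = ?N (\<bar>z\<bar> + 1) z" for z
  have cP: "continuous_on UNIV (\<lambda>(t, z). ?P t z)" and cN: "continuous_on UNIV (\<lambda>(t, z). ?N t z)"
    unfolding split_beta by (intro left_char_continuous right_char_continuous F continuous_intros)+
  have bP: "integral {-M..M} (\<lambda>z. (?P t z)\<^sup>2) \<le> C" and bN: "integral {-M..M} (\<lambda>z. (?N t z)\<^sup>2) \<le> C"
    if "R + 2 \<le> t" "t + 1 \<le> M" for t M using C that by auto
  have PL: "P \<in> L2" and limP: "((\<lambda>t. weighted_square (\<lambda>z. ?P t z - P z)) \<longlongrightarrow> 0) at_top"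
    unfolding P_def
    using weighted_convergence_if_stationary[OF cP left_char_stationary[OF F] bP] by blast+
  have NL: "N \<in> L2" and limN: "((\<lambda>t. weighted_square (\<lambda>z. ?N t z - N z)) \<longlongrightarrow> 0) at_top"
    unfolding N_def
    using weighted_convergence_if_stationary[OF cN right_char_stationary[OF F] bN] by blast+
  have charL: "?P t \<in> L2" "?N t \<in> L2" for t
  proof -
    show "?P t \<in> L2"
      by (rule L2_continuous_bounded_support[where r = "1 + \<bar>t\<bar>"])
        (auto intro!: left_char_continuous left_char_zero F continuous_intros)
    show "?N t \<in> L2"
      by (rule L2_continuous_bounded_support[where r = "1 + \<bar>t\<bar>"])
        (auto intro!: right_char_continuous right_char_zero F continuous_intros)
  qed

  \<comment> \<open>\<open>d t\<close> is the weak derivative of the first component of \<open>W t\<close>, and \<open>e t\<close> is its second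
    component; \<open>\<alpha>\<close> and \<open>V\<close> are their limits.\<close>
  define W where "W t = wave_group (- t) (u t, L2_time_deriv u t)" for t
  define d where "d t x = a x - (?P t x - ?N t x) / 2" for t x
  define e where "e t x = u1 x - (?P t x + ?N t x) / 2" for t x
  have du: "\<exists>v. has_L2_time_deriv u v s" for s using CL by (auto simp: C1_L2_def)
  note WG = wave_group_of_solution[OF F a u1 um du rep]
  have W1: "has_weak_deriv (fst (W t)) (d t)" for t unfolding W_def d_def using WG(1) .
  have W2: "snd (W t) \<in> borel_measurable borel" "AE x in lborel. snd (W t) x = e t x" for t
    unfolding W_def e_def using WG(2,3)[of t] by auto
  define \<alpha> where "\<alpha> x = a x - (P x - N x) / 2" for x
  define V where "V x = u1 x - (P x + N x) / 2" for x
  have dL: "d t \<in> L2" and eL: "e t \<in> L2" for t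
    using L2_lincomb(1)[OF aL L2_diff[OF charL], of 1 "-1/2" t t] L2_lincomb(1)[OF u1L L2_add[OF charL], of 1 "-1/2" t t]
    by (simp_all add: d_def[abs_def] e_def[abs_def])
  have \<alpha>L: "\<alpha> \<in> L2" and VL: "V \<in> L2"
    using L2_lincomb(1)[OF aL L2_diff[OF PL NL], of 1 "-1/2"] L2_lincomb(1)[OF u1L L2_add[OF PL NL], of 1 "-1/2"]
    by (simp_all add: \<alpha>_def[abs_def] V_def[abs_def])
  have dw: "d t \<in> weighted_L2" and ew: "e t \<in> weighted_L2" for t
    using dL eL by (auto intro: L2_imp_weighted_L2)
  have \<alpha>w: "\<alpha> \<in> weighted_L2" and Vw: "V \<in> weighted_L2" using \<alpha>L VL by (auto intro: L2_imp_weighted_L2)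
  have l\<alpha>: "locally_integrable \<alpha>" using \<alpha>L by (rule L2_locally_integrable)
  define U where "U = prim \<alpha>"
  have wU: "has_weak_deriv U \<alpha>"
    unfolding U_def using prim_continuous[OF l\<alpha>]
    by (intro has_weak_deriv_if_AE_prim[where c = 0] l\<alpha> borel_measurable_continuous_onI) auto
  have scatters: "scatters_to u (U', V') \<longleftrightarrow>
      ((\<lambda>t. weighted_square (\<lambda>x. d t x - \<alpha>' x)) \<longlongrightarrow> 0) at_top \<and> ((\<lambda>t. weighted_square (\<lambda>x. e t x - V' x)) \<longlongrightarrow> 0) at_top"
    if "has_weak_deriv U' \<alpha>'" "V' \<in> borel_measurable borel" for U' V' \<alpha>'
    using Y_norm_tendsto_0_iff[where W = W and d = d and e = e and F = at_top, OF \<eta> W1 W2 _ that] eL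
    by (auto simp: scatters_to_def W_def)
  have limd: "((\<lambda>t. weighted_square (\<lambda>x. d t x - \<alpha> x)) \<longlongrightarrow> 0) at_top"
    and lime: "((\<lambda>t. weighted_square (\<lambda>x. e t x - V x)) \<longlongrightarrow> 0) at_top"
  proof -
    have wP: "(\<lambda>z. ?P t z - P z) \<in> weighted_L2" and wN: "(\<lambda>z. ?N t z - N z) \<in> weighted_L2" for t
      by (intro L2_imp_weighted_L2 L2_diff charL PL NL)+
    let ?s = "\<lambda>t. weighted_square (\<lambda>z. ?P t z - P z) / 2 + weighted_square (\<lambda>z. ?N t z - N z) / 2"
    have deq: "d t x - \<alpha> x = (-1/2) * (?P t x - P x) + (1/2) * (?N t x - N x)"
      and eeq: "e t x - V x = (-1/2) * (?P t x - P x) + (-1/2) * (?N t x - N x)" for t x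
      by (simp_all add: d_def \<alpha>_def e_def V_def field_simps)
    have le: "weighted_square (\<lambda>x. d t x - \<alpha> x) \<le> ?s t" "weighted_square (\<lambda>x. e t x - V x) \<le> ?s t" for t
      unfolding deq eeq
      using weighted_L2_lincomb(2)[OF wP wN, of "-1/2" t "1/2" t] weighted_L2_lincomb(2)[OF wP wN, of "-1/2" t "-1/2" t]
      by (simp_all add: power2_eq_square)
    have "(?s \<longlongrightarrow> 0 / 2 + 0 / 2) at_top" by (intro tendsto_intros limP limN) simp_all
    then have s: "(?s \<longlongrightarrow> 0) at_top" by simp
    show "((\<lambda>t. weighted_square (\<lambda>x. d t x - \<alpha> x)) \<longlongrightarrow> 0) at_top"
      by (rule tendsto_sandwich[OF _ _ tendsto_const s]) (intro always_eventually allI weighted_square_nonneg le)+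
    show "((\<lambda>t. weighted_square (\<lambda>x. e t x - V x)) \<longlongrightarrow> 0) at_top"
      by (rule tendsto_sandwich[OF _ _ tendsto_const s]) (intro always_eventually allI weighted_square_nonneg le)+
  qed
  have 1: "(U, V) \<in> Y_space" using wU \<alpha>w Vw by (auto simp: Y_space_def)
  have 2: "scatters_to u (U, V)" using scatters[OF wU] VL limd lime by blast
  have 3: "Y_eq (U', V') (U, V)" if Y: "(U', V') \<in> Y_space" and sc: "scatters_to u (U', V')" for U' V'
  proof -
    obtain \<alpha>' where \<alpha>': "\<alpha>' \<in> weighted_L2" "has_weak_deriv U' \<alpha>'" and V': "V' \<in> weighted_L2"
      using Y by (auto simp: Y_space_def)
    have V'm: "V' \<in> borel_measurable borel" using V' by (simp add: weighted_L2_iff)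
    have lims: "((\<lambda>t. weighted_square (\<lambda>x. d t x - \<alpha>' x)) \<longlongrightarrow> 0) at_top"
      "((\<lambda>t. weighted_square (\<lambda>x. e t x - V' x)) \<longlongrightarrow> 0) at_top"
      using scatters[OF \<alpha>'(2) V'm] sc by blast+
    have "AE x in lborel. \<alpha>' x = \<alpha> x"
      by (rule weighted_limit_unique[OF dw \<alpha>'(1) \<alpha>w lims(1) limd]) simp
    then have pr: "prim \<alpha>' x = prim \<alpha> x" for x
      using \<alpha>'(1) \<alpha>w by (intro prim_cong_AE) (simp_all add: weighted_L2_iff)
    obtain c' where "AE x in lborel. U' x = c' + prim \<alpha>' x" using AE_prim_if_has_weak_deriv[OF \<eta> \<alpha>'(2)] by blast
    then have "AE x in lborel. U' x = U x + c'" by eventually_elim (simp add: U_def pr)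
    moreover have "AE x in lborel. V' x = V x"
      by (rule weighted_limit_unique[OF ew V' Vw lims(2) lime]) simp
    ultimately show ?thesis by (auto simp: Y_eq_def)
  qed
  show ?thesis using 1 2 3 by blast
qed

end
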